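(* Consider an $N$-agent linear quadratic Gaussian game with horizon $T$ (as defined in the context). For every agent $i\in[N]$, at every time step $t<T$, the entropic cost equilibrium (ECE) policy $\pi^{i*}_t$ is a normal distribution $\mathcal{N}(\mu^i_t,\Sigma^i_t)$, where the mean $\mu^i_t$ and the covariance $\Sigma^i_t$ are computed by $$\mu^i_t=-P^i_ts_t-\alpha^i_t,\qquad \Sigma^i_t=\big(R^{ii}+{B^i}^{\mathsf T}Z^i_{t+1}B^i\big)^{-1}.$$ The matrices $P^i_t$ and the vectors $\alpha^i_t$ satisfy the following sets of linear equations (for all $i\in[N]$): $$\big[R^{ii}+{B^i}^{\mathsf T}Z^i_{t+1}B^i\big]P^i_t+{B^i}^{\mathsf T}Z^i_{t+1}\sum_{j\in[N],\,j\ne i}B^jP^j_t={B^i}^{\mathsf T}Z^i_{t+1}A,$$ $$\big[R^{ii}+{B^i}^{\mathsf T}Z^i_{t+1}B^i\big]\alpha^i_t+{B^i}^{\mathsf T}Z^i_{t+1}\sum_{j\in[N],\,j\ne i}B^j\alpha^j_t={B^i}^{\mathsf T}\xi^i_{t+1},$$ where $Z^i_t$ and $\xi^i_t$ are recursively computed from $$Z^i_t=F_t^{\mathsf T}Z^i_{t+1}F_t+\sum_{j\in[N]}{P^j_t}^{\mathsf T}R^{ij}P^j_t+Q^i,$$ $$\xi^i_t=F_t^{\mathsf T}\big(\xi^i_{t+1}+Z^i_{t+1}\beta_t\big)+\sum_{j\in[N]}{P^j_t}^{\mathsf T}R^{ij}\alpha^j_t,$$ with $$F_t=A-\sum_{j\in[N]}B^jP^j_t,\qquad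 \beta_t=-\sum_{j\in[N]}B^j\alpha^j_t,$$ and the terminal conditions are $$\xi^i_T=l^i,\qquad Z^i_T=Q^i.$$
   Context: There are $N\ge1$ agents, $[N]=\{1,\dots,N\}$; $\boldsymbol{a}_t=(a^1_t,\dots,a^N_t)$ is the joint action at time $t$, with $a^i_t\in\mathbb{R}^{m^i}$; the superscript $-i$ denotes all agents except $i$; $s_t\in\mathbb{R}^n$ is the joint state. Linear quadratic Gaussian game. The dynamics are $$s_{t+1}=As_t+\sum_{j\in[N]}B^ja^j_t+w_t,\qquad w_t\sim\mathcal{N}(0,I),$$ with known time-invariant matrices $A\in\mathbb{R}^{n\times n}$, $B^j\in\mathbb{R}^{n\times m^j}$, and for every $t\le T$ agent $i$ has the convex quadratic per-stage cost $$c^i(s_t,a^1_t,\dots,a^N_t)=\tfrac12\Big(s_t^{\mathsf T}Q^is_t+{l^i}^{\mathsf T}s_t+\sum_{j\in[N]}{a^j_t}^{\mathsf T}R^{ij}a^j_t\Big),$$ where $Q^i\in\mathbb{R}^{n\times n}$ is positive semi-definite, $l^i\in\mathbb{R}^n$, $R^{ij}\in\mathbb{R}^{m^j\times m^j}$ is positive semi-definite for $j\ne i$, and $R^{ii}$ is positive definite. Policies. Agent $i$ uses a stochastic Markovian policy $\pi^i=\{\pi^i_t\}_{t=1}^T$, where $\pi^i_t(a^i_t\mid s_t)$ is the probability (density) of agent $i$ taking action $a^i_t$ at time $t$ in state $s_t$; given $s_t$ the agents select their actions independently. $\boldsymbol{\pi}=\{\pi^i\}_{i=1}^N$. Q functions.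 For policies $\boldsymbol{\pi}$ and $t<T$, $$Q^i_{t,\boldsymbol{\pi}}(s_t,\boldsymbol{a}_t)=c^i(s_t,\boldsymbol{a}_t)+\mathbb{E}_{s_{t+1:T},\boldsymbol{\pi}}\Big[\sum_{k=t+1}^Tc^i(s_k,\boldsymbol{a}_k)\,\Big|\,s_t,\boldsymbol{a}_t\Big],$$ $Q^i_{T,\boldsymbol{\pi}}(s_T,\boldsymbol{a}_T)=c^i(s_T,\boldsymbol{a}_T)$, and for all $t\le T$ $$\bar Q^i_{t,\boldsymbol{\pi}}(s_t,a^i_t)=\mathbb{E}_{\boldsymbol{a}^{-i}_t\sim\boldsymbol{\pi}^{-i}_t(\cdot\mid s_t)}\,Q^i_{t,\boldsymbol{\pi}}(s_t,\boldsymbol{a}_t).$$ Entropic cost equilibrium (ECE). $\boldsymbol{\pi}^*$ is an ECE if and only if for every agent $i\in[N]$, every action $a^i_t$ and every time step $t\le T$ (and every state $s_t$), $$\pi^{i*}_t(a^i_t\mid s_t)=\frac{e^{-\bar Q^i_{t,\boldsymbol{\pi}^*}(s_t,a^i_t)}}{\int e^{-\bar Q^i_{t,\boldsymbol{\pi}^*}(s_t,\tilde a^i_t)}\,d\tilde a^i_t}.$$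
   Formalization: The recursion for ξ is corrected: ξ_T = l/2 and a summand l/2 is added to ξ_t at every stage (the printed version fails unless l = 0); the linear systems for P and α are assumed nonsingular at each backward step, since otherwise ECE means need not be affine in s. *)

theory Defs
  imports
    "HOL-Probability.Probability"
    "Jordan_Normal_Form.Gauss_Jordan_Elimination"
    "Jordan_Normal_Form.Determinant"
begin

text \<open>
  Agents have action spaces of different dimensions, so vectors and matrices are those of
  \<open>Jordan_Normal_Form\<close>, whose dimensions are terms. As \<open>HOL-Analysis\<close> has types and constants
  of the same names, these are qualified throughout.
\<close>

type_synonym rvec = "real Matrix.vec"
type_synonym rmat = "real Matrix.mat"
type_synonym joint_action = "nat \<Rightarrow> rvec"
type_synonym policies = "nat \<Rightarrow> nat \<Rightarrow> rvec \<Rightarrow> rvec \<Rightarrow> real"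

section \<open>Linear algebra and the multivariate normal distribution\<close>

definition vsum :: "nat \<Rightarrow> ('j \<Rightarrow> rvec) \<Rightarrow> 'j set \<Rightarrow> rvec" where
  "vsum d f J = Matrix.vec d (\<lambda>p. \<Sum>j\<in>J. vec_index (f j) p)"

definition msum :: "nat \<Rightarrow> nat \<Rightarrow> ('j \<Rightarrow> rmat) \<Rightarrow> 'j set \<Rightarrow> rmat" where
  "msum d e f J = Matrix.mat d e (\<lambda>pq. \<Sum>j\<in>J. index_mat (f j) pq)"

definition quad_form :: "rmat \<Rightarrow> rvec \<Rightarrow> real" where
  "quad_form M v = scalar_prod v (M *\<^sub>v v)"

definition pos_semidef :: "nat \<Rightarrow> rmat \<Rightarrow> bool" where
  "pos_semidef d M \<longleftrightarrow> M \<in> carrier_mat d d \<and> transpose_mat M = M \<and>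
     (\<forall>v\<in>carrier_vec d. 0 \<le> quad_form M v)"

definition pos_def :: "nat \<Rightarrow> rmat \<Rightarrow> bool" where
  "pos_def d M \<longleftrightarrow> M \<in> carrier_mat d d \<and> transpose_mat M = M \<and>
     (\<forall>v\<in>carrier_vec d. v \<noteq> 0\<^sub>v d \<longrightarrow> 0 < quad_form M v)"

text \<open>Meaningful for invertible matrices only.\<close>

definition minv :: "rmat \<Rightarrow> rmat" where
  "minv M = the (mat_inverse M)"

text \<open>Lebesgue measure on \<open>carrier_vec d\<close>, transported from the product space.\<close>

definition lborel_vec :: "nat \<Rightarrow> rvec measure" where
  "lborel_vec d = embed_measure (\<Pi>\<^sub>M k\<in>{..<d}. (lborel :: real measure)) (Matrix.vec d)"

text \<open>Lebesgue density of the normal distribution with mean \<open>\<mu>\<close> and (positive definite)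
  covariance matrix \<open>S\<close>.\<close>

definition mvn_density :: "rvec \<Rightarrow> rmat \<Rightarrow> rvec \<Rightarrow> real" where
  "mvn_density \<mu> S x =
     exp (- (1/2) * quad_form (minv S) (x - \<mu>)) / sqrt ((2 * pi) ^ dim_vec \<mu> * Determinant.det S)"

section \<open>The game\<close>

record lqg_game =
  num_agents :: nat
  horizon :: nat
  sdim :: nat                          \<comment> \<open>\<open>n\<close>\<close>
  adim :: "nat \<Rightarrow> nat"             \<comment> \<open>\<open>m\<^sup>i\<close>\<close>
  Am :: rmat
  Bm :: "nat \<Rightarrow> rmat"
  Qm :: "nat \<Rightarrow> rmat"
  lv :: "nat \<Rightarrow> rvec"
  Rm :: "nat \<Rightarrow> nat \<Rightarrow> rmat"

definition agents :: "lqg_game \<Rightarrow> nat set" where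
  "agents G = {1..num_agents G}"

definition valid_game :: "lqg_game \<Rightarrow> bool" where
  "valid_game G \<longleftrightarrow>
     1 \<le> num_agents G \<and>
     Am G \<in> carrier_mat (sdim G) (sdim G) \<and>
     (\<forall>i\<in>agents G.
        Bm G i \<in> carrier_mat (sdim G) (adim G i) \<and>
        pos_semidef (sdim G) (Qm G i) \<and>
        lv G i \<in> carrier_vec (sdim G) \<and>
        pos_def (adim G i) (Rm G i i) \<and>
        (\<forall>j\<in>agents G - {i}. pos_semidef (adim G j) (Rm G i j)))"

definition cost :: "lqg_game \<Rightarrow> nat \<Rightarrow> rvec \<Rightarrow> joint_action \<Rightarrow> real" where
  "cost G i s a = 1/2 * (quad_form (Qm G i) s + scalar_prod (lv G i) s
                         + (\<Sum>j\<in>agents G. quad_form (Rm G i j) (a j)))"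

section \<open>Policies and the law of trajectories\<close>

text \<open>\<open>\<pi> i t s\<close> is the density of agent \<open>i\<close>'s action at time \<open>t\<close> in state \<open>s\<close>.\<close>

definition is_policy :: "lqg_game \<Rightarrow> policies \<Rightarrow> bool" where
  "is_policy G \<pi> \<longleftrightarrow> (\<forall>i\<in>agents G. \<forall>t\<in>{1..horizon G}.
     (\<lambda>(s, a). \<pi> i t s a) \<in> borel_measurable (lborel_vec (sdim G) \<Otimes>\<^sub>M lborel_vec (adim G i)) \<and>
     (\<forall>s\<in>carrier_vec (sdim G).
        (\<forall>a\<in>carrier_vec (adim G i). 0 \<le> \<pi> i t s a) \<and>
        (\<integral>\<^sup>+ a. ennreal (\<pi> i t s a) \<partial>lborel_vec (adim G i)) = 1))"

definition action_space :: "lqg_game \<Rightarrow> nat set \<Rightarrow> joint_action measure" where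
  "action_space G J = (\<Pi>\<^sub>M j\<in>J. lborel_vec (adim G j))"

definition state_action_space :: "lqg_game \<Rightarrow> (rvec \<times> joint_action) measure" where
  "state_action_space G = lborel_vec (sdim G) \<Otimes>\<^sub>M action_space G (agents G)"

text \<open>Given the state, the agents in \<open>J\<close> act independently.\<close>

definition action_law :: "lqg_game \<Rightarrow> policies \<Rightarrow> nat \<Rightarrow> nat set \<Rightarrow> rvec \<Rightarrow> joint_action measure" where
  "action_law G \<pi> t J s =
     density (action_space G J) (\<lambda>a. ennreal (\<Prod>j\<in>J. \<pi> j t s (a j)))"

definition next_state_law :: "lqg_game \<Rightarrow> rvec \<Rightarrow> joint_action \<Rightarrow> rvec measure" where
  "next_state_law G s a =
     distr (density (lborel_vec (sdim G))
              (\<lambda>w. ennreal (mvn_density (0\<^sub>v (sdim G)) (1\<^sub>m (sdim G)) w)))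
           (lborel_vec (sdim G))
           (\<lambda>w. Am G *\<^sub>v s + vsum (sdim G) (\<lambda>j. Bm G j *\<^sub>v a j) (agents G) + w)"

text \<open>Law of \<open>(s\<^bsub>t+1\<^esub>, a\<^bsub>t+1\<^esub>)\<close> given \<open>(s\<^sub>t, a\<^sub>t)\<close>.\<close>

definition transition ::
    "lqg_game \<Rightarrow> policies \<Rightarrow> nat \<Rightarrow> rvec \<times> joint_action \<Rightarrow> (rvec \<times> joint_action) measure" where
  "transition G \<pi> t x =
     next_state_law G (fst x) (snd x) \<bind>
       (\<lambda>s'. distr (action_law G \<pi> (Suc t) (agents G) s') (state_action_space G) (Pair s'))"

text \<open>Law of \<open>(s\<^sub>k, a\<^sub>k)\<close>, \<open>t \<le> k \<le> t + d\<close>, conditioned on \<open>(s\<^sub>t, a\<^sub>t) = (s, a)\<close>.\<close>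

primrec trajectory_law ::
    "lqg_game \<Rightarrow> policies \<Rightarrow> nat \<Rightarrow> rvec \<Rightarrow> joint_action \<Rightarrow> nat \<Rightarrow>
     (nat \<Rightarrow> rvec \<times> joint_action) measure" where
  "trajectory_law G \<pi> t s a 0 =
     return (\<Pi>\<^sub>M k\<in>{t..t}. state_action_space G) (\<lambda>k\<in>{t..t}. (s, a))"
| "trajectory_law G \<pi> t s a (Suc d) =
     trajectory_law G \<pi> t s a d \<bind>
       (\<lambda>\<omega>. distr (transition G \<pi> (t + d) (\<omega> (t + d)))
                (\<Pi>\<^sub>M k\<in>{t..t + Suc d}. state_action_space G)
                (\<lambda>x. fun_upd \<omega> (t + Suc d) x))"

section \<open>Q functions and entropic cost equilibria\<close>

definition cost_to_go :: "lqg_game \<Rightarrow> nat \<Rightarrow> nat \<Rightarrow> (nat \<Rightarrow> rvec \<times> joint_action) \<Rightarrow> real" where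
  "cost_to_go G i t \<omega> = (\<Sum>k\<in>{t<..horizon G}. cost G i (fst (\<omega> k)) (snd (\<omega> k)))"

definition Qfun :: "lqg_game \<Rightarrow> policies \<Rightarrow> nat \<Rightarrow> nat \<Rightarrow> rvec \<Rightarrow> joint_action \<Rightarrow> real" where
  "Qfun G \<pi> i t s a =
     cost G i s a + (\<integral>\<omega>. cost_to_go G i t \<omega> \<partial>trajectory_law G \<pi> t s a (horizon G - t))"

definition Qbar :: "lqg_game \<Rightarrow> policies \<Rightarrow> nat \<Rightarrow> nat \<Rightarrow> rvec \<Rightarrow> rvec \<Rightarrow> real" where
  "Qbar G \<pi> i t s ai =
     (\<integral>b. Qfun G \<pi> i t s (b(i := ai)) \<partial>action_law G \<pi> t (agents G - {i}) s)"

text \<open>All expectations in the definitions of \<open>Qfun\<close> and \<open>Qbar\<close> exist (the Bochner integral is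
  \<open>0\<close> otherwise).\<close>

definition Q_defined :: "lqg_game \<Rightarrow> policies \<Rightarrow> bool" where
  "Q_defined G \<pi> \<longleftrightarrow> (\<forall>i\<in>agents G. \<forall>t\<in>{1..horizon G}. \<forall>s\<in>carrier_vec (sdim G).
     (\<forall>a\<in>space (action_space G (agents G)).
        integrable (trajectory_law G \<pi> t s a (horizon G - t)) (cost_to_go G i t)) \<and>
     (\<forall>ai\<in>carrier_vec (adim G i).
        integrable (action_law G \<pi> t (agents G - {i}) s) (\<lambda>b. Qfun G \<pi> i t s (b(i := ai)))))"

definition is_ECE :: "lqg_game \<Rightarrow> policies \<Rightarrow> bool" where
  "is_ECE G \<pi> \<longleftrightarrow> is_policy G \<pi> \<and> Q_defined G \<pi> \<and>
     (\<forall>i\<in>agents G. \<forall>t\<in>{1..horizon G}.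
        \<forall>s\<in>carrier_vec (sdim G). \<forall>a\<in>carrier_vec (adim G i).
          \<pi> i t s a = exp (- Qbar G \<pi> i t s a) /
                      (\<integral>a'. exp (- Qbar G \<pi> i t s a') \<partial>lborel_vec (adim G i)))"

section \<open>The coupled recursion for the equilibrium coefficients\<close>

text \<open>Throughout, \<open>P i t\<close>, \<open>\<alpha> i t\<close>, \<open>Z i t\<close>, \<open>\<xi> i t\<close> are the coefficients of agent \<open>i\<close> at time \<open>t\<close>.\<close>

definition gain :: "lqg_game \<Rightarrow> (nat \<Rightarrow> nat \<Rightarrow> rmat) \<Rightarrow> nat \<Rightarrow> nat \<Rightarrow> rmat" where
  "gain G Z i t = Rm G i i + transpose_mat (Bm G i) * Z i (t + 1) * Bm G i"

definition Fm :: "lqg_game \<Rightarrow> (nat \<Rightarrow> nat \<Rightarrow> rmat) \<Rightarrow> nat \<Rightarrow> rmat" where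
  "Fm G P t = Am G - msum (sdim G) (sdim G) (\<lambda>j. Bm G j * P j t) (agents G)"

definition betav :: "lqg_game \<Rightarrow> (nat \<Rightarrow> nat \<Rightarrow> rvec) \<Rightarrow> nat \<Rightarrow> rvec" where
  "betav G \<alpha> t = - vsum (sdim G) (\<lambda>j. Bm G j *\<^sub>v \<alpha> j t) (agents G)"

definition P_eq ::
    "lqg_game \<Rightarrow> (nat \<Rightarrow> nat \<Rightarrow> rmat) \<Rightarrow> (nat \<Rightarrow> nat \<Rightarrow> rmat) \<Rightarrow> nat \<Rightarrow> nat \<Rightarrow> bool" where
  "P_eq G P Z i t \<longleftrightarrow>
     gain G Z i t * P i t
     + transpose_mat (Bm G i) * Z i (t + 1)
         * msum (sdim G) (sdim G) (\<lambda>j. Bm G j * P j t) (agents G - {i})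
     = transpose_mat (Bm G i) * Z i (t + 1) * Am G"

definition alpha_eq ::
    "lqg_game \<Rightarrow> (nat \<Rightarrow> nat \<Rightarrow> rvec) \<Rightarrow> (nat \<Rightarrow> nat \<Rightarrow> rmat) \<Rightarrow> (nat \<Rightarrow> nat \<Rightarrow> rvec) \<Rightarrow>
     nat \<Rightarrow> nat \<Rightarrow> bool" where
  "alpha_eq G \<alpha> Z \<xi> i t \<longleftrightarrow>
     gain G Z i t *\<^sub>v \<alpha> i t
     + (transpose_mat (Bm G i) * Z i (t + 1))
         *\<^sub>v vsum (sdim G) (\<lambda>j. Bm G j *\<^sub>v \<alpha> j t) (agents G - {i})
     = transpose_mat (Bm G i) *\<^sub>v \<xi> i (t + 1)"

definition Z_rec ::
    "lqg_game \<Rightarrow> (nat \<Rightarrow> nat \<Rightarrow> rmat) \<Rightarrow> (nat \<Rightarrow> nat \<Rightarrow> rmat) \<Rightarrow> nat \<Rightarrow> nat \<Rightarrow> bool" where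
  "Z_rec G P Z i t \<longleftrightarrow>
     Z i t = transpose_mat (Fm G P t) * Z i (t + 1) * Fm G P t
       + msum (sdim G) (sdim G) (\<lambda>j. transpose_mat (P j t) * Rm G i j * P j t) (agents G)
       + Qm G i"

text \<open>
  The conditional expected cost from time \<open>t\<close> on is
  \<open>1/2 s\<^sup>T Z\<^sub>t s + \<xi>\<^sub>t\<^sup>T s + const\<close>. The linear part of the stage cost is
  \<open>1/2 l\<^sup>T s\<close>, so each stage contributes \<open>1/2 l\<close> to \<open>\<xi>\<close>. (In the literature the recursion
  is also found without this summand and with terminal value \<open>l\<close>; for the stage cost used here
  that version is correct only if \<open>l = 0\<close>.)
\<close>

definition xi_rec ::
    "lqg_game \<Rightarrow> (nat \<Rightarrow> nat \<Rightarrow> rmat) \<Rightarrow> (nat \<Rightarrow> nat \<Rightarrow> rvec) \<Rightarrow> (nat \<Rightarrow> nat \<Rightarrow> rmat) \<Rightarrow>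
     (nat \<Rightarrow> nat \<Rightarrow> rvec) \<Rightarrow> nat \<Rightarrow> nat \<Rightarrow> bool" where
  "xi_rec G P \<alpha> Z \<xi> i t \<longleftrightarrow>
     \<xi> i t = transpose_mat (Fm G P t) *\<^sub>v (\<xi> i (t + 1) + Z i (t + 1) *\<^sub>v betav G \<alpha> t)
       + vsum (sdim G) (\<lambda>j. (transpose_mat (P j t) * Rm G i j) *\<^sub>v \<alpha> j t) (agents G)
       + (1/2) \<cdot>\<^sub>v lv G i"

text \<open>The equations at all times \<open>t0 \<le> t < T\<close>, with the terminal conditions.\<close>

definition solves_from ::
    "lqg_game \<Rightarrow> nat \<Rightarrow> (nat \<Rightarrow> nat \<Rightarrow> rmat) \<Rightarrow> (nat \<Rightarrow> nat \<Rightarrow> rvec) \<Rightarrow> (nat \<Rightarrow> nat \<Rightarrow> rmat) \<Rightarrow>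
     (nat \<Rightarrow> nat \<Rightarrow> rvec) \<Rightarrow> bool" where
  "solves_from G t0 P \<alpha> Z \<xi> \<longleftrightarrow>
     (\<forall>i\<in>agents G.
        Z i (horizon G) = Qm G i \<and> \<xi> i (horizon G) = (1/2) \<cdot>\<^sub>v lv G i \<and>
        (\<forall>t\<in>{t0..<horizon G}.
           P i t \<in> carrier_mat (adim G i) (sdim G) \<and> \<alpha> i t \<in> carrier_vec (adim G i) \<and>
           P_eq G P Z i t \<and> alpha_eq G \<alpha> Z \<xi> i t \<and>
           Z_rec G P Z i t \<and> xi_rec G P \<alpha> Z \<xi> i t))"

text \<open>
  The linear systems for \<open>P\<close> and for \<open>\<alpha>\<close> at time \<open>t\<close> have the same square coefficient matrix,
  determined by \<open>Z i (t + 1)\<close>. It is required to be nonsingular at every step of the backward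
  recursion. Otherwise a system may have no solution, or an equilibrium may have means which are
  not affine in the state.
\<close>

definition uniquely_solvable :: "lqg_game \<Rightarrow> bool" where
  "uniquely_solvable G \<longleftrightarrow>
     (\<forall>t\<in>{1..<horizon G}. \<forall>P \<alpha> Z \<xi>. solves_from G (Suc t) P \<alpha> Z \<xi> \<longrightarrow>
        (\<forall>x. (\<forall>i\<in>agents G. x i \<in> carrier_vec (adim G i) \<and>
                 gain G Z i t *\<^sub>v x i
                 + (transpose_mat (Bm G i) * Z i (t + 1))
                     *\<^sub>v vsum (sdim G) (\<lambda>j. Bm G j *\<^sub>v x j) (agents G - {i})
                 = 0\<^sub>v (adim G i))
             \<longrightarrow> (\<forall>i\<in>agents G. x i = 0\<^sub>v (adim G i))))"

end

theory Submission
  imports Defs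
begin

text \<open>
  Backward induction on the stage. If the expected cost of agent \<open>i\<close> after stage \<open>t\<close> is a quadratic
  function of the next mean state, then its averaged Q function is quadratic in its own action with
  positive definite leading part \<open>gain\<close>, whatever the policies of the others are; so the equilibrium
  policy is Gaussian. Reading off the linear part at the Gaussian means gives a linear system for the
  means, and unique solvability makes its solution affine in the state. Inserting affine means into
  the stage cost yields a quadratic function again, with coefficients given by the recursion.

  No moments are computed. A Gaussian law is invariant under reflection in its mean, so the integral
  of a quadratic function is its value at the mean plus a constant, and integrability is inherited from
  the hypothesis that the Q functions are defined.
\<close>


unbundle no vec_syntax and no inner_syntax

section \<open>Lebesgue measure on vectors\<close>

text \<open>Integrability shapes the proof: \<open>Q_defined\<close> provides it only for the
  complete cost to go and for the Q functions averaged over the other agents. Identities for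
  expectations are therefore conditional on integrability of the integrand at hand, and a value
  function is claimed to be an expected cost only under that condition. The condition is supplied by
  disintegrating the complete cost backwards from the horizon.

  Reflection splits a quadratic function into its value at the mean and a remainder in the deviation
  from the mean. The law of the deviation involves neither the state nor the means, so randomness
  enters only the constant terms, and \<open>Z\<close> and \<open>\<xi>\<close> obey the recursion
  of the noise-free problem.

  An exact normalising constant is needed because the target density contains a determinant; it
  comes from eliminating one coordinate at a time by Schur complements.

  The claim is about stages before the horizon, but the value function of the last stage starts the
  recursion. That stage is treated like the others, with zero continuation cost, and its means turn
  out to be zero.\<close>

lemma inj_on_vec: "inj_on (Matrix.vec d) (space (\<Pi>\<^sub>M k\<in>{..<d}. (lborel :: real measure)))"
  by (rule inj_onI, rule extensionalityI[of _ "{..<d}"])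
     (auto simp: space_PiM vec_eq_iff PiE_iff)

lemma space_lborel_vec [simp]: "space (lborel_vec d) = carrier_vec d"
proof -
  have "v \<in> Matrix.vec d ` space (\<Pi>\<^sub>M k\<in>{..<d}. (lborel :: real measure))" if "v \<in> carrier_vec d" for v
    using that by (intro image_eqI[where x = "\<lambda>k\<in>{..<d}. vec_index v k"]) (auto simp: space_PiM vec_eq_iff)
  then show ?thesis
    by (auto simp: lborel_vec_def space_embed_measure)
qed

lemma measurable_vec_index:
  assumes "f \<in> N \<rightarrow>\<^sub>M lborel_vec d" and "k < d"
  shows "(\<lambda>x. vec_index (f x) k) \<in> borel_measurable N"
proof -
  have "(\<lambda>v. vec_index v k) \<in> borel_measurable (lborel_vec d)"
    unfolding lborel_vec_def
    by (rule measurable_embed_measure1) (use assms(2) in simp)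
  from measurable_compose[OF assms(1) this] show ?thesis .
qed

text \<open>The coordinates are passed separately as \<open>h\<close>, so that closed expressions
  can stand in for \<open>vec_index (f x) k\<close>, with which they have to agree only on the
  space.\<close>

lemma measurable_lborel_vecI:
  assumes f: "\<And>x. x \<in> space N \<Longrightarrow> f x \<in> carrier_vec d"
    and h: "\<And>k. k < d \<Longrightarrow> h k \<in> borel_measurable N"
    and fh: "\<And>x k. x \<in> space N \<Longrightarrow> k < d \<Longrightarrow> vec_index (f x) k = h k x"
  shows "f \<in> N \<rightarrow>\<^sub>M lborel_vec d"
proof -
  have "(\<lambda>x. \<lambda>k\<in>{..<d}. h k x) \<in> N \<rightarrow>\<^sub>M (\<Pi>\<^sub>M k\<in>{..<d}. (lborel :: real measure))"
    using h by (intro measurable_restrict) auto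
  from measurable_compose[OF this measurable_embed_measure2'[OF inj_on_vec]]
  have "(\<lambda>x. Matrix.vec d (\<lambda>k\<in>{..<d}. h k x)) \<in> N \<rightarrow>\<^sub>M lborel_vec d"
    by (simp add: lborel_vec_def)
  also have "?this \<longleftrightarrow> ?thesis"
    using f fh by (intro measurable_cong eq_vecI) (force dest: carrier_vecD)+
  finally show ?thesis .
qed

lemma measurable_vec_plus:
  assumes "f \<in> N \<rightarrow>\<^sub>M lborel_vec d" "g \<in> N \<rightarrow>\<^sub>M lborel_vec d"
  shows "(\<lambda>x. f x + g x) \<in> N \<rightarrow>\<^sub>M lborel_vec d"
  using assms[THEN measurable_space] assms[THEN measurable_vec_index]
  by (intro measurable_lborel_vecI[where h = "\<lambda>k x. vec_index (f x) k + vec_index (g x) k"])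
     (auto simp: carrier_vecD[OF measurable_space[OF assms(2), unfolded space_lborel_vec]])

lemma measurable_vec_minus:
  assumes "f \<in> N \<rightarrow>\<^sub>M lborel_vec d" "g \<in> N \<rightarrow>\<^sub>M lborel_vec d"
  shows "(\<lambda>x. f x - g x) \<in> N \<rightarrow>\<^sub>M lborel_vec d"
  using assms[THEN measurable_space] assms[THEN measurable_vec_index]
  by (intro measurable_lborel_vecI[where h = "\<lambda>k x. vec_index (f x) k - vec_index (g x) k"])
     (auto simp: carrier_vecD[OF measurable_space[OF assms(2), unfolded space_lborel_vec]])

lemma measurable_vec_const: "c \<in> carrier_vec d \<Longrightarrow> (\<lambda>x. c) \<in> N \<rightarrow>\<^sub>M lborel_vec d"
  by simp

lemma borel_measurable_scalar_prod:
  assumes "f \<in> N \<rightarrow>\<^sub>M lborel_vec d" "g \<in> N \<rightarrow>\<^sub>M lborel_vec d"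
  shows "(\<lambda>x. scalar_prod (f x) (g x)) \<in> borel_measurable N"
proof -
  have "(\<lambda>x. \<Sum>k\<in>{0..<d}. vec_index (f x) k * vec_index (g x) k) \<in> borel_measurable N"
    using assms[THEN measurable_vec_index] by (intro borel_measurable_sum borel_measurable_times) auto
  also have "?this \<longleftrightarrow> ?thesis"
    by (intro measurable_cong)
       (simp add: scalar_prod_def carrier_vecD[OF measurable_space[OF assms(2), unfolded space_lborel_vec]])
  finally show ?thesis .
qed

lemma measurable_mult_mat_vec:
  assumes "A \<in> carrier_mat e d" and f: "f \<in> N \<rightarrow>\<^sub>M lborel_vec d"
  shows "(\<lambda>x. A *\<^sub>v f x) \<in> N \<rightarrow>\<^sub>M lborel_vec e"
proof (rule measurable_lborel_vecI)
  show "A *\<^sub>v f x \<in> carrier_vec e" if "x \<in> space N" for x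
    using assms measurable_space[OF f that] by auto
  show "(\<lambda>x. scalar_prod (row A k) (f x)) \<in> borel_measurable N" if "k < e" for k
    using assms that by (intro borel_measurable_scalar_prod[where d = d] f measurable_vec_const) auto
qed (use assms(1) in auto)

lemma borel_measurable_quad_form:
  assumes "A \<in> carrier_mat d d" and "f \<in> N \<rightarrow>\<^sub>M lborel_vec d"
  shows "(\<lambda>x. quad_form A (f x)) \<in> borel_measurable N"
  unfolding quad_form_def
  using assms by (intro borel_measurable_scalar_prod measurable_mult_mat_vec)

lemma measurable_vsum:
  assumes "\<And>j. j \<in> J \<Longrightarrow> f j \<in> N \<rightarrow>\<^sub>M lborel_vec d"
  shows "(\<lambda>x. vsum d (\<lambda>j. f j x) J) \<in> N \<rightarrow>\<^sub>M lborel_vec d"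
  unfolding vsum_def
  using assms[THEN measurable_vec_index]
  by (intro measurable_lborel_vecI[where h = "\<lambda>k x. \<Sum>j\<in>J. vec_index (f j x) k"]) auto

text \<open>The injective map \<open>Matrix.vec d\<close> carries along a countable cover by sets of
  finite measure. The Tonelli arguments for joint actions rest on this.\<close>

lemma sigma_finite_lborel_vec: "sigma_finite_measure (lborel_vec d)"
proof -
  interpret finite_product_sigma_finite "\<lambda>_. lborel :: real measure" "{..<d}"
    by standard auto
  obtain F where F: "countable F" "F \<subseteq> sets (\<Pi>\<^sub>M k\<in>{..<d}. (lborel :: real measure))"
    "\<Union>F = space (\<Pi>\<^sub>M k\<in>{..<d}. (lborel :: real measure))"
    "\<And>a. a \<in> F \<Longrightarrow> emeasure (\<Pi>\<^sub>M k\<in>{..<d}. (lborel :: real measure)) a \<noteq> \<infinity>"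
    using sigma_finite_countable by blast
  show ?thesis
  proof (intro sigma_finite_measure.intro exI[of _ "(`) (Matrix.vec d) ` F"] conjI ballI)
    fix a assume "a \<in> (`) (Matrix.vec d) ` F"
    then obtain b where b: "b \<in> F" "a = Matrix.vec d ` b" by auto
    have "emeasure (lborel_vec d) a = emeasure (\<Pi>\<^sub>M k\<in>{..<d}. (lborel :: real measure)) b"
      unfolding b(2) lborel_vec_def
      by (rule emeasure_embed_measure_image') (use b F inj_on_vec in auto)
    then show "emeasure (lborel_vec d) a \<noteq> \<infinity>" using F(4)[OF b(1)] by simp
  qed (use F(1,2) F(3)[symmetric] in \<open>auto simp: lborel_vec_def space_embed_measure intro!: in_sets_embed_measure\<close>)
qed

interpretation lborel_vec: sigma_finite_measure "lborel_vec d" for d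
  by (rule sigma_finite_lborel_vec)

interpretation lborel_vec_product: product_sigma_finite "\<lambda>j. lborel_vec (d j)" for d :: "nat \<Rightarrow> nat"
  by standard

text \<open>Preimages of boxes are boxes, and boxes determine the product measure. The lemma serves
  on two levels: for the coordinates of one vector and for the agents of a joint action.\<close>

lemma (in product_sigma_finite) distr_PiM_pointwise:
  assumes I: "finite I"
    and r: "\<And>i. i \<in> I \<Longrightarrow> r i \<in> M i \<rightarrow>\<^sub>M M i" "\<And>i. i \<in> I \<Longrightarrow> distr (M i) (M i) (r i) = M i"
  shows "distr (PiM I M) (PiM I M) (\<lambda>x. \<lambda>i\<in>I. r i (x i)) = PiM I M"
proof (rule PiM_eqI[OF I])
  have meas: "(\<lambda>x. \<lambda>i\<in>I. r i (x i)) \<in> PiM I M \<rightarrow>\<^sub>M PiM I M"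
    by (intro measurable_restrict measurable_compose[OF measurable_component_singleton] r(1))
  fix A assume A: "\<And>i. i \<in> I \<Longrightarrow> A i \<in> sets (M i)"
  have "(\<lambda>x. \<lambda>i\<in>I. r i (x i)) -` Pi\<^sub>E I A \<inter> space (PiM I M) = (\<Pi>\<^sub>E i\<in>I. r i -` A i \<inter> space (M i))"
    by (auto simp: space_PiM PiE_iff)
  then have "emeasure (distr (PiM I M) (PiM I M) (\<lambda>x. \<lambda>i\<in>I. r i (x i))) (Pi\<^sub>E I A)
      = emeasure (PiM I M) (\<Pi>\<^sub>E i\<in>I. r i -` A i \<inter> space (M i))"
    using A I by (subst emeasure_distr[OF meas]) (auto intro: sets_PiM_I_finite)
  also have "\<dots> = (\<Prod>i\<in>I. emeasure (M i) (r i -` A i \<inter> space (M i)))"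
    using A r(1) I by (intro emeasure_PiM) (auto intro: measurable_sets)
  also have "\<dots> = (\<Prod>i\<in>I. emeasure (M i) (A i))"
  proof (rule prod.cong[OF refl])
    fix i assume i: "i \<in> I"
    show "emeasure (M i) (r i -` A i \<inter> space (M i)) = emeasure (M i) (A i)"
      using r(2)[OF i] emeasure_distr[OF r(1)[OF i] A[OF i]] by simp
  qed
  finally show "emeasure (distr (PiM I M) (PiM I M) (\<lambda>x. \<lambda>i\<in>I. r i (x i))) (Pi\<^sub>E I A)
      = (\<Prod>i\<in>I. emeasure (M i) (A i))" .
qed simp

lemma measurable_vec_reflect: "c \<in> carrier_vec d \<Longrightarrow> (\<lambda>x. c - x) \<in> lborel_vec d \<rightarrow>\<^sub>M lborel_vec d"
  by (intro measurable_vec_minus measurable_vec_const) auto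

text \<open>In each coordinate the reflection is negation followed by translation, both of which
  preserve one-dimensional Lebesgue measure.\<close>

lemma distr_lborel_vec_reflect:
  assumes c: "c \<in> carrier_vec d"
  shows "distr (lborel_vec d) (lborel_vec d) (\<lambda>x. c - x) = lborel_vec d"
proof -
  interpret product_sigma_finite "\<lambda>_ :: nat. lborel :: real measure" by standard
  define P where "P = (\<Pi>\<^sub>M k\<in>{..<d}. (lborel :: real measure))"
  define r where "r = (\<lambda>x. \<lambda>k\<in>{..<d}. vec_index c k - x k)"
  have refl: "distr lborel lborel (\<lambda>x. b - x) = lborel" for b :: real
  proof -
    have "distr (distr lborel borel uminus) borel ((+) b) = distr lborel borel (\<lambda>x. b - x)"
      by (subst distr_distr) (auto simp: comp_def)
    then show ?thesis
      by (simp add: lborel_distr_uminus lborel_distr_plus cong: distr_cong)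
  qed
  have P: "distr P P r = P" 
    unfolding P_def r_def by (rule distr_PiM_pointwise) (auto simp: refl)
  have rP: "r \<in> P \<rightarrow>\<^sub>M P" unfolding P_def r_def by (intro measurable_restrict) auto
  have v: "Matrix.vec d \<in> P \<rightarrow>\<^sub>M lborel_vec d"
    unfolding P_def lborel_vec_def by (rule measurable_embed_measure2'[OF inj_on_vec])
  have L: "lborel_vec d = distr P (lborel_vec d) (Matrix.vec d)"
    unfolding P_def lborel_vec_def by (rule embed_measure_eq_distr'[OF inj_on_vec])
  have "distr (lborel_vec d) (lborel_vec d) (\<lambda>x. c - x)
      = distr P (lborel_vec d) (\<lambda>x. c - Matrix.vec d x)"
    by (subst (1) L, subst distr_distr[OF measurable_vec_reflect[OF c] v]) (simp add: comp_def)
  also have "\<dots> = distr P (lborel_vec d) (\<lambda>x. Matrix.vec d (r x))"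
    by (rule distr_cong) (use c in \<open>auto simp: r_def vec_eq_iff\<close>)
  also have "\<dots> = distr (distr P P r) (lborel_vec d) (Matrix.vec d)"
    by (subst distr_distr[OF v rP]) (simp add: comp_def)
  also have "\<dots> = lborel_vec d" unfolding P using L by simp
  finally show ?thesis .
qed


section \<open>Gaussian integrals\<close>

lemma quad_form_sum:
  assumes "M \<in> carrier_mat d d" "v \<in> carrier_vec d"
  shows "quad_form M v = (\<Sum>p<d. \<Sum>q<d. v $ p * M $$ (p, q) * v $ q)"
  using assms
  by (auto simp: quad_form_def scalar_prod_def sum_distrib_left atLeast0LessThan mult.assoc intro!: sum.cong)

text \<open>A nonzero vector in the kernel would give the quadratic form the value zero.\<close>

lemma pos_def_det:
  assumes "pos_def d M"
  shows "det M \<noteq> 0"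
proof
  assume "det M = 0"
  then obtain v where "v \<in> carrier_vec d" "v \<noteq> 0\<^sub>v d" "M *\<^sub>v v = 0\<^sub>v d"
    using assms det_0_iff_vec_prod_zero[of M d] by (auto simp: pos_def_def)
  then show False using assms by (force simp: pos_def_def quad_form_def)
qed

text \<open>A nonzero determinant excludes \<open>None\<close> as the value of
  \<open>mat_inverse\<close>, so the \<open>the\<close> in \<open>minv\<close> is harmless.\<close>

lemma minv_inverse:
  assumes "M \<in> carrier_mat d d" "det M \<noteq> 0"
  shows "minv M \<in> carrier_mat d d" "M * minv M = 1\<^sub>m d" "minv M * M = 1\<^sub>m d"
proof -
  have "M \<in> Units (ring_mat TYPE(real) d b)" for b :: unit
    using assms by (rule det_non_zero_imp_unit)
  then obtain B where "mat_inverse M = Some B"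
    using mat_inverse(1)[OF assms(1), where b = "()"] by (cases "mat_inverse M") auto
  with mat_inverse(2)[OF assms(1) this]
  show "minv M \<in> carrier_mat d d" "M * minv M = 1\<^sub>m d" "minv M * M = 1\<^sub>m d"
    by (auto simp: minv_def)
qed

lemma minv_eqI:
  assumes "M \<in> carrier_mat d d" "det M \<noteq> 0" "B \<in> carrier_mat d d" "M * B = 1\<^sub>m d"
  shows "minv M = B"
proof -
  note inv = minv_inverse[OF assms(1,2)]
  have "minv M = minv M * (M * B)" using inv(1) assms(4) by simp
  also have "\<dots> = (minv M * M) * B" using inv(1) assms(1,3) by (metis assoc_mult_mat)
  finally show ?thesis using inv(3) assms(3) by simp
qed

lemma minv_minv:
  assumes "M \<in> carrier_mat d d" "det M \<noteq> 0"
  shows "minv (minv M) = M" "det (minv M) = 1 / det M"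
proof -
  note inv = minv_inverse[OF assms]
  have "det (minv M) * det M = 1"
    using inv by (metis assms(1) det_mult det_one)
  then show "det (minv M) = 1 / det M" using assms(2) by (simp add: field_simps)
  then show "minv (minv M) = M"
    using assms inv by (intro minv_eqI) auto
qed

lemma nn_integral_gaussian:
  fixes c b :: real
  assumes "0 < c"
  shows "(\<integral>\<^sup>+y. ennreal (exp (- (1/2) * (c * (y + b)\<^sup>2))) \<partial>lborel) = ennreal (sqrt (2 * pi / c))"
proof -
  \<comment> \<open>The integrand is a multiple of the normal density with mean \<open>- b\<close>
    and standard deviation \<open>1 / sqrt c\<close>; the factor is the claimed integral.\<close>
  have eq: "exp (- (1/2) * (c * (y + b)\<^sup>2)) = sqrt (2 * pi / c) * normal_density (- b) (1 / sqrt c) y" for y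
    using assms by (simp add: normal_density_def field_simps real_sqrt_divide real_sqrt_mult)
  interpret prob_space "density lborel (normal_density (- b) (1 / sqrt c))"
    by (rule prob_space_normal_density) (use assms in simp)
  have "(\<integral>\<^sup>+y. ennreal (normal_density (- b) (1 / sqrt c) y) \<partial>lborel) = 1"
    using emeasure_space_1 by (simp add: emeasure_density)
  then show ?thesis
    unfolding eq using assms by (simp add: ennreal_mult nn_integral_cmult)
qed

lemma nn_integral_lborel_vec:
  assumes "f \<in> borel_measurable (lborel_vec d)"
  shows "(\<integral>\<^sup>+x. f x \<partial>lborel_vec d) = (\<integral>\<^sup>+x. f (Matrix.vec d x) \<partial>(\<Pi>\<^sub>M k\<in>{..<d}. (lborel :: real measure)))"
  using assms nn_integral_embed_measure'[OF inj_on_vec] by (simp add: lborel_vec_def)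

text \<open>Tonelli with the last coordinate innermost, as needed for an induction on the
  dimension.\<close>

lemma nn_integral_lborel_vec_Suc:
  assumes f: "f \<in> borel_measurable (lborel_vec (Suc d))"
  shows "(\<integral>\<^sup>+x. f x \<partial>lborel_vec (Suc d))
    = (\<integral>\<^sup>+x. \<integral>\<^sup>+y. f (Matrix.vec (Suc d) (x(d := y))) \<partial>lborel \<partial>(\<Pi>\<^sub>M k\<in>{..<d}. (lborel :: real measure)))"
proof -
  interpret product_sigma_finite "\<lambda>_ :: nat. lborel :: real measure" by standard
  have "Matrix.vec (Suc d) \<in> (\<Pi>\<^sub>M k\<in>{..<Suc d}. (lborel :: real measure)) \<rightarrow>\<^sub>M lborel_vec (Suc d)"
    unfolding lborel_vec_def by (rule measurable_embed_measure2'[OF inj_on_vec])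
  from measurable_compose[OF this f]
  have "(\<lambda>x. f (Matrix.vec (Suc d) x)) \<in> borel_measurable (\<Pi>\<^sub>M k\<in>insert d {..<d}. (lborel :: real measure))"
    by (simp add: lessThan_Suc)
  from product_nn_integral_insert[OF _ _ this] show ?thesis
    by (subst nn_integral_lborel_vec[OF f]) (simp add: lessThan_Suc)
qed

definition schur_complement :: "nat \<Rightarrow> rmat \<Rightarrow> rmat" where
  "schur_complement d M = mat d d (\<lambda>(p, q). M $$ (p, q) - M $$ (p, d) * M $$ (d, q) / M $$ (d, d))"

text \<open>Completing the square in the last coordinate. Symmetry of \<open>M\<close> merges the
  two cross terms into one.\<close>

lemma quad_form_schur_complement:
  assumes M: "M \<in> carrier_mat (Suc d) (Suc d)" "transpose_mat M = M" "M $$ (d, d) \<noteq> 0"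
  shows "quad_form M (Matrix.vec (Suc d) v) = quad_form (schur_complement d M) (Matrix.vec d v)
    + M $$ (d, d) * (v d + (\<Sum>p<d. v p * M $$ (p, d)) / M $$ (d, d))\<^sup>2"
proof -
  let ?c = "M $$ (d, d)" and ?S = "\<Sum>p<d. v p * M $$ (p, d)"
  have sym: "M $$ (d, p) = M $$ (p, d)" if "p < d" for p
    using arg_cong[OF M(2), of "\<lambda>A. A $$ (p, d)"] that M(1) by simp
  have "quad_form M (Matrix.vec (Suc d) v) = (\<Sum>p<d. \<Sum>q<d. v p * M $$ (p, q) * v q) + 2 * v d * ?S + ?c * (v d)\<^sup>2"
    using M(1) sym by (subst quad_form_sum[OF M(1)])
      (auto simp: sum.distrib sum_distrib_left power2_eq_square algebra_simps intro!: sum.cong)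
  moreover have "quad_form (schur_complement d M) (Matrix.vec d v)
      = (\<Sum>p<d. \<Sum>q<d. v p * M $$ (p, q) * v q) - ?S\<^sup>2 / ?c"
  proof -
    have "?S\<^sup>2 / ?c = (\<Sum>p<d. \<Sum>q<d. v p * (M $$ (p, d) * M $$ (d, q) / ?c) * v q)"
      using sym by (auto simp: power2_eq_square sum_product sum_divide_distrib intro!: sum.cong)
    then show ?thesis
      by (subst quad_form_sum[of _ d]) (auto simp: schur_complement_def algebra_simps sum_subtractf)
  qed
  moreover have "?c * (v d + ?S / ?c)\<^sup>2 = ?c * (v d)\<^sup>2 + 2 * v d * ?S + ?S\<^sup>2 / ?c"
    using M(3) by (simp add: power2_eq_square field_simps)
  ultimately show ?thesis by linarith
qed

text \<open>\<open>M\<close> factors into a unit upper triangular block matrix, of determinant one,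
  and a lower triangular one whose diagonal blocks are the Schur complement and the last diagonal
  entry.\<close>

lemma det_schur_complement:
  assumes M: "M \<in> carrier_mat (Suc d) (Suc d)" "M $$ (d, d) \<noteq> 0"
  shows "det M = det (schur_complement d M) * M $$ (d, d)"
proof -
  let ?c = "M $$ (d, d)"
  define B where "B = mat d 1 (\<lambda>(p, q). M $$ (p, d) / ?c)"
  define C where "C = mat 1 d (\<lambda>(p, q). M $$ (d, q))"
  define D where "D = mat 1 1 (\<lambda>_. ?c)"
  define S where "S = schur_complement d M"
  have c: "B \<in> carrier_mat d 1" "C \<in> carrier_mat 1 d" "D \<in> carrier_mat 1 1" "S \<in> carrier_mat d d"
    by (auto simp: B_def C_def D_def S_def schur_complement_def)
  have "four_block_mat (1\<^sub>m d) B (0\<^sub>m 1 d) (1\<^sub>m 1) * four_block_mat S (0\<^sub>m d 1) C D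
      = four_block_mat (S + B * C) (B * D) C D"
    using c by (subst mult_four_block_mat[of _ d d _ 1 _ 1 _ _ d _ 1]) auto
  also have "\<dots> = M"
    using c M by (intro eq_matI)
      (auto simp: B_def C_def D_def S_def schur_complement_def scalar_prod_def less_Suc_eq)
  finally have "det M = det (four_block_mat (1\<^sub>m d) B (0\<^sub>m 1 d) (1\<^sub>m 1)) * det (four_block_mat S (0\<^sub>m d 1) C D)"
    using c by (metis Suc_eq_plus1 det_mult four_block_carrier_mat one_carrier_mat)
  also have "\<dots> = det S * ?c"
    unfolding det_four_block_mat_lower_left_zero[OF one_carrier_mat c(1) refl one_carrier_mat]
      det_four_block_mat_upper_right_zero[OF c(4) refl c(2,3)] det_single[OF c(3)]
    by (simp add: D_def)
  finally show ?thesis by (simp add: S_def)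
qed

lemma pos_def_schur_complement:
  assumes M: "pos_def (Suc d) M"
  shows "0 < M $$ (d, d)" "pos_def d (schur_complement d M)"
proof -
  have c: "M \<in> carrier_mat (Suc d) (Suc d)" "transpose_mat M = M" using M by (auto simp: pos_def_def)
  have sym: "M $$ (q, p) = M $$ (p, q)" if "p < Suc d" "q < Suc d" for p q
    using arg_cong[OF c(2), of "\<lambda>A. A $$ (p, q)"] that c(1) by simp
  have "unit_vec (Suc d) d \<noteq> 0\<^sub>v (Suc d)" by (auto simp: vec_eq_iff)
  then have "0 < quad_form M (unit_vec (Suc d) d)" using M by (simp add: pos_def_def)
  also have "quad_form M (unit_vec (Suc d) d) = M $$ (d, d)"
    using c(1) by (subst quad_form_sum) auto
  finally show pos: "0 < M $$ (d, d)" .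
  have "0 < quad_form (schur_complement d M) x" if x: "x \<in> carrier_vec d" "x \<noteq> 0\<^sub>v d" for x
  proof -
    \<comment> \<open>The last entry annihilates the completed square, so the form of
      \<open>M\<close> at \<open>v\<close> equals that of the Schur complement at
      \<open>x\<close>.\<close>
    define v where "v = (\<lambda>p. if p < d then x $ p else - (\<Sum>p<d. x $ p * M $$ (p, d)) / M $$ (d, d))"
    have vx: "Matrix.vec d v = x" using x(1) by (auto simp: v_def vec_eq_iff)
    have "Matrix.vec (Suc d) v \<noteq> 0\<^sub>v (Suc d)"
    proof
      assume "Matrix.vec (Suc d) v = 0\<^sub>v (Suc d)"
      then have "Matrix.vec d v = 0\<^sub>v d" by (auto simp: vec_eq_iff)
      with vx x(2) show False by simp
    qed
    then have "0 < quad_form M (Matrix.vec (Suc d) v)" using M by (simp add: pos_def_def)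
    also have "\<dots> = quad_form (schur_complement d M) x"
      using pos by (subst quad_form_schur_complement[OF c]) (auto simp: vx, simp add: v_def)
    finally show ?thesis .
  qed
  then show "pos_def d (schur_complement d M)"
    using sym by (auto simp: pos_def_def schur_complement_def)
qed

text \<open>Induction on the dimension: integrating out the last coordinate gives a factor
  independent of the others, although the centre of the inner Gaussian depends on them. Positivity
  of the determinant is proved along, since combining the factors uses it.\<close>

lemma gaussian_integral:
  assumes "pos_def d M"
  shows "0 < det M \<and>
    (\<integral>\<^sup>+x. ennreal (exp (- (1/2) * quad_form M x)) \<partial>lborel_vec d) = ennreal (sqrt ((2 * pi) ^ d / det M))"
  using assms
proof (induction d arbitrary: M)
  case 0
  then have "M \<in> carrier_mat 0 0" by (simp add: pos_def_def)
  moreover from this have "(\<lambda>x. ennreal (exp (- (1/2) * quad_form M x))) \<in> borel_measurable (lborel_vec 0)"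
    by (intro measurable_compose[OF _ measurable_ennreal] borel_measurable_exp[THEN measurable_compose_rev] borel_measurable_times
        borel_measurable_quad_form) auto
  ultimately show ?case
    by (subst nn_integral_lborel_vec)
       (simp_all add: PiM_empty quad_form_def scalar_prod_def nn_integral_count_space_finite)
next
  case (Suc d)
  let ?c = "M $$ (d, d)" and ?S = "schur_complement d M"
  let ?b = "\<lambda>x. (\<Sum>p<d. x p * M $$ (p, d)) / ?c"
  note S = pos_def_schur_complement[OF Suc.prems]
  have c: "M \<in> carrier_mat (Suc d) (Suc d)" "transpose_mat M = M" using Suc.prems by (auto simp: pos_def_def)
  have meas: "(\<lambda>x. ennreal (exp (- (1/2) * quad_form A x))) \<in> borel_measurable (lborel_vec k)"
    if "A \<in> carrier_mat k k" for A k
    using borel_measurable_quad_form[OF that, of "\<lambda>x. x" "lborel_vec k"] by simp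
  have Sc: "?S \<in> carrier_mat d d" using S(2) by (simp add: pos_def_def)
  have IH: "0 < det ?S"
    "(\<integral>\<^sup>+x. ennreal (exp (- (1/2) * quad_form ?S x)) \<partial>lborel_vec d) = ennreal (sqrt ((2 * pi) ^ d / det ?S))"
    using Suc.IH[OF S(2)] by auto
  have "(\<integral>\<^sup>+x. ennreal (exp (- (1/2) * quad_form M x)) \<partial>lborel_vec (Suc d))
     = (\<integral>\<^sup>+x. \<integral>\<^sup>+y. ennreal (exp (- (1/2) * quad_form ?S (Matrix.vec d x))) * ennreal (exp (- (1/2) * (?c * (y + ?b x)\<^sup>2)))
          \<partial>lborel \<partial>(\<Pi>\<^sub>M k\<in>{..<d}. (lborel :: real measure)))"
  proof (subst nn_integral_lborel_vec_Suc[OF meas[OF c(1)]], intro nn_integral_cong)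
    fix x :: "nat \<Rightarrow> real" and y :: real
    have "Matrix.vec d (x(d := y)) = Matrix.vec d x" by (auto simp: vec_eq_iff)
    moreover have "(\<Sum>p<d. (x(d := y)) p * M $$ (p, d)) = (\<Sum>p<d. x p * M $$ (p, d))"
      by (intro sum.cong) auto
    ultimately have "quad_form M (Matrix.vec (Suc d) (x(d := y))) = quad_form ?S (Matrix.vec d x) + ?c * (y + ?b x)\<^sup>2"
      using S(1) by (subst quad_form_schur_complement[OF c]) auto
    then show "ennreal (exp (- (1/2) * quad_form M (Matrix.vec (Suc d) (x(d := y)))))
      = ennreal (exp (- (1/2) * quad_form ?S (Matrix.vec d x))) * ennreal (exp (- (1/2) * (?c * (y + ?b x)\<^sup>2)))"
      by (simp only: ring_distribs exp_add) (simp add: ennreal_mult)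
  qed
  also have "\<dots> = (\<integral>\<^sup>+x. ennreal (exp (- (1/2) * quad_form ?S (Matrix.vec d x))) * ennreal (sqrt (2 * pi / ?c))
          \<partial>(\<Pi>\<^sub>M k\<in>{..<d}. (lborel :: real measure)))"
    by (subst nn_integral_cmult) (simp_all only: nn_integral_gaussian[OF S(1)], simp_all)
  also have "\<dots> = (\<integral>\<^sup>+x. ennreal (exp (- (1/2) * quad_form ?S x)) * ennreal (sqrt (2 * pi / ?c)) \<partial>lborel_vec d)"
    by (rule nn_integral_lborel_vec[symmetric]) (intro borel_measurable_times_ennreal meas Sc borel_measurable_const)
  also have "\<dots> = ennreal (sqrt ((2 * pi) ^ d / det ?S)) * ennreal (sqrt (2 * pi / ?c))"
    by (subst nn_integral_multc[OF meas[OF Sc]]) (simp only: IH(2))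
  also have "\<dots> = ennreal (sqrt ((2 * pi) ^ Suc d / det M))"
    using S(1) IH(1) det_schur_complement[OF c(1)]
    by (simp add: ennreal_mult[symmetric] real_sqrt_mult[symmetric] mult_ac)
  finally show ?case
    using S(1) IH(1) det_schur_complement[OF c(1)] by simp
qed


section \<open>Quadratic forms, and normal densities in terms of the precision matrix\<close>

lemma pos_def_imp_pos_semidef: "pos_def d M \<Longrightarrow> pos_semidef d M"
  by (force simp: pos_def_def pos_semidef_def quad_form_def order.order_iff_strict)

lemma scalar_prod_mult_mat_vec:
  fixes A :: rmat
  assumes "A \<in> carrier_mat n m" "x \<in> carrier_vec n" "y \<in> carrier_vec m"
  shows "scalar_prod x (A *\<^sub>v y) = scalar_prod (transpose_mat A *\<^sub>v x) y"
  using transpose_vec_mult_scalar[OF assms(1,3,2)] by simp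

lemma scalar_prod_symmetric_mat:
  fixes M :: rmat
  assumes "M \<in> carrier_mat d d" "transpose_mat M = M" "x \<in> carrier_vec d" "y \<in> carrier_vec d"
  shows "scalar_prod x (M *\<^sub>v y) = scalar_prod y (M *\<^sub>v x)"
  using assms scalar_prod_mult_mat_vec[of M d d x y] by (simp add: comm_scalar_prod[of _ d])

lemma quad_form_add:
  assumes "M \<in> carrier_mat d d" "transpose_mat M = M" "x \<in> carrier_vec d" "y \<in> carrier_vec d"
  shows "quad_form M (x + y) = quad_form M x + 2 * scalar_prod y (M *\<^sub>v x) + quad_form M y"
  using assms scalar_prod_symmetric_mat[OF assms]
  by (simp add: quad_form_def mult_add_distrib_mat_vec scalar_prod_add_distrib[of _ d] add_scalar_prod_distrib[of _ d])

lemma quad_form_uminus: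
  assumes "M \<in> carrier_mat d d" "x \<in> carrier_vec d"
  shows "quad_form M (- x) = quad_form M x"
proof -
  have "M *\<^sub>v (- x) = - (M *\<^sub>v x)"
    using assms by (auto simp: vec_eq_iff)
  then show ?thesis using assms by (simp add: quad_form_def)
qed

text \<open>Covariances are written as \<open>minv M\<close> because the equilibrium condition
  yields the precision matrix \<open>M\<close> directly; the inversion inside
  \<open>mvn_density\<close> then cancels.\<close>

lemma mvn_density_eq:
  assumes "pos_def d M" "\<mu> \<in> carrier_vec d"
  shows "mvn_density \<mu> (minv M) x = exp (- (1/2) * quad_form M (x - \<mu>)) / sqrt ((2 * pi) ^ d / det M)"
proof -
  have "M \<in> carrier_mat d d" using assms(1) by (simp add: pos_def_def)
  with minv_minv[OF this pos_def_det[OF assms(1)]] assms(2) show ?thesis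
    by (simp add: mvn_density_def)
qed

lemma minv_one: "minv (1\<^sub>m d) = (1\<^sub>m d :: rmat)"
  by (rule minv_eqI) auto

lemma pos_def_one: "pos_def d (1\<^sub>m d)"
proof -
  have "0 < scalar_prod v v" if "v \<in> carrier_vec d" "v \<noteq> 0\<^sub>v d" for v :: rvec
    using that conjugate_square_greater_0_vec[of v d] by simp
  then show ?thesis by (auto simp: pos_def_def quad_form_def)
qed

text \<open>Two successive reflections make a translation.\<close>

lemma distr_lborel_vec_translate:
  assumes c: "c \<in> carrier_vec d"
  shows "distr (lborel_vec d) (lborel_vec d) (\<lambda>x. x - c) = lborel_vec d"
proof -
  have "distr (distr (lborel_vec d) (lborel_vec d) (\<lambda>x. c - x)) (lborel_vec d) (\<lambda>x. 0\<^sub>v d - x)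
      = distr (lborel_vec d) (lborel_vec d) (\<lambda>x. 0\<^sub>v d - (c - x))"
    using c by (subst distr_distr) (auto intro!: measurable_vec_reflect simp: comp_def)
  also have "\<dots> = distr (lborel_vec d) (lborel_vec d) (\<lambda>x. x - c)"
    using c by (intro distr_cong) auto
  finally show ?thesis using c by (simp add: distr_lborel_vec_reflect)
qed

lemma nn_integral_lborel_vec_translate:
  assumes c: "c \<in> carrier_vec d" and f: "f \<in> borel_measurable (lborel_vec d)"
  shows "(\<integral>\<^sup>+x. f (x - c) \<partial>lborel_vec d) = (\<integral>\<^sup>+x. f x \<partial>lborel_vec d)"
proof -
  have "(\<integral>\<^sup>+x. f (x - c) \<partial>lborel_vec d) = (\<integral>\<^sup>+x. f x \<partial>distr (lborel_vec d) (lborel_vec d) (\<lambda>x. x - c))"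
    using c f by (intro nn_integral_distr[symmetric] measurable_vec_minus measurable_vec_const) auto
  then show ?thesis by (simp add: distr_lborel_vec_translate[OF c])
qed

lemma borel_measurable_mvn_density:
  assumes "pos_def d M" "\<mu> \<in> carrier_vec d"
  shows "mvn_density \<mu> (minv M) \<in> borel_measurable (lborel_vec d)"
proof -
  have M: "M \<in> carrier_mat d d" using assms(1) by (simp add: pos_def_def)
  have "(\<lambda>x. quad_form M (x - \<mu>)) \<in> borel_measurable (lborel_vec d)"
    using assms(2) by (intro borel_measurable_quad_form[OF M] measurable_vec_minus measurable_vec_const) auto
  moreover have "mvn_density \<mu> (minv M) = (\<lambda>x. exp (- (1/2) * quad_form M (x - \<mu>)) / sqrt ((2 * pi) ^ d / det M))"
    using mvn_density_eq[OF assms] by auto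
  ultimately show ?thesis by simp
qed

lemma nn_integral_exp_quad_form:
  assumes M: "pos_def d M" and \<mu>: "\<mu> \<in> carrier_vec d"
  shows "(\<integral>\<^sup>+x. ennreal (exp (- (1/2) * quad_form M (x - \<mu>))) \<partial>lborel_vec d) = ennreal (sqrt ((2 * pi) ^ d / det M))"
proof -
  have "M \<in> carrier_mat d d" using M by (simp add: pos_def_def)
  then have "(\<lambda>x. ennreal (exp (- (1/2) * quad_form M x))) \<in> borel_measurable (lborel_vec d)"
    using borel_measurable_quad_form[of M d "\<lambda>x. x" "lborel_vec d"] by simp
  from nn_integral_lborel_vec_translate[OF \<mu> this] gaussian_integral[OF M] show ?thesis
    by simp
qed

lemma nn_integral_mvn_density:
  assumes M: "pos_def d M" and \<mu>: "\<mu> \<in> carrier_vec d"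
  shows "(\<integral>\<^sup>+x. ennreal (mvn_density \<mu> (minv M) x) \<partial>lborel_vec d) = 1"
proof -
  have Mc: "M \<in> carrier_mat d d" using M by (simp add: pos_def_def)
  let ?C = "sqrt ((2 * pi) ^ d / det M)"
  have C: "0 < ?C" using gaussian_integral[OF M] by simp
  have meas: "(\<lambda>x. ennreal (exp (- (1/2) * quad_form M (x - \<mu>)))) \<in> borel_measurable (lborel_vec d)"
    using borel_measurable_quad_form[OF Mc measurable_vec_minus[OF measurable_ident measurable_vec_const[OF \<mu>]]]
    by simp
  have "(\<integral>\<^sup>+x. ennreal (mvn_density \<mu> (minv M) x) \<partial>lborel_vec d)
      = (\<integral>\<^sup>+x. ennreal (1 / ?C) * ennreal (exp (- (1/2) * quad_form M (x - \<mu>))) \<partial>lborel_vec d)"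
    using C by (intro nn_integral_cong) (simp add: mvn_density_eq[OF M \<mu>] ennreal_mult'[symmetric])
  also have "\<dots> = ennreal (1 / ?C) * ennreal ?C"
    by (subst nn_integral_cmult[OF meas]) (simp only: nn_integral_exp_quad_form[OF M \<mu>])
  also have "\<dots> = 1"
    using C by (subst ennreal_mult[symmetric]) auto
  finally show ?thesis .
qed

text \<open>Used to recover the mean from the density alone, as the only point where the maximum is
  attained.\<close>

lemma mvn_density_less_mode:
  assumes M: "pos_def d M" and \<mu>: "\<mu> \<in> carrier_vec d" and x: "x \<in> carrier_vec d" "x \<noteq> \<mu>"
  shows "mvn_density \<mu> (minv M) x < mvn_density \<mu> (minv M) \<mu>"
proof -
  have "x - \<mu> \<noteq> 0\<^sub>v d"
  proof
    assume "x - \<mu> = 0\<^sub>v d"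
    then have "\<mu> + (x - \<mu>) = \<mu>" using \<mu> by simp
    with x \<mu> show False by (auto simp: vec_eq_iff)
  qed
  then have "0 < quad_form M (x - \<mu>)" using M \<mu> x by (simp add: pos_def_def)
  moreover have "quad_form M (\<mu> - \<mu>) = 0"
    using M \<mu> by (auto simp: pos_def_def quad_form_def intro!: scalar_prod_left_zero mult_mat_vec_carrier)
  moreover have "0 < sqrt ((2 * pi) ^ d / det M)" using gaussian_integral[OF M] by simp
  ultimately show ?thesis
    unfolding mvn_density_eq[OF M \<mu>] by (intro divide_strict_right_mono) auto
qed

text \<open>Completing the square. \<open>K\<close> and the constant left by the square cancel
  against the normaliser, so only the part of \<open>f\<close> that varies with the action
  matters.\<close>

lemma softmax_quadratic_eq_mvn_density:
  assumes M: "pos_def d M" and v: "v \<in> carrier_vec d"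
    and f: "\<And>a. a \<in> carrier_vec d \<Longrightarrow> f a = K + 1/2 * quad_form M a + scalar_prod a v"
    and a: "a \<in> carrier_vec d"
  shows "exp (- f a) / (\<integral>a'. exp (- f a') \<partial>lborel_vec d) = mvn_density (- (minv M *\<^sub>v v)) (minv M) a"
proof -
  have Mc: "M \<in> carrier_mat d d" "transpose_mat M = M" using M by (auto simp: pos_def_def)
  note inv = minv_inverse[OF Mc(1) pos_def_det[OF M]]
  \<comment> \<open>The shift satisfies \<open>M *\<^sub>v m = v\<close>, so the cross term of the
    square is the linear term of \<open>f\<close>.\<close>
  define m where "m = minv M *\<^sub>v v"
  have m: "m \<in> carrier_vec d" using inv v by (simp add: m_def)
  have Mm: "M *\<^sub>v m = v"
    using inv(2) v by (simp add: m_def assoc_mult_mat_vec[OF Mc(1) inv(1) v, symmetric])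
  let ?C = "sqrt ((2 * pi) ^ d / det M)"
  \<comment> \<open>The factor of \<open>exp (- f x)\<close> that does not depend on
    \<open>x\<close>.\<close>
  define k where "k = exp (1/2 * quad_form M m - K)"
  have sq: "exp (- f x) = k * exp (- (1/2) * quad_form M (x - (- m)))" if x: "x \<in> carrier_vec d" for x
  proof -
    have "x - (- m) = x + m" using x m by (auto simp: vec_eq_iff)
    then have "quad_form M (x - (- m)) = quad_form M x + 2 * scalar_prod x v + quad_form M m"
      using quad_form_add[OF Mc m x] x m by (simp add: Mm comm_add_vec[of x d m])
    then show ?thesis
      unfolding f[OF x] k_def by (simp add: exp_add[symmetric] field_simps)
  qed
  have meas: "(\<lambda>x. exp (- (1/2) * quad_form M (x - (- m)))) \<in> borel_measurable (lborel_vec d)"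
    using borel_measurable_quad_form[OF Mc(1) measurable_vec_minus[OF measurable_ident measurable_vec_const[of "- m"]]] m
    by simp
  have "(\<integral>x. exp (- (1/2) * quad_form M (x - (- m))) \<partial>lborel_vec d) = ?C"
    using nn_integral_exp_quad_form[OF M, of "- m"] m gaussian_integral[OF M]
    by (subst integral_eq_nn_integral[OF meas]) auto
  moreover have "(\<integral>x. exp (- f x) \<partial>lborel_vec d) = (\<integral>x. k * exp (- (1/2) * quad_form M (x - (- m))) \<partial>lborel_vec d)"
    by (intro Bochner_Integration.integral_cong) (simp_all only: sq space_lborel_vec)
  ultimately have "(\<integral>x. exp (- f x) \<partial>lborel_vec d) = k * ?C"
    by simp
  moreover have "k > 0" by (simp add: k_def)
  ultimately show ?thesis
    using m by (simp add: sq[OF a] mvn_density_eq[OF M] flip: m_def)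
qed

section \<open>Integration lemmas\<close>

text \<open>Change of variables along a map that preserves \<open>M\<close>. With equal densities it
  expresses invariance of a law; with different ones it transports a law to another, as in
  centring.\<close>

lemma density_eq_distr_density:
  assumes r: "r \<in> M \<rightarrow>\<^sub>M M" "distr M M r = M"
    and \<rho>: "\<rho> \<in> borel_measurable M" "\<And>x. x \<in> space M \<Longrightarrow> \<rho> (r x) = \<rho>' x"
  shows "density M \<rho> = distr (density M \<rho>') M r"
proof -
  have "density M \<rho> = density (distr M M r) \<rho>" using r(2) by simp
  also have "\<dots> = distr (density M (\<lambda>x. \<rho> (r x))) M r"
    using \<rho>(1) r(1) by (intro density_distr) auto
  also have "density M (\<lambda>x. \<rho> (r x)) = density M \<rho>'"
    using measurable_compose[OF r(1) \<rho>(1)] \<rho>(2) 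
    by (intro density_cong) (auto cong: measurable_cong)
  finally show ?thesis .
qed

text \<open>By invariance \<open>f\<close> has the same integral as its average with
  \<open>f (r x)\<close>, from which everything odd under \<open>r\<close> has disappeared.
  Integrability of \<open>q\<close> is inherited from \<open>f\<close>.\<close>

lemma (in prob_space) integral_reflection:
  fixes f q :: "'a \<Rightarrow> real"
  assumes r: "r \<in> M \<rightarrow>\<^sub>M M" "distr M M r = M"
    and f: "integrable M f"
    and q: "\<And>x. x \<in> space M \<Longrightarrow> f x + f (r x) = 2 * (c + q x)"
  shows "(\<integral>x. f x \<partial>M) = c + (\<integral>x. q x \<partial>M)"
proof -
  have fr: "integrable M (\<lambda>x. f (r x))"
    using f r by (metis integrable_distr)
  have "(\<integral>x. f (r x) \<partial>M) = (\<integral>x. f x \<partial>distr M M r)"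
    using r(1) f by (intro integral_distr[symmetric]) auto
  then have eq: "(\<integral>x. f (r x) \<partial>M) = (\<integral>x. f x \<partial>M)" using r(2) by simp
  have "(\<integral>x. q x \<partial>M) = (\<integral>x. (f x + f (r x)) / 2 - c \<partial>M)"
  proof (rule Bochner_Integration.integral_cong[OF refl])
    show "q x = (f x + f (r x)) / 2 - c" if "x \<in> space M" for x using q[OF that] by (simp add: field_simps)
  qed
  also have "\<dots> = (\<integral>x. f x \<partial>M) - c"
    using f fr by (simp add: eq prob_space)
  finally show ?thesis by simp
qed

text \<open>Fubini for a kernel and a signed integrand whose inner integral is known only where it
  exists. The positive and the negative part have finite total integral, so their inner integrals
  are finite almost everywhere; this is where integrability under \<open>K x\<close> comes
  from.\<close>

lemma integral_bind_AE:
  fixes f :: "'b \<Rightarrow> real"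
  assumes K: "K \<in> M \<rightarrow>\<^sub>M subprob_algebra N"
    and f: "f \<in> borel_measurable N" and fi: "integrable (M \<bind> K) f"
    and h: "h \<in> borel_measurable M"
      "\<And>x. x \<in> space M \<Longrightarrow> integrable (K x) f \<Longrightarrow> (\<integral>y. f y \<partial>K x) = h x"
  shows "integrable M h" "(\<integral>y. f y \<partial>(M \<bind> K)) = (\<integral>x. h x \<partial>M)"
    "AE x in M. integrable (K x) f"
proof -
  \<comment> \<open>Inner integrals of the positive and the negative part; \<open>ennreal\<close>
    sends negative numbers to zero.\<close>
  define p where "p = (\<lambda>x. \<integral>\<^sup>+y. ennreal (f y) \<partial>K x)"
  define n where "n = (\<lambda>x. \<integral>\<^sup>+y. ennreal (- f y) \<partial>K x)"
  have meas: "p \<in> borel_measurable M" "n \<in> borel_measurable M"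
    unfolding p_def n_def using f
    by (auto intro!: measurable_compose[OF K nn_integral_measurable_subprob_algebra])
  have pI: "(\<integral>\<^sup>+x. p x \<partial>M) = (\<integral>\<^sup>+y. ennreal (f y) \<partial>(M \<bind> K))"
    and nI: "(\<integral>\<^sup>+x. n x \<partial>M) = (\<integral>\<^sup>+y. ennreal (- f y) \<partial>(M \<bind> K))"
    unfolding p_def n_def using f by (auto intro!: nn_integral_bind[symmetric, OF _ K])
  have fin: "(\<integral>\<^sup>+x. p x \<partial>M) \<noteq> \<infinity>" "(\<integral>\<^sup>+x. n x \<partial>M) \<noteq> \<infinity>"
    using fi unfolding real_integrable_def pI nI by auto
  have AEfin: "AE x in M. p x \<noteq> \<infinity>" "AE x in M. n x \<noteq> \<infinity>"
    by (fact nn_integral_PInf_AE[OF meas(1) fin(1)], fact nn_integral_PInf_AE[OF meas(2) fin(2)])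
  have Kf: "f \<in> borel_measurable (K x)" if "x \<in> space M" for x
    using f by (simp add: measurable_cong_sets[OF sets_kernel[OF K that] refl])
  show int: "AE x in M. integrable (K x) f"
    using AEfin AE_space
  proof eventually_elim
    case (elim x)
    then show ?case using Kf[of x] by (simp add: real_integrable_def p_def n_def)
  qed
  have heq: "AE x in M. h x = enn2real (p x) - enn2real (n x)"
    using int AE_space
  proof eventually_elim
    case (elim x)
    then show ?case using h(2)[of x] by (simp add: real_lebesgue_integral_def p_def n_def)
  qed
  have part: "integrable M (\<lambda>x. enn2real (g x)) \<and> (\<integral>x. enn2real (g x) \<partial>M) = enn2real (\<integral>\<^sup>+x. g x \<partial>M)"
    if g: "g \<in> borel_measurable M" "(\<integral>\<^sup>+x. g x \<partial>M) \<noteq> \<infinity>" "AE x in M. g x \<noteq> \<infinity>" for g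
  proof -
    have "(\<integral>\<^sup>+x. ennreal (enn2real (g x)) \<partial>M) = (\<integral>\<^sup>+x. g x \<partial>M)"
      using g(3) by (intro nn_integral_cong_AE) (auto elim!: eventually_mono simp: top.not_eq_extremum)
    then show ?thesis
      using g(1,2) by (auto simp: integral_eq_nn_integral top.not_eq_extremum intro!: integrableI_nonneg)
  qed
  note pp = part[OF meas(1) fin(1) AEfin(1)] and nn = part[OF meas(2) fin(2) AEfin(2)]
  have d: "integrable M (\<lambda>x. enn2real (p x) - enn2real (n x))" using pp nn by auto
  show "integrable M h"
    using heq h(1) meas d by (subst integrable_cong_AE[OF _ _ heq]) auto
  have "(\<integral>x. h x \<partial>M) = (\<integral>x. enn2real (p x) - enn2real (n x) \<partial>M)"
    using heq h(1) meas by (intro integral_cong_AE) auto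
  also have "\<dots> = enn2real (\<integral>\<^sup>+x. p x \<partial>M) - enn2real (\<integral>\<^sup>+x. n x \<partial>M)"
    using pp nn by simp
  also have "\<dots> = (\<integral>y. f y \<partial>(M \<bind> K))"
    unfolding pI nI using fi by (simp add: real_lebesgue_integral_def)
  finally show "(\<integral>y. f y \<partial>(M \<bind> K)) = (\<integral>x. h x \<partial>M)" ..
qed


section \<open>Measurability of the kernels\<close>

definition next_mean :: "lqg_game \<Rightarrow> rvec \<Rightarrow> joint_action \<Rightarrow> rvec" where
  "next_mean G s a = Am G *\<^sub>v s + vsum (sdim G) (\<lambda>j. Bm G j *\<^sub>v a j) (agents G)"

definition noise_law :: "nat \<Rightarrow> rvec measure" where
  "noise_law d = density (lborel_vec d) (\<lambda>w. ennreal (mvn_density (0\<^sub>v d) (1\<^sub>m d) w))"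

lemma next_state_law_eq:
  "next_state_law G s a = distr (noise_law (sdim G)) (lborel_vec (sdim G)) (\<lambda>w. next_mean G s a + w)"
  by (simp add: next_state_law_def noise_law_def next_mean_def)

lemma sets_noise_law [measurable_cong, simp]: "sets (noise_law d) = sets (lborel_vec d)"
  by (simp add: noise_law_def)

lemma space_noise_law [simp]: "space (noise_law d) = carrier_vec d"
  by (simp add: noise_law_def)

lemma emeasure_density_space:
  assumes "f \<in> borel_measurable M"
  shows "emeasure (density M f) (space M) = (\<integral>\<^sup>+x. f x \<partial>M)"
proof -
  have "(\<integral>\<^sup>+x. f x * indicator (space M) x \<partial>M) = (\<integral>\<^sup>+x. f x \<partial>M)"
    by (rule nn_integral_cong) simp
  then show ?thesis by (simp add: emeasure_density assms)
qed

lemma prob_space_noise_law: "prob_space (noise_law d)"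
  using nn_integral_mvn_density[OF pos_def_one, of "0\<^sub>v d" d]
    borel_measurable_mvn_density[OF pos_def_one, of "0\<^sub>v d" d]
    emeasure_density_space[of "\<lambda>w. ennreal (mvn_density (0\<^sub>v d) (1\<^sub>m d) w)" "lborel_vec d"]
  by (intro prob_spaceI) (simp add: noise_law_def minv_one)

text \<open>The standard normal density is even. Negation is written \<open>0\<^sub>v d - w\<close>
  to be an instance of the reflection lemma for Lebesgue measure.\<close>

lemma distr_noise_law_uminus: "distr (noise_law d) (noise_law d) (\<lambda>w. 0\<^sub>v d - w) = noise_law d"
proof -
  have "mvn_density (0\<^sub>v d) (minv (1\<^sub>m d)) (0\<^sub>v d - w) = mvn_density (0\<^sub>v d) (minv (1\<^sub>m d)) w"
    if w: "w \<in> carrier_vec d" for w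
  proof -
    have "0\<^sub>v d - w - 0\<^sub>v d = - w" "w - 0\<^sub>v d = w" using w by (auto simp: vec_eq_iff)
    then show ?thesis
      using w by (simp add: mvn_density_eq[OF pos_def_one] quad_form_uminus[of _ d])
  qed
  then have "noise_law d = distr (noise_law d) (lborel_vec d) (\<lambda>w. 0\<^sub>v d - w)"
    unfolding noise_law_def
    using borel_measurable_mvn_density[OF pos_def_one, of "0\<^sub>v d" d]
    by (intro density_eq_distr_density measurable_vec_reflect distr_lborel_vec_reflect) (auto simp: minv_one)
  then show ?thesis by (simp cong: distr_cong)
qed

lemma space_action_space [simp]: "space (action_space G J) = (\<Pi>\<^sub>E j\<in>J. carrier_vec (adim G j))"
  by (simp add: action_space_def space_PiM)

lemma space_state_action_space [simp]:
  "space (state_action_space G) = carrier_vec (sdim G) \<times> (\<Pi>\<^sub>E j\<in>agents G. carrier_vec (adim G j))"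
  by (simp add: state_action_space_def space_pair_measure)

lemma measurable_state: "fst \<in> state_action_space G \<rightarrow>\<^sub>M lborel_vec (sdim G)"
  by (simp add: state_action_space_def)

lemma measurable_actions: "snd \<in> state_action_space G \<rightarrow>\<^sub>M action_space G (agents G)"
  by (simp add: state_action_space_def)

lemma measurable_action: "j \<in> J \<Longrightarrow> (\<lambda>a. a j) \<in> action_space G J \<rightarrow>\<^sub>M lborel_vec (adim G j)"
  unfolding action_space_def by (rule measurable_component_singleton)

lemma finite_agents [simp]: "finite (agents G)"
  by (simp add: agents_def)

lemma sets_action_law [simp, measurable_cong]: "sets (action_law G \<pi> t J s) = sets (action_space G J)"
  by (simp add: action_law_def)

lemma space_action_law [simp]: "space (action_law G \<pi> t J s) = (\<Pi>\<^sub>E j\<in>J. carrier_vec (adim G j))"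
  by (simp add: action_law_def)

locale lqg =
  fixes G :: lqg_game
  assumes valid: "valid_game G"
begin

lemma A_carrier: "Am G \<in> carrier_mat (sdim G) (sdim G)"
  using valid by (simp add: valid_game_def)

lemma B_carrier: "j \<in> agents G \<Longrightarrow> Bm G j \<in> carrier_mat (sdim G) (adim G j)"
  using valid by (simp add: valid_game_def)

lemma measurable_next_mean:
  "(\<lambda>x. next_mean G (fst x) (snd x)) \<in> state_action_space G \<rightarrow>\<^sub>M lborel_vec (sdim G)"
  unfolding next_mean_def
  by (intro measurable_vec_plus measurable_vsum measurable_mult_mat_vec[OF A_carrier] measurable_state
      measurable_mult_mat_vec[OF B_carrier] measurable_compose[OF measurable_actions measurable_action])

lemma next_mean_carrier:
  "s \<in> carrier_vec (sdim G) \<Longrightarrow> next_mean G s a \<in> carrier_vec (sdim G)"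
  using A_carrier by (auto simp: next_mean_def vsum_def)

lemma next_state_kernel:
  "(\<lambda>x. next_state_law G (fst x) (snd x)) \<in> state_action_space G \<rightarrow>\<^sub>M prob_algebra (lborel_vec (sdim G))"
  unfolding next_state_law_eq
proof (rule measurable_distr_prob_space2[where M = "lborel_vec (sdim G)"])
  show "(\<lambda>x. noise_law (sdim G)) \<in> state_action_space G \<rightarrow>\<^sub>M prob_algebra (lborel_vec (sdim G))"
    by (simp add: space_prob_algebra prob_space_noise_law)
  show "(\<lambda>(x, w). next_mean G (fst x) (snd x) + w) \<in> state_action_space G \<Otimes>\<^sub>M lborel_vec (sdim G) \<rightarrow>\<^sub>M lborel_vec (sdim G)"
    unfolding split_beta
    by (intro measurable_vec_plus measurable_compose[OF measurable_fst measurable_next_mean]) simp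
qed

end

locale lqg_policy = lqg +
  fixes \<pi> :: policies
  assumes policy: "is_policy G \<pi>"
begin

lemma policy_measurable:
  assumes "j \<in> agents G" "t \<in> {1..horizon G}"
  shows "(\<lambda>(s, a). \<pi> j t s a) \<in> borel_measurable (lborel_vec (sdim G) \<Otimes>\<^sub>M lborel_vec (adim G j))"
  using policy assms by (auto simp: is_policy_def)

lemma policy_nonneg:
  assumes "j \<in> agents G" "t \<in> {1..horizon G}" "s \<in> carrier_vec (sdim G)" "a \<in> carrier_vec (adim G j)"
  shows "0 \<le> \<pi> j t s a"
  using policy assms by (auto simp: is_policy_def)

lemma borel_measurable_joint_policy:
  assumes "J \<subseteq> agents G" "t \<in> {1..horizon G}"
  shows "(\<lambda>(s, a). \<Prod>j\<in>J. \<pi> j t s (a j)) \<in> borel_measurable (lborel_vec (sdim G) \<Otimes>\<^sub>M action_space G J)"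
  unfolding split_beta
proof (rule borel_measurable_prod)
  fix j assume j: "j \<in> J"
  have "(\<lambda>x. (fst x, snd x j)) \<in> lborel_vec (sdim G) \<Otimes>\<^sub>M action_space G J \<rightarrow>\<^sub>M lborel_vec (sdim G) \<Otimes>\<^sub>M lborel_vec (adim G j)"
    by (intro measurable_Pair measurable_fst measurable_compose[OF measurable_snd measurable_action[OF j]])
  from measurable_compose[OF this policy_measurable[of j t]] j assms
  show "(\<lambda>x. \<pi> j t (fst x) (snd x j)) \<in> borel_measurable (lborel_vec (sdim G) \<Otimes>\<^sub>M action_space G J)"
    by auto
qed

lemma borel_measurable_joint_policy_section:
  assumes "J \<subseteq> agents G" "t \<in> {1..horizon G}" "s \<in> carrier_vec (sdim G)"
  shows "(\<lambda>a. \<Prod>j\<in>J. \<pi> j t s (a j)) \<in> borel_measurable (action_space G J)"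
  using measurable_compose[OF measurable_Pair1'[of s "lborel_vec (sdim G)" "action_space G J"]
      borel_measurable_joint_policy[OF assms(1,2)]] assms(3)
  by simp

text \<open>Independence turns the integral of the product density into a product of integrals equal
  to one. Nonnegativity of the densities is what lets \<open>ennreal\<close> move inside the
  product.\<close>

lemma prob_space_action_law:
  assumes J: "J \<subseteq> agents G" and t: "t \<in> {1..horizon G}" and s: "s \<in> carrier_vec (sdim G)"
  shows "prob_space (action_law G \<pi> t J s)"
proof (rule prob_spaceI)
  have fin: "finite J" using J by (rule finite_subset) simp
  have pm: "(\<lambda>a. \<pi> j t s a) \<in> borel_measurable (lborel_vec (adim G j))" if "j \<in> J" for j
    using measurable_compose[OF measurable_Pair1'[of s "lborel_vec (sdim G)" "lborel_vec (adim G j)"] policy_measurable[of j t]]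
      that J t s by auto
  have "emeasure (action_law G \<pi> t J s) (space (action_law G \<pi> t J s))
      = (\<integral>\<^sup>+a. ennreal (\<Prod>j\<in>J. \<pi> j t s (a j)) \<partial>action_space G J)"
    using borel_measurable_joint_policy_section[OF assms]
      emeasure_density_space[of "\<lambda>a. ennreal (\<Prod>j\<in>J. \<pi> j t s (a j))" "action_space G J"]
    by (simp add: action_law_def)
  also have "\<dots> = (\<integral>\<^sup>+a. (\<Prod>j\<in>J. ennreal (\<pi> j t s (a j))) \<partial>action_space G J)"
    using J t s by (intro nn_integral_cong) (auto intro!: prod_ennreal[symmetric] policy_nonneg simp: PiE_iff)
  also have "\<dots> = (\<Prod>j\<in>J. \<integral>\<^sup>+a. ennreal (\<pi> j t s a) \<partial>lborel_vec (adim G j))"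
    unfolding action_space_def using pm by (intro lborel_vec_product.product_nn_integral_prod fin) auto
  also have "\<dots> = 1"
    using policy J t s by (auto intro!: prod.neutral simp: is_policy_def)
  finally show "emeasure (action_law G \<pi> t J s) (space (action_law G \<pi> t J s)) = 1" .
qed

text \<open>Joint measurability of the density in state and action, which \<open>is_policy\<close>
  demands, makes the mass of a fixed set measurable in the state by Tonelli; this uses
  sigma-finiteness of the action space.\<close>

lemma action_kernel:
  assumes J: "J \<subseteq> agents G" and t: "t \<in> {1..horizon G}"
  shows "action_law G \<pi> t J \<in> lborel_vec (sdim G) \<rightarrow>\<^sub>M prob_algebra (action_space G J)"
proof (rule measurable_prob_algebraI)
  show ps: "prob_space (action_law G \<pi> t J s)" if "s \<in> space (lborel_vec (sdim G))" for s
    using prob_space_action_law[OF J t] that by simp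
  have "finite J" using J by (rule finite_subset) simp
  then have "sigma_finite_measure (action_space G J)"
    unfolding action_space_def by (rule lborel_vec_product.sigma_finite)
  then interpret S: sigma_finite_measure "action_space G J" .
  show "action_law G \<pi> t J \<in> lborel_vec (sdim G) \<rightarrow>\<^sub>M subprob_algebra (action_space G J)"
  proof (rule measurable_subprob_algebra)
    fix s assume s: "s \<in> space (lborel_vec (sdim G))"
    show "subprob_space (action_law G \<pi> t J s)" using ps[OF s] by (rule prob_space_imp_subprob_space)
  next
    fix X assume X: "X \<in> sets (action_space G J)"
    have "(\<lambda>(s, a). ennreal (\<Prod>j\<in>J. \<pi> j t s (a j)) * indicator X a)
        \<in> borel_measurable (lborel_vec (sdim G) \<Otimes>\<^sub>M action_space G J)"
      using borel_measurable_joint_policy[OF J t] X unfolding split_beta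
      by (intro borel_measurable_times_ennreal measurable_compose[OF _ measurable_ennreal]
          measurable_compose[OF measurable_snd borel_measurable_indicator])
    then have "(\<lambda>s. \<integral>\<^sup>+a. ennreal (\<Prod>j\<in>J. \<pi> j t s (a j)) * indicator X a \<partial>action_space G J)
        \<in> borel_measurable (lborel_vec (sdim G))"
      by (rule S.borel_measurable_nn_integral)
    also have "?this \<longleftrightarrow> (\<lambda>s. emeasure (action_law G \<pi> t J s) X) \<in> borel_measurable (lborel_vec (sdim G))"
      using borel_measurable_joint_policy_section[OF J t] X
      by (intro measurable_cong) (simp add: action_law_def emeasure_density)
    finally show "(\<lambda>s. emeasure (action_law G \<pi> t J s) X) \<in> borel_measurable (lborel_vec (sdim G))" .
  qed simp
qed

lemma state_action_kernel:
  assumes t: "t \<in> {1..horizon G}"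
  shows "(\<lambda>s. distr (action_law G \<pi> t (agents G) s) (state_action_space G) (Pair s))
    \<in> lborel_vec (sdim G) \<rightarrow>\<^sub>M prob_algebra (state_action_space G)"
  by (rule measurable_distr_prob_space2[OF action_kernel[OF order.refl t]])
     (simp add: state_action_space_def)

text \<open>The bound concerns \<open>Suc t\<close>: leaving stage \<open>t\<close> draws the
  actions of the next stage, and policies are constrained only up to the horizon.\<close>

lemma transition_kernel:
  assumes t: "Suc t \<in> {1..horizon G}"
  shows "transition G \<pi> t \<in> state_action_space G \<rightarrow>\<^sub>M prob_algebra (state_action_space G)"
  unfolding transition_def
  by (rule measurable_bind_prob_space[OF next_state_kernel state_action_kernel[OF t]])

lemma trajectory_step_kernel:
  assumes t: "Suc (t + d) \<in> {1..horizon G}"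
  shows "(\<lambda>\<omega>. distr (transition G \<pi> (t + d) (\<omega> (t + d))) (\<Pi>\<^sub>M k\<in>{t..t + Suc d}. state_action_space G)
      (\<lambda>x. fun_upd \<omega> (t + Suc d) x))
    \<in> (\<Pi>\<^sub>M k\<in>{t..t + d}. state_action_space G) \<rightarrow>\<^sub>M prob_algebra (\<Pi>\<^sub>M k\<in>{t..t + Suc d}. state_action_space G)"
proof (rule measurable_distr_prob_space2[where M = "state_action_space G"])
  show "(\<lambda>\<omega>. transition G \<pi> (t + d) (\<omega> (t + d)))
      \<in> (\<Pi>\<^sub>M k\<in>{t..t + d}. state_action_space G) \<rightarrow>\<^sub>M prob_algebra (state_action_space G)"
    by (rule measurable_compose[OF _ transition_kernel[OF t]], rule measurable_component_singleton) simp
  show "(\<lambda>(\<omega>, x). fun_upd \<omega> (t + Suc d) x) \<in> (\<Pi>\<^sub>M k\<in>{t..t + d}. state_action_space G) \<Otimes>\<^sub>M state_action_space G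
      \<rightarrow>\<^sub>M (\<Pi>\<^sub>M k\<in>{t..t + Suc d}. state_action_space G)"
    unfolding split_beta by (rule measurable_fun_upd[where J = "{t..t + d}"]) auto
qed

lemma trajectory_law_prob:
  assumes "t + d \<le> horizon G" "s \<in> carrier_vec (sdim G)" "a \<in> space (action_space G (agents G))"
  shows "trajectory_law G \<pi> t s a d \<in> space (prob_algebra (\<Pi>\<^sub>M k\<in>{t..t + d}. state_action_space G))"
  using assms(1)
proof (induction d)
  case 0
  have "(\<lambda>k\<in>{t..t}. (s, a)) \<in> space (\<Pi>\<^sub>M k\<in>{t..t}. state_action_space G)"
    using assms(2,3) by (auto simp: space_PiM)
  then show ?case by (simp add: space_prob_algebra prob_space_return)
next
  case (Suc d)
  have "Suc (t + d) \<in> {1..horizon G}" using Suc.prems by auto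
  from measurable_space[OF measurable_bind_prob_space[OF measurable_ident[of "prob_algebra (\<Pi>\<^sub>M k\<in>{t..t + d}. state_action_space G)"]
      trajectory_step_kernel[OF this]] Suc.IH] Suc.prems
  show ?case by simp
qed

end


section \<open>Quadratic value functions\<close>

text \<open>The factor 1/2 stands only at the quadratic term, so that \<open>Z\<close> and
  \<open>\<xi>\<close> are literally those of the recursion. The stage cost has 1/2 at its linear
  term too, hence the \<open>(1/2) \<cdot>\<^sub>v lv G i\<close> there.\<close>

definition quad_value :: "rmat \<Rightarrow> rvec \<Rightarrow> real \<Rightarrow> rvec \<Rightarrow> real" where
  "quad_value Z \<xi> \<kappa> y = 1/2 * quad_form Z y + scalar_prod \<xi> y + \<kappa>"

text \<open>Parallelogram identity for \<open>m\<close> and the deviation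
  \<open>x - m\<close>.\<close>

lemma quad_form_reflect:
  assumes M: "M \<in> carrier_mat d d" "transpose_mat M = M" and x: "x \<in> carrier_vec d" "m \<in> carrier_vec d"
  shows "quad_form M x + quad_form M (m + m - x) = 2 * quad_form M m + 2 * quad_form M (x - m)"
proof -
  define e where "e = x - m"
  have e: "e \<in> carrier_vec d" "- e \<in> carrier_vec d" using x by (auto simp: e_def)
  have x_eq: "x = m + e" "m + m - x = m + (- e)" using x by (auto simp: e_def vec_eq_iff)
  have "scalar_prod (- e) (M *\<^sub>v m) = - scalar_prod e (M *\<^sub>v m)"
    using e M x by simp
  then have "quad_form M (m + e) + quad_form M (m + (- e)) = 2 * quad_form M m + 2 * quad_form M e"
    using quad_form_add[OF M x(2) e(1)] quad_form_add[OF M x(2) e(2)] quad_form_uminus[OF M(1) e(1)]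
    by simp
  then show ?thesis by (simp only: x_eq(1)[symmetric] x_eq(2)[symmetric] e_def[symmetric])
qed

text \<open>The linear part is odd about \<open>m\<close> up to its value there and cancels; the
  remainder is a function of \<open>x - m\<close> alone. This is the shape that
  \<open>integral_reflection\<close> asks for.\<close>

lemma quad_value_reflect:
  assumes M: "Z \<in> carrier_mat d d" "transpose_mat Z = Z" and v: "\<xi> \<in> carrier_vec d"
    and x: "x \<in> carrier_vec d" "m \<in> carrier_vec d"
  shows "quad_value Z \<xi> \<kappa> x + quad_value Z \<xi> \<kappa> (m + m - x) = 2 * (quad_value Z \<xi> \<kappa> m + 1/2 * quad_form Z (x - m))"
proof -
  have "scalar_prod \<xi> (m + m - x) = 2 * scalar_prod \<xi> m - scalar_prod \<xi> x"
    using v x by (simp add: scalar_prod_minus_distrib[of _ d] scalar_prod_add_distrib[of _ d])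
  then show ?thesis
    using quad_form_reflect[OF M x] by (simp add: quad_value_def field_simps)
qed

lemma borel_measurable_quad_value:
  assumes "Z \<in> carrier_mat d d" "\<xi> \<in> carrier_vec d" "f \<in> N \<rightarrow>\<^sub>M lborel_vec d"
  shows "(\<lambda>x. quad_value Z \<xi> \<kappa> (f x)) \<in> borel_measurable N"
  unfolding quad_value_def
  using assms
  by (intro borel_measurable_add borel_measurable_times borel_measurable_const borel_measurable_quad_form
      borel_measurable_scalar_prod[where d = d] measurable_vec_const)

context lqg
begin

lemma Q_symmetric: "i \<in> agents G \<Longrightarrow> Qm G i \<in> carrier_mat (sdim G) (sdim G) \<and> transpose_mat (Qm G i) = Qm G i"
  using valid by (simp add: valid_game_def pos_semidef_def)

lemma l_carrier: "i \<in> agents G \<Longrightarrow> lv G i \<in> carrier_vec (sdim G)"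
  using valid by (simp add: valid_game_def)

lemma R_pos_semidef: "i \<in> agents G \<Longrightarrow> j \<in> agents G \<Longrightarrow> pos_semidef (adim G j) (Rm G i j)"
  using valid pos_def_imp_pos_semidef by (cases "i = j") (auto simp: valid_game_def)

lemma R_symmetric:
  "i \<in> agents G \<Longrightarrow> j \<in> agents G \<Longrightarrow> Rm G i j \<in> carrier_mat (adim G j) (adim G j) \<and> transpose_mat (Rm G i j) = Rm G i j"
  using R_pos_semidef by (simp add: pos_semidef_def)

lemma cost_cong: "(\<And>j. j \<in> agents G \<Longrightarrow> a j = b j) \<Longrightarrow> cost G i s a = cost G i s b"
  by (simp add: cost_def)

lemma next_mean_cong: "(\<And>j. j \<in> agents G \<Longrightarrow> a j = b j) \<Longrightarrow> next_mean G s a = next_mean G s b"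
  by (simp add: next_mean_def vsum_def)

lemma borel_measurable_cost:
  assumes "i \<in> agents G"
  shows "(\<lambda>x. cost G i (fst x) (snd x)) \<in> borel_measurable (state_action_space G)"
  unfolding cost_def
  using Q_symmetric[OF assms] R_symmetric[OF assms] l_carrier[OF assms]
  by (intro borel_measurable_times borel_measurable_add borel_measurable_const borel_measurable_sum
      borel_measurable_quad_form[where d = "sdim G"] borel_measurable_scalar_prod[where d = "sdim G"] measurable_vec_const
      borel_measurable_quad_form[OF _ measurable_compose[OF measurable_actions measurable_action]] measurable_state) auto

text \<open>The noise term is half the trace of \<open>Z\<close>, but only its independence of
  \<open>s\<close> and \<open>a\<close> matters, so it stays an integral.\<close>

lemma integral_next_state_quad_value:
  assumes Z: "Z \<in> carrier_mat (sdim G) (sdim G)" "transpose_mat Z = Z" "\<xi> \<in> carrier_vec (sdim G)"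
    and s: "s \<in> carrier_vec (sdim G)"
    and int: "integrable (next_state_law G s a) (quad_value Z \<xi> \<kappa>)"
  shows "(\<integral>y. quad_value Z \<xi> \<kappa> y \<partial>next_state_law G s a)
    = quad_value Z \<xi> \<kappa> (next_mean G s a) + (\<integral>w. 1/2 * quad_form Z w \<partial>noise_law (sdim G))"
proof -
  interpret prob_space "noise_law (sdim G)" by (rule prob_space_noise_law)
  let ?y = "next_mean G s a"
  note y = next_mean_carrier[OF s, of a]
  have m: "(\<lambda>w. ?y + w) \<in> noise_law (sdim G) \<rightarrow>\<^sub>M lborel_vec (sdim G)"
    by (intro measurable_vec_plus measurable_vec_const y) (simp add: noise_law_def)
  have V: "quad_value Z \<xi> \<kappa> \<in> borel_measurable (lborel_vec (sdim G))"
    using borel_measurable_quad_value[OF Z(1,3), of "\<lambda>x. x"] by simp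
  have i: "integrable (noise_law (sdim G)) (\<lambda>w. quad_value Z \<xi> \<kappa> (?y + w))"
    using int unfolding next_state_law_eq by (simp add: integrable_distr_eq[OF m V])
  have "(\<integral>y. quad_value Z \<xi> \<kappa> y \<partial>next_state_law G s a) = (\<integral>w. quad_value Z \<xi> \<kappa> (?y + w) \<partial>noise_law (sdim G))"
    unfolding next_state_law_eq by (rule integral_distr[OF m V])
  also have "\<dots> = quad_value Z \<xi> \<kappa> ?y + (\<integral>w. 1/2 * quad_form Z w \<partial>noise_law (sdim G))"
  proof (rule integral_reflection[OF _ distr_noise_law_uminus i])
    show "(\<lambda>w. 0\<^sub>v (sdim G) - w) \<in> noise_law (sdim G) \<rightarrow>\<^sub>M noise_law (sdim G)"
      using measurable_vec_reflect[of "0\<^sub>v (sdim G)" "sdim G"] by (simp add: noise_law_def)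
    fix w assume w: "w \<in> space (noise_law (sdim G))"
    have "?y + (0\<^sub>v (sdim G) - w) = ?y + ?y - (?y + w)" "?y + w - ?y = w"
      using y w by (auto simp: vec_eq_iff)
    then show "quad_value Z \<xi> \<kappa> (?y + w) + quad_value Z \<xi> \<kappa> (?y + (0\<^sub>v (sdim G) - w))
        = 2 * (quad_value Z \<xi> \<kappa> ?y + 1/2 * quad_form Z w)"
      using quad_value_reflect[OF Z _ y, of "?y + w"] y w by simp
  qed
  finally show ?thesis .
qed

end

section \<open>Dynamic programming\<close>

text \<open>Here \<open>V k\<close> stands for the expected cost from stage \<open>k\<close> on,
  \<open>\<gamma> k\<close> for the effect of the noise on entering stage \<open>k\<close>, and
  \<open>H k s a\<close> for the expected cost after stage \<open>k\<close>. The hypotheses on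
  \<open>V\<close> are conditional on integrability, which the proof has to deliver before it can
  use them.\<close>

lemma (in lqg_policy) integral_cost_to_go:
  fixes V :: "nat \<Rightarrow> rvec \<Rightarrow> real" and \<gamma> :: "nat \<Rightarrow> real"
  defines "H \<equiv> \<lambda>k s a. if k = horizon G then 0 else V (Suc k) (next_mean G s a) + \<gamma> (Suc k)"
  assumes i: "i \<in> agents G"
    and V_meas: "\<And>k. k \<in> {t<..horizon G} \<Longrightarrow> V k \<in> borel_measurable (lborel_vec (sdim G))"
    and V_stage: "\<And>k s. k \<in> {t<..horizon G} \<Longrightarrow> s \<in> carrier_vec (sdim G) \<Longrightarrow>
      integrable (action_law G \<pi> k (agents G) s) (\<lambda>a. cost G i s a + H k s a) \<Longrightarrow>
      (\<integral>a. cost G i s a + H k s a \<partial>action_law G \<pi> k (agents G) s) = V k s"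
    and V_noise: "\<And>k s a. k \<in> {t<..horizon G} \<Longrightarrow> s \<in> carrier_vec (sdim G) \<Longrightarrow>
      a \<in> space (action_space G (agents G)) \<Longrightarrow>
      integrable (next_state_law G s a) (V k) \<Longrightarrow>
      (\<integral>y. V k y \<partial>next_state_law G s a) = V k (next_mean G s a) + \<gamma> k"
    and t: "t \<le> horizon G" and s: "s \<in> carrier_vec (sdim G)" and a: "a \<in> space (action_space G (agents G))"
    and int: "integrable (trajectory_law G \<pi> t s a (horizon G - t)) (cost_to_go G i t)"
  shows "(\<integral>\<omega>. cost_to_go G i t \<omega> \<partial>trajectory_law G \<pi> t s a (horizon G - t)) = H t s a"
proof -
  let ?S = "state_action_space G"
  let ?P = "\<lambda>d. \<Pi>\<^sub>M k\<in>{t..t + d}. state_action_space G"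
  let ?L = "trajectory_law G \<pi> t s a"
  let ?c = "\<lambda>x. cost G i (fst x) (snd x)"
  let ?H = "\<lambda>k x. H k (fst x) (snd x)"
  \<comment> \<open>Cost of the stages after \<open>t\<close> up to \<open>t + d\<close>, with
    everything later replaced by its conditional expectation. At the horizon this is the whole cost
    to go, at \<open>d = 0\<close> it is \<open>H\<close> at the initial pair.\<close>
  define F where "F d \<omega> = (\<Sum>k\<in>{t<..t + d}. ?c (\<omega> k)) + ?H (t + d) (\<omega> (t + d))" for d \<omega>
  note c_meas = borel_measurable_cost[OF i]
  have H_meas: "?H k \<in> borel_measurable ?S" if "k \<in> {t..horizon G}" for k
    using measurable_compose[OF measurable_next_mean V_meas[of "Suc k"]] that
    by (cases "k = horizon G") (auto simp: H_def)
  have F_meas: "F d \<in> borel_measurable (?P d)" if "t + d \<le> horizon G" for d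
  proof -
    have "(\<lambda>\<omega>. ?c (\<omega> k)) \<in> borel_measurable (?P d)" if "k \<in> {t<..t + d}" for k
      by (rule measurable_compose[OF _ c_meas], rule measurable_component_singleton) (use that in auto)
    moreover have "(\<lambda>\<omega>. ?H (t + d) (\<omega> (t + d))) \<in> borel_measurable (?P d)"
      by (rule measurable_compose[OF _ H_meas], rule measurable_component_singleton) (use that in auto)
    ultimately show ?thesis
      unfolding F_def by (intro borel_measurable_add borel_measurable_sum) auto
  qed
  \<comment> \<open>Integrating out the last stage. Integrability passes from the longer trajectory
    to the shorter one, which fixes the direction of the induction below.\<close>
  have shorten: "integrable (?L d) (F d) \<and> (\<integral>\<omega>. F d \<omega> \<partial>?L d) = (\<integral>\<omega>. F (Suc d) \<omega> \<partial>?L (Suc d))"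
    if d: "t + Suc d \<le> horizon G" and I: "integrable (?L (Suc d)) (F (Suc d))" for d
  proof -
    define K where "K = (\<lambda>\<omega>. distr (transition G \<pi> (t + d) (\<omega> (t + d))) (?P (Suc d)) (\<lambda>x. fun_upd \<omega> (t + Suc d) x))"
    have L: "?L (Suc d) = ?L d \<bind> K" by (simp add: K_def)
    have Suc_d: "Suc (t + d) \<in> {1..horizon G}" using d by auto
    have k: "Suc (t + d) \<in> {t<..horizon G}" using d by auto
    have sets: "sets (?L d) = sets (?P d)" and sp: "space (?L d) = space (?P d)"
      using trajectory_law_prob[of t d s a] d s a by (auto simp: space_prob_algebra dest: sets_eq_imp_space_eq)
    have K: "K \<in> ?L d \<rightarrow>\<^sub>M subprob_algebra (?P (Suc d))"
      using measurable_prob_algebraD[OF trajectory_step_kernel[OF Suc_d]]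
      by (simp add: K_def measurable_cong_sets[OF sets refl])
    have inner: "(\<integral>\<omega>'. F (Suc d) \<omega>' \<partial>K \<omega>) = F d \<omega>"
      if \<omega>: "\<omega> \<in> space (?L d)" and intK: "integrable (K \<omega>) (F (Suc d))" for \<omega>
    proof -
      define x where "x = \<omega> (t + d)"
      define C where "C = (\<Sum>k\<in>{t<..t + d}. ?c (\<omega> k))"
      define g where "g y = ?c y + ?H (Suc (t + d)) y" for y
      have x: "x \<in> space ?S" using \<omega> unfolding sp x_def space_PiM by (auto simp: PiE_iff)
      have g_meas: "g \<in> borel_measurable ?S"
        unfolding g_def using d by (intro borel_measurable_add c_meas H_meas) auto
      have tr: "transition G \<pi> (t + d) x \<in> space (prob_algebra ?S)"
        using measurable_space[OF transition_kernel[OF Suc_d] x] .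
      then interpret tr: prob_space "transition G \<pi> (t + d) x" by (simp add: space_prob_algebra)
      have tr_sets: "sets (transition G \<pi> (t + d) x) = sets ?S" using tr by (simp add: space_prob_algebra)
      have upd: "(\<lambda>y. fun_upd \<omega> (t + Suc d) y) \<in> transition G \<pi> (t + d) x \<rightarrow>\<^sub>M ?P (Suc d)"
        unfolding measurable_cong_sets[OF tr_sets refl]
        using \<omega> unfolding sp by (intro measurable_fun_upd[where J = "{t..t + d}"]) auto
      have F_upd: "F (Suc d) (fun_upd \<omega> (t + Suc d) y) = C + g y" for y
      proof -
        have "{t<..t + Suc d} = insert (t + Suc d) {t<..t + d}" by auto
        moreover have "(\<Sum>k\<in>{t<..t + d}. ?c ((fun_upd \<omega> (t + Suc d) y) k)) = C"
          unfolding C_def by (rule sum.cong) auto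
        ultimately show ?thesis by (simp add: F_def g_def)
      qed
      have "integrable (transition G \<pi> (t + d) x) (\<lambda>y. C + g y)"
        using intK integrable_distr_eq[OF upd F_meas[of "Suc d"]] d unfolding K_def F_upd x_def by simp
      then have g_int: "integrable (transition G \<pi> (t + d) x) g"
        using Bochner_Integration.integrable_diff[of _ "\<lambda>y. C + g y" "\<lambda>y. C"] by simp
      have "(\<integral>\<omega>'. F (Suc d) \<omega>' \<partial>K \<omega>) = (\<integral>y. C + g y \<partial>transition G \<pi> (t + d) x)"
        using integral_distr[OF upd F_meas[of "Suc d"]] d unfolding K_def F_upd x_def by simp
      also have "\<dots> = C + (\<integral>y. g y \<partial>transition G \<pi> (t + d) x)"
        using g_int by (simp add: tr.prob_space)
      also have "(\<integral>y. g y \<partial>transition G \<pi> (t + d) x) = ?H (t + d) x"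
      proof -
        let ?N = "next_state_law G (fst x) (snd x)"
        let ?A = "\<lambda>s'. distr (action_law G \<pi> (Suc (t + d)) (agents G) s') ?S (Pair s')"
        have N: "?N \<in> space (prob_algebra (lborel_vec (sdim G)))"
          using measurable_space[OF next_state_kernel x] .
        then have N_sets: "sets ?N = sets (lborel_vec (sdim G))" by (simp add: space_prob_algebra)
        then have N_space: "space ?N = carrier_vec (sdim G)" by (auto dest: sets_eq_imp_space_eq)
        have A: "?A \<in> ?N \<rightarrow>\<^sub>M subprob_algebra ?S"
          unfolding measurable_cong_sets[OF N_sets refl]
          by (rule measurable_prob_algebraD[OF state_action_kernel[OF Suc_d]])
        have g_int': "integrable (?N \<bind> ?A) g"
          using g_int by (simp add: transition_def)
        \<comment> \<open>Averaging over the actions of the new stage gives \<open>V\<close> at its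
          state, wherever the integral exists.\<close>
        have stage: "(\<integral>y. g y \<partial>?A s') = V (Suc (t + d)) s'" if s': "s' \<in> space ?N" and "integrable (?A s') g" for s'
        proof -
          have p: "Pair s' \<in> action_law G \<pi> (Suc (t + d)) (agents G) s' \<rightarrow>\<^sub>M ?S"
            using s' N_space by (simp add: state_action_space_def)
          have "integrable (action_law G \<pi> (Suc (t + d)) (agents G) s') (\<lambda>a. g (s', a))"
            using that(2) by (simp add: integrable_distr_eq[OF p g_meas])
          moreover have "(\<integral>y. g y \<partial>?A s') = (\<integral>a. g (s', a) \<partial>action_law G \<pi> (Suc (t + d)) (agents G) s')"
            by (rule integral_distr[OF p g_meas])
          ultimately show ?thesis
            using V_stage[OF k, of s'] s' N_space by (simp add: g_def)
        qed
        have V_meas': "V (Suc (t + d)) \<in> borel_measurable ?N"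
          using V_meas[OF k] by (simp add: measurable_cong_sets[OF N_sets refl])
        \<comment> \<open>Besides the value, \<open>b(1)\<close> is essential: integrability of
          \<open>V\<close> under the next state law is the premise of
          \<open>V_noise\<close>.\<close>
        note b = integral_bind_AE[OF A g_meas g_int' V_meas' stage]
        have "(\<integral>y. g y \<partial>transition G \<pi> (t + d) x) = (\<integral>s'. V (Suc (t + d)) s' \<partial>?N)"
          using b(2) by (simp add: transition_def)
        also have "\<dots> = V (Suc (t + d)) (next_mean G (fst x) (snd x)) + \<gamma> (Suc (t + d))"
          using V_noise[OF k _ _ b(1)] x by auto
        finally show ?thesis using d by (simp add: H_def)
      qed
      finally show ?thesis by (simp add: F_def C_def x_def)
    qed
    have Fd: "F d \<in> borel_measurable (?L d)"
      using F_meas[of d] d by (simp add: measurable_cong_sets[OF sets refl])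
    have "integrable (?L d \<bind> K) (F (Suc d))" using I by (simp only: L)
    note b = integral_bind_AE[OF K F_meas[OF d] this Fd inner]
    then show ?thesis by (simp only: L)
  qed
  \<comment> \<open>Downward induction from the horizon, where integrability is the hypothesis
    \<open>int\<close>.\<close>
  have all: "integrable (?L d) (F d) \<and> (\<integral>\<omega>. F d \<omega> \<partial>?L d) = (\<integral>\<omega>. cost_to_go G i t \<omega> \<partial>?L (horizon G - t))"
    if "d \<le> horizon G - t" for d
    using that
  proof (induction d rule: inc_induct)
    case base
    have "F (horizon G - t) = cost_to_go G i t"
      using t by (auto simp: F_def cost_to_go_def H_def fun_eq_iff)
    then show ?case using int by simp
  next
    case (step d)
    have "t + Suc d \<le> horizon G" using step.hyps by auto
    from shorten[OF this] step.IH show ?case by simp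
  qed
  have "(\<integral>\<omega>. F 0 \<omega> \<partial>?L 0) = F 0 (\<lambda>k\<in>{t..t}. (s, a))"
    using F_meas[of 0] t s a by (simp add: integral_return space_PiM)
  then show ?thesis using all[of 0] by (simp add: F_def)
qed


section \<open>Gaussian action laws\<close>

definition reflect_actions :: "nat set \<Rightarrow> joint_action \<Rightarrow> joint_action \<Rightarrow> joint_action" where
  "reflect_actions J m a = (\<lambda>j\<in>J. m j + m j - a j)"

definition centre_actions :: "nat set \<Rightarrow> joint_action \<Rightarrow> joint_action \<Rightarrow> joint_action" where
  "centre_actions J m a = (\<lambda>j\<in>J. a j - m j)"

text \<open>Law of the deviations from the means. It is given by a density rather than as an image
  of \<open>action_law\<close>, so that its independence of the state and of the means is
  visible.\<close>

definition centred_action_law :: "lqg_game \<Rightarrow> (nat \<Rightarrow> rmat) \<Rightarrow> nat set \<Rightarrow> joint_action measure" where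
  "centred_action_law G M J =
     density (action_space G J) (\<lambda>a. ennreal (\<Prod>j\<in>J. mvn_density (0\<^sub>v (adim G j)) (minv (M j)) (a j)))"

lemma distr_action_space_pointwise:
  assumes "finite J"
    and "\<And>j. j \<in> J \<Longrightarrow> r j \<in> lborel_vec (adim G j) \<rightarrow>\<^sub>M lborel_vec (adim G j)"
    and "\<And>j. j \<in> J \<Longrightarrow> distr (lborel_vec (adim G j)) (lborel_vec (adim G j)) (r j) = lborel_vec (adim G j)"
  shows "(\<lambda>a. \<lambda>j\<in>J. r j (a j)) \<in> action_space G J \<rightarrow>\<^sub>M action_space G J"
    "distr (action_space G J) (action_space G J) (\<lambda>a. \<lambda>j\<in>J. r j (a j)) = action_space G J"
proof -
  show "(\<lambda>a. \<lambda>j\<in>J. r j (a j)) \<in> action_space G J \<rightarrow>\<^sub>M action_space G J"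
    using measurable_compose[OF measurable_action assms(2)] unfolding action_space_def
    by (intro measurable_restrict) auto
  show "distr (action_space G J) (action_space G J) (\<lambda>a. \<lambda>j\<in>J. r j (a j)) = action_space G J"
    unfolding action_space_def using assms by (rule lborel_vec_product.distr_PiM_pointwise)
qed

text \<open>Reflection in the means preserves the joint action law, so no moments need to be computed:
  the odd part of an integrand which is quadratic in the actions drops out.\<close>

lemma (in lqg_policy) integral_action_law_reflect:
  fixes f q :: "joint_action \<Rightarrow> real"
  assumes J: "J \<subseteq> agents G" and t: "t \<in> {1..horizon G}" and s: "s \<in> carrier_vec (sdim G)"
    and M: "\<And>j. j \<in> J \<Longrightarrow> pos_def (adim G j) (M j)"
    and m: "\<And>j. j \<in> J \<Longrightarrow> m j \<in> carrier_vec (adim G j)"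
    and \<pi>: "\<And>j a. j \<in> J \<Longrightarrow> a \<in> carrier_vec (adim G j) \<Longrightarrow> \<pi> j t s a = mvn_density (m j) (minv (M j)) a"
    and f: "integrable (action_law G \<pi> t J s) f"
    and q: "q \<in> borel_measurable (action_space G J)"
      "\<And>a. a \<in> space (action_space G J) \<Longrightarrow> f a + f (reflect_actions J m a) = 2 * (c + q (centre_actions J m a))"
  shows "(\<integral>a. f a \<partial>action_law G \<pi> t J s) = c + (\<integral>a. q a \<partial>centred_action_law G M J)"
proof -
  interpret prob_space "action_law G \<pi> t J s" by (rule prob_space_action_law[OF J t s])
  have fin: "finite J" using J by (rule finite_subset) simp
  let ?S = "action_space G J"
  let ?L = "action_law G \<pi> t J s"
  let ?\<rho> = "\<lambda>a. ennreal (\<Prod>j\<in>J. \<pi> j t s (a j))"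
  let ?c = "\<lambda>a. ennreal (\<Prod>j\<in>J. mvn_density (0\<^sub>v (adim G j)) (minv (M j)) (a j))"
  have \<rho>_meas: "?\<rho> \<in> borel_measurable ?S"
    using borel_measurable_joint_policy_section[OF J t s] by simp
  \<comment> \<open>The density depends only on the deviation from the mean and is even in
    it.\<close>
  have dens: "mvn_density (m j) (minv (M j)) (m j + m j - x) = mvn_density (m j) (minv (M j)) x"
    "mvn_density (0\<^sub>v (adim G j)) (minv (M j)) (x - m j) = mvn_density (m j) (minv (M j)) x"
    if j: "j \<in> J" and x: "x \<in> carrier_vec (adim G j)" for j x
  proof -
    have "m j + m j - x - m j = - (x - m j)" using x m[OF j] by (auto simp: vec_eq_iff)
    moreover have "x - m j - 0\<^sub>v (adim G j) = x - m j" using x m[OF j] by auto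
    moreover have "M j \<in> carrier_mat (adim G j) (adim G j)" using M[OF j] by (simp add: pos_def_def)
    ultimately show "mvn_density (m j) (minv (M j)) (m j + m j - x) = mvn_density (m j) (minv (M j)) x"
      "mvn_density (0\<^sub>v (adim G j)) (minv (M j)) (x - m j) = mvn_density (m j) (minv (M j)) x"
      using x m[OF j] by (simp_all add: mvn_density_eq[OF M[OF j]] quad_form_uminus[of _ "adim G j"])
  qed
  have r: "reflect_actions J m \<in> ?S \<rightarrow>\<^sub>M ?S" "distr ?S ?S (reflect_actions J m) = ?S"
    unfolding reflect_actions_def[abs_def] using fin m
    by (intro distr_action_space_pointwise measurable_vec_reflect distr_lborel_vec_reflect; simp)+
  have z: "centre_actions J m \<in> ?S \<rightarrow>\<^sub>M ?S" "distr ?S ?S (centre_actions J m) = ?S"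
    unfolding centre_actions_def[abs_def] using fin m
    by (intro distr_action_space_pointwise measurable_vec_minus measurable_vec_const distr_lborel_vec_translate; simp)+
  have c_meas: "?c \<in> borel_measurable ?S"
    using measurable_compose[OF measurable_action borel_measurable_mvn_density[OF M]]
    by (intro measurable_compose[OF _ measurable_ennreal] borel_measurable_prod) auto
  have "?L = distr ?L ?S (reflect_actions J m)"
    unfolding action_law_def
  proof (rule density_eq_distr_density[OF r \<rho>_meas])
    fix a assume a: "a \<in> space ?S"
    have "\<pi> j t s (reflect_actions J m a j) = \<pi> j t s (a j)" if j: "j \<in> J" for j
    proof -
      have "a j \<in> carrier_vec (adim G j)" using a j by auto
      then show ?thesis using dens(1)[OF j] j m[OF j] by (simp add: reflect_actions_def \<pi>)
    qed
    then show "?\<rho> (reflect_actions J m a) = ?\<rho> a" by simp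
  qed
  then have L: "distr ?L ?L (reflect_actions J m) = ?L" by (simp cong: distr_cong)
  \<comment> \<open>Translation to mean zero removes the state from the law.\<close>
  have C: "centred_action_law G M J = distr ?L ?S (centre_actions J m)"
    unfolding action_law_def centred_action_law_def
  proof (rule density_eq_distr_density[OF z c_meas])
    fix a assume a: "a \<in> space ?S"
    have "mvn_density (0\<^sub>v (adim G j)) (minv (M j)) (centre_actions J m a j) = \<pi> j t s (a j)" if j: "j \<in> J" for j
    proof -
      have "a j \<in> carrier_vec (adim G j)" using a j by auto
      then show ?thesis using dens(2)[OF j] j by (simp add: centre_actions_def \<pi>)
    qed
    then show "?c (centre_actions J m a) = ?\<rho> a" by simp
  qed
  have cong: "?S \<rightarrow>\<^sub>M ?S = ?L \<rightarrow>\<^sub>M ?L" "?S \<rightarrow>\<^sub>M ?S = ?L \<rightarrow>\<^sub>M ?S"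
    by (auto intro!: measurable_cong_sets)
  have "(\<integral>a. f a \<partial>?L) = c + (\<integral>a. q (centre_actions J m a) \<partial>?L)"
  proof (rule integral_reflection[OF _ L f])
    show "reflect_actions J m \<in> ?L \<rightarrow>\<^sub>M ?L" using r(1) by (simp only: cong(1))
  qed (use q(2) in simp)
  also have "(\<integral>a. q (centre_actions J m a) \<partial>?L) = (\<integral>a. q a \<partial>centred_action_law G M J)"
    unfolding C using z(1) q(1) by (intro integral_distr[symmetric]) (simp_all only: cong(2))
  finally show ?thesis .
qed

lemma vec_index_vsum [simp]: "p < d \<Longrightarrow> vec_index (vsum d f J) p = (\<Sum>j\<in>J. vec_index (f j) p)"
  by (simp add: vsum_def)

lemma vsum_carrier [simp]: "vsum d f J \<in> carrier_vec d"
  by (simp add: vsum_def)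

lemma dim_vsum [simp]: "dim_vec (vsum d f J) = d"
  by (simp add: vsum_def)

lemma vsum_cong: "(\<And>j. j \<in> J \<Longrightarrow> f j = g j) \<Longrightarrow> vsum d f J = vsum d g J"
  by (simp add: vsum_def)

context lqg
begin

lemma mult_B_minus:
  assumes "j \<in> agents G" "x \<in> carrier_vec (adim G j)" "y \<in> carrier_vec (adim G j)"
  shows "Bm G j *\<^sub>v (x - y) = Bm G j *\<^sub>v x - Bm G j *\<^sub>v y"
  using B_carrier[OF assms(1)] assms(2,3) by (rule mult_minus_distrib_mat_vec)

lemma mult_B_plus:
  assumes "j \<in> agents G" "x \<in> carrier_vec (adim G j)" "y \<in> carrier_vec (adim G j)"
  shows "Bm G j *\<^sub>v (x + y) = Bm G j *\<^sub>v x + Bm G j *\<^sub>v y"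
  using B_carrier[OF assms(1)] assms(2,3) by (rule mult_add_distrib_mat_vec)

text \<open>The next mean is affine in the joint action and so carries reflections to
  reflections.\<close>

lemma next_mean_reflect:
  assumes s: "s \<in> carrier_vec (sdim G)" and m: "\<And>j. j \<in> agents G \<Longrightarrow> m j \<in> carrier_vec (adim G j)"
    and a: "\<And>j. j \<in> agents G \<Longrightarrow> a j \<in> carrier_vec (adim G j)"
  shows "next_mean G s (reflect_actions (agents G) m a) = next_mean G s m + next_mean G s m - next_mean G s a"
    "vsum (sdim G) (\<lambda>j. Bm G j *\<^sub>v centre_actions (agents G) m a j) (agents G) = next_mean G s a - next_mean G s m"
proof -
  have B: "dim_vec (Bm G j *\<^sub>v x) = sdim G" if "j \<in> agents G" for j x using B_carrier[OF that] by simp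
  have A: "Am G *\<^sub>v s \<in> carrier_vec (sdim G)" using A_carrier s by simp
  have "vec_index (Bm G j *\<^sub>v (m j + m j - a j)) p
      = 2 * vec_index (Bm G j *\<^sub>v m j) p - vec_index (Bm G j *\<^sub>v a j) p" if "j \<in> agents G" "p < sdim G" for j p
    using that m[of j] a[of j] B[of j] by (simp add: mult_B_minus mult_B_plus del: index_mult_mat_vec)
  then show "next_mean G s (reflect_actions (agents G) m a) = next_mean G s m + next_mean G s m - next_mean G s a"
    unfolding next_mean_def reflect_actions_def using A
    by (intro eq_vecI) (simp_all add: sum_subtractf sum_distrib_left[symmetric] del: index_mult_mat_vec)
  have "vec_index (Bm G j *\<^sub>v (a j - m j)) p
      = vec_index (Bm G j *\<^sub>v a j) p - vec_index (Bm G j *\<^sub>v m j) p" if "j \<in> agents G" "p < sdim G" for j p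
    using that m[of j] a[of j] B[of j] by (simp add: mult_B_minus del: index_mult_mat_vec)
  then show "vsum (sdim G) (\<lambda>j. Bm G j *\<^sub>v centre_actions (agents G) m a j) (agents G) = next_mean G s a - next_mean G s m"
    unfolding next_mean_def centre_actions_def using A
    by (intro eq_vecI) (simp_all add: sum_subtractf del: index_mult_mat_vec)
qed

lemma cost_reflect:
  assumes i: "i \<in> agents G" and m: "\<And>j. j \<in> agents G \<Longrightarrow> m j \<in> carrier_vec (adim G j)"
    and a: "\<And>j. j \<in> agents G \<Longrightarrow> a j \<in> carrier_vec (adim G j)"
  shows "cost G i s a + cost G i s (reflect_actions (agents G) m a)
    = 2 * (cost G i s m + 1/2 * (\<Sum>j\<in>agents G. quad_form (Rm G i j) (centre_actions (agents G) m a j)))"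
proof -
  have "(\<Sum>j\<in>agents G. quad_form (Rm G i j) (a j)) + (\<Sum>j\<in>agents G. quad_form (Rm G i j) (reflect_actions (agents G) m a j))
      = 2 * (\<Sum>j\<in>agents G. quad_form (Rm G i j) (m j)) + 2 * (\<Sum>j\<in>agents G. quad_form (Rm G i j) (centre_actions (agents G) m a j))"
    unfolding sum.distrib[symmetric] sum_distrib_left
  proof (rule sum.cong[OF refl])
    fix j assume j: "j \<in> agents G"
    show "quad_form (Rm G i j) (a j) + quad_form (Rm G i j) (reflect_actions (agents G) m a j)
        = 2 * quad_form (Rm G i j) (m j) + 2 * quad_form (Rm G i j) (centre_actions (agents G) m a j)"
      using quad_form_reflect[OF _ _ a[OF j] m[OF j]] R_symmetric[OF i j] j
      by (simp add: reflect_actions_def centre_actions_def)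
  qed
  then show ?thesis by (simp add: cost_def field_simps)
qed

end

text \<open>Sum of the remainders in \<open>cost_reflect\<close> and
  \<open>quad_value_reflect\<close>. As it involves the deviations only, its expectation does not
  depend on the state.\<close>

definition stage_noise_cost :: "lqg_game \<Rightarrow> nat \<Rightarrow> rmat \<Rightarrow> joint_action \<Rightarrow> real" where
  "stage_noise_cost G i Z e = 1/2 * (\<Sum>j\<in>agents G. quad_form (Rm G i j) (e j))
     + 1/2 * quad_form Z (vsum (sdim G) (\<lambda>j. Bm G j *\<^sub>v e j) (agents G))"

lemma (in lqg_policy) integral_stage_cost:
  assumes i: "i \<in> agents G" and t: "t \<in> {1..horizon G}" and s: "s \<in> carrier_vec (sdim G)"
    and M: "\<And>j. j \<in> agents G \<Longrightarrow> pos_def (adim G j) (M j)"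
    and m: "\<And>j. j \<in> agents G \<Longrightarrow> m j \<in> carrier_vec (adim G j)"
    and \<pi>: "\<And>j a. j \<in> agents G \<Longrightarrow> a \<in> carrier_vec (adim G j) \<Longrightarrow> \<pi> j t s a = mvn_density (m j) (minv (M j)) a"
    and Z: "Z \<in> carrier_mat (sdim G) (sdim G)" "transpose_mat Z = Z" "\<xi> \<in> carrier_vec (sdim G)"
    and int: "integrable (action_law G \<pi> t (agents G) s) (\<lambda>a. cost G i s a + quad_value Z \<xi> \<kappa> (next_mean G s a))"
  shows "(\<integral>a. cost G i s a + quad_value Z \<xi> \<kappa> (next_mean G s a) \<partial>action_law G \<pi> t (agents G) s)
    = cost G i s m + quad_value Z \<xi> \<kappa> (next_mean G s m)
      + (\<integral>e. stage_noise_cost G i Z e \<partial>centred_action_law G M (agents G))"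
proof (rule integral_action_law_reflect[OF order.refl t s M m \<pi> int])
  show "stage_noise_cost G i Z \<in> borel_measurable (action_space G (agents G))"
    unfolding stage_noise_cost_def[abs_def] using R_symmetric[OF i] Z
    by (intro borel_measurable_add borel_measurable_times borel_measurable_const borel_measurable_sum
        borel_measurable_quad_form[OF _ measurable_action] borel_measurable_quad_form[OF Z(1)]
        measurable_vsum measurable_mult_mat_vec[OF B_carrier measurable_action]) auto
  fix a assume "a \<in> space (action_space G (agents G))"
  then have a: "a j \<in> carrier_vec (adim G j)" if "j \<in> agents G" for j using that by auto
  show "(cost G i s a + quad_value Z \<xi> \<kappa> (next_mean G s a))
      + (cost G i s (reflect_actions (agents G) m a) + quad_value Z \<xi> \<kappa> (next_mean G s (reflect_actions (agents G) m a)))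
    = 2 * (cost G i s m + quad_value Z \<xi> \<kappa> (next_mean G s m) + stage_noise_cost G i Z (centre_actions (agents G) m a))"
    unfolding stage_noise_cost_def
    using cost_reflect[where a = a and m = m, OF i m a, of s] next_mean_reflect[where a = a and m = m, OF s m a]
      quad_value_reflect[OF Z next_mean_carrier[OF s, of a] next_mean_carrier[OF s, of m], of \<kappa>]
    by simp
qed auto


section \<open>The equilibrium of a single stage\<close>

text \<open>Agrees with \<open>gain\<close>, but takes the continuation matrix itself as argument,
  so that the zero matrix covers the last stage.\<close>

definition stage_gain :: "lqg_game \<Rightarrow> nat \<Rightarrow> rmat \<Rightarrow> rmat" where
  "stage_gain G i Z = Rm G i i + transpose_mat (Bm G i) * Z * Bm G i"

lemma quad_value_add:
  assumes Z: "Z \<in> carrier_mat d d" "transpose_mat Z = Z" "\<xi> \<in> carrier_vec d"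
    and y: "y \<in> carrier_vec d" "u \<in> carrier_vec d"
  shows "quad_value Z \<xi> \<kappa> (y + u)
    = quad_value Z \<xi> \<kappa> y + 1/2 * quad_form Z u + scalar_prod u (Z *\<^sub>v y) + scalar_prod u \<xi>"
  using quad_form_add[OF Z(1,2) y] scalar_prod_add_distrib[OF Z(3) y] comm_scalar_prod[OF Z(3) y(2)]
  by (simp add: quad_value_def field_simps)

lemma mult_mat_vec_uminus:
  fixes A :: rmat
  assumes "A \<in> carrier_mat n d" "x \<in> carrier_vec d"
  shows "A *\<^sub>v (- x) = - (A *\<^sub>v x)"
  using assms by (auto simp: vec_eq_iff)

lemma congruence_mult_vec:
  fixes Z B :: rmat
  assumes Z: "Z \<in> carrier_mat n n" and B: "B \<in> carrier_mat n d" and a: "a \<in> carrier_vec d"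
  shows "(transpose_mat B * Z * B) *\<^sub>v a = transpose_mat B *\<^sub>v (Z *\<^sub>v (B *\<^sub>v a))"
proof -
  have "transpose_mat B * Z \<in> carrier_mat d n" "transpose_mat B \<in> carrier_mat d n" "B *\<^sub>v a \<in> carrier_vec n"
    using assms by auto
  then show ?thesis
    using assoc_mult_mat_vec[of "transpose_mat B * Z" d n B d a] assoc_mult_mat_vec[of "transpose_mat B" d n Z n "B *\<^sub>v a"] assms
    by simp
qed

lemma quad_form_congruence:
  assumes Z: "Z \<in> carrier_mat n n" and B: "B \<in> carrier_mat n d" and a: "a \<in> carrier_vec d"
  shows "quad_form (transpose_mat B * Z * B) a = quad_form Z (B *\<^sub>v a)"
  using scalar_prod_mult_mat_vec[of "transpose_mat B" d n a "Z *\<^sub>v (B *\<^sub>v a)"] assms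
  by (simp only: quad_form_def congruence_mult_vec[OF assms]) simp

lemma pos_semidef_congruence:
  assumes Z: "pos_semidef n Z" and B: "B \<in> carrier_mat n d"
  shows "pos_semidef d (transpose_mat B * Z * B)"
proof -
  have Zc: "Z \<in> carrier_mat n n" "transpose_mat Z = Z" using Z by (auto simp: pos_semidef_def)
  have BZ: "transpose_mat B \<in> carrier_mat d n" "transpose_mat B * Z \<in> carrier_mat d n" using B Zc by auto
  have "transpose_mat (transpose_mat B * Z * B) = transpose_mat B * (transpose_mat Z * B)"
    using transpose_mult[OF BZ(2) B] transpose_mult[OF BZ(1) Zc(1)] by simp
  also have "\<dots> = transpose_mat B * Z * B"
    using B Zc by simp
  finally show ?thesis
    using Z B mult_carrier_mat[OF BZ(2) B]
    by (simp add: pos_semidef_def quad_form_congruence[OF Zc(1) B] del: assoc_mult_mat)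
qed

lemma quad_form_add_mat:
  assumes "M \<in> carrier_mat d d" "N \<in> carrier_mat d d" "v \<in> carrier_vec d"
  shows "quad_form (M + N) v = quad_form M v + quad_form N v"
  using assms by (simp add: quad_form_def add_mult_distrib_mat_vec[of _ d d] scalar_prod_add_distrib[of _ d])

lemma pos_semidef_add:
  assumes "pos_semidef d M" "pos_semidef d N"
  shows "pos_semidef d (M + N)"
  using assms by (auto simp: pos_semidef_def transpose_add[of _ d d] quad_form_add_mat[of _ d])

context lqg
begin

text \<open>Strictness comes from \<open>Rm G i i\<close>, while \<open>Z\<close> contributes a
  nonnegative term. This is why semidefiniteness of \<open>Z\<close> is carried through the
  recursion.\<close>

lemma stage_gain:
  assumes i: "i \<in> agents G" and Z: "pos_semidef (sdim G) Z"
  shows "stage_gain G i Z \<in> carrier_mat (adim G i) (adim G i)"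
    "a \<in> carrier_vec (adim G i) \<Longrightarrow>
      quad_form (stage_gain G i Z) a = quad_form (Rm G i i) a + quad_form Z (Bm G i *\<^sub>v a)"
    "pos_def (adim G i) (stage_gain G i Z)"
proof -
  have Zc: "Z \<in> carrier_mat (sdim G) (sdim G)" using Z by (simp add: pos_semidef_def)
  have R: "pos_def (adim G i) (Rm G i i)" using valid i by (simp add: valid_game_def)
  note BZB = pos_semidef_congruence[OF Z B_carrier[OF i]]
  have psd: "pos_semidef (adim G i) (stage_gain G i Z)"
    unfolding stage_gain_def by (rule pos_semidef_add[OF pos_def_imp_pos_semidef[OF R] BZB])
  then show c: "stage_gain G i Z \<in> carrier_mat (adim G i) (adim G i)" by (simp add: pos_semidef_def)
  show q: "quad_form (stage_gain G i Z) a = quad_form (Rm G i i) a + quad_form Z (Bm G i *\<^sub>v a)"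
    if a: "a \<in> carrier_vec (adim G i)" for a
    using R BZB a unfolding stage_gain_def quad_form_congruence[OF Zc B_carrier[OF i] a, symmetric]
    by (intro quad_form_add_mat[of _ "adim G i"]) (auto simp: pos_def_def pos_semidef_def)
  have "0 < quad_form (stage_gain G i Z) v" if "v \<in> carrier_vec (adim G i)" "v \<noteq> 0\<^sub>v (adim G i)" for v
  proof -
    have "0 \<le> quad_form Z (Bm G i *\<^sub>v v)" using Z B_carrier[OF i] that by (simp add: pos_semidef_def)
    moreover have "0 < quad_form (Rm G i i) v" using R that by (simp add: pos_def_def)
    ultimately show ?thesis using q[OF that(1)] by simp
  qed
  then show "pos_def (adim G i) (stage_gain G i Z)" using psd by (simp add: pos_def_def pos_semidef_def)
qed

lemma next_mean_update:
  assumes i: "i \<in> agents G" and s: "s \<in> carrier_vec (sdim G)" and a: "a \<in> carrier_vec (adim G i)"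
  shows "next_mean G s (b(i := a))
      = (Am G *\<^sub>v s + vsum (sdim G) (\<lambda>j. Bm G j *\<^sub>v b j) (agents G - {i})) + Bm G i *\<^sub>v a"
proof -
  have A: "Am G *\<^sub>v s \<in> carrier_vec (sdim G)" using A_carrier s by simp
  have d: "dim_row (Bm G i) = sdim G" using B_carrier[OF i] by simp
  have "(\<Sum>j\<in>agents G. vec_index (Bm G j *\<^sub>v (b(i := a)) j) p)
      = vec_index (Bm G i *\<^sub>v a) p + (\<Sum>j\<in>agents G - {i}. vec_index (Bm G j *\<^sub>v b j) p)" for p
    by (subst sum.remove[OF finite_agents i]) (auto intro!: sum.cong)
  then show ?thesis
    using A d unfolding next_mean_def by (intro eq_vecI) (simp_all del: index_mult_mat_vec fun_upd_apply)
qed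

lemma cost_update:
  assumes "i \<in> agents G"
  shows "cost G i s (b(i := a)) = 1/2 * (quad_form (Qm G i) s + scalar_prod (lv G i) s
      + (\<Sum>j\<in>agents G - {i}. quad_form (Rm G i j) (b j))) + 1/2 * quad_form (Rm G i i) a"
proof -
  have "(\<Sum>j\<in>agents G. quad_form (Rm G i j) ((b(i := a)) j))
      = quad_form (Rm G i i) a + (\<Sum>j\<in>agents G - {i}. quad_form (Rm G i j) (b j))"
    by (subst sum.remove[OF finite_agents assms]) (auto intro!: sum.cong)
  then show ?thesis by (simp add: cost_def)
qed

end

text \<open>The first order condition of agent \<open>i\<close> at the actions \<open>b\<close> of the other agents reads
  \<open>stage_gain G i Z *\<^sub>v a + stage_gradient G i Z \<xi> s b = 0\<close>.\<close>

definition stage_gradient :: "lqg_game \<Rightarrow> nat \<Rightarrow> rmat \<Rightarrow> rvec \<Rightarrow> rvec \<Rightarrow> joint_action \<Rightarrow> rvec" where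
  "stage_gradient G i Z \<xi> s b =
     (transpose_mat (Bm G i) * Z) *\<^sub>v (Am G *\<^sub>v s + vsum (sdim G) (\<lambda>j. Bm G j *\<^sub>v b j) (agents G - {i}))
     + transpose_mat (Bm G i) *\<^sub>v \<xi>"

context lqg
begin

lemma stage_gradient_carrier [simp]:
  "i \<in> agents G \<Longrightarrow> stage_gradient G i Z \<xi> s b \<in> carrier_vec (adim G i)"
  using B_carrier[of i] by (intro carrier_vecI) (simp add: stage_gradient_def)

text \<open>Expansion in the own action about zero. The other actions \<open>b\<close> occur in the
  constant and the linear term but not in the quadratic one, so averaging over them leaves the
  latter alone.\<close>

lemma stage_cost_update:
  assumes i: "i \<in> agents G" and s: "s \<in> carrier_vec (sdim G)" and a: "a \<in> carrier_vec (adim G i)"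
    and Z: "pos_semidef (sdim G) Z" "\<xi> \<in> carrier_vec (sdim G)"
  shows "cost G i s (b(i := a)) + quad_value Z \<xi> \<kappa> (next_mean G s (b(i := a)))
    = (cost G i s (b(i := 0\<^sub>v (adim G i))) + quad_value Z \<xi> \<kappa> (next_mean G s (b(i := 0\<^sub>v (adim G i)))))
      + 1/2 * quad_form (stage_gain G i Z) a + scalar_prod a (stage_gradient G i Z \<xi> s b)"
proof -
  let ?B = "Bm G i"
  define y where "y = Am G *\<^sub>v s + vsum (sdim G) (\<lambda>j. Bm G j *\<^sub>v b j) (agents G - {i})"
  have Zc: "Z \<in> carrier_mat (sdim G) (sdim G)" "transpose_mat Z = Z" using Z by (auto simp: pos_semidef_def)
  have B: "?B \<in> carrier_mat (sdim G) (adim G i)" "transpose_mat ?B \<in> carrier_mat (adim G i) (sdim G)"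
    using B_carrier[OF i] by auto
  have y: "y \<in> carrier_vec (sdim G)" using A_carrier s by (simp add: y_def)
  have u: "?B *\<^sub>v a \<in> carrier_vec (sdim G)" using B a by simp
  have y0: "next_mean G s (b(i := 0\<^sub>v (adim G i))) = y"
    using B y by (subst next_mean_update[OF i s]) (auto simp: y_def[symmetric] vec_eq_iff)
  have q0: "quad_form (Rm G i i) (0\<^sub>v (adim G i)) = 0"
    using R_symmetric[OF i i] by (auto simp: quad_form_def intro!: scalar_prod_left_zero mult_mat_vec_carrier)
  have "scalar_prod a (stage_gradient G i Z \<xi> s b) = scalar_prod (?B *\<^sub>v a) (Z *\<^sub>v y) + scalar_prod (?B *\<^sub>v a) \<xi>"
    using scalar_prod_mult_mat_vec[OF B(2) a, of "Z *\<^sub>v y"] scalar_prod_mult_mat_vec[OF B(2) a Z(2)] B Zc y Z(2) a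
    by (simp add: stage_gradient_def y_def[symmetric] scalar_prod_add_distrib[of _ "adim G i"] assoc_mult_mat_vec[of _ _ "sdim G"])
  moreover have "quad_value Z \<xi> \<kappa> (next_mean G s (b(i := a)))
      = quad_value Z \<xi> \<kappa> y + 1/2 * quad_form Z (?B *\<^sub>v a) + scalar_prod (?B *\<^sub>v a) (Z *\<^sub>v y) + scalar_prod (?B *\<^sub>v a) \<xi>"
    unfolding next_mean_update[OF i s a] y_def[symmetric] by (rule quad_value_add[OF Zc Z(2) y u])
  ultimately show ?thesis
    unfolding y0 stage_gain(2)[OF i Z(1) a] by (simp add: cost_update[OF i] q0 field_simps)
qed

text \<open>The gradient is affine in the actions of the others, so no even remainder is left and
  its expectation will be its value at their means. It is treated by coordinates because the
  reflection lemma is about real functions.\<close>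

lemma stage_gradient_reflect:
  assumes i: "i \<in> agents G" and s: "s \<in> carrier_vec (sdim G)"
    and Z: "Z \<in> carrier_mat (sdim G) (sdim G)"
    and m: "\<And>j. j \<in> agents G - {i} \<Longrightarrow> m j \<in> carrier_vec (adim G j)"
    and b: "\<And>j. j \<in> agents G - {i} \<Longrightarrow> b j \<in> carrier_vec (adim G j)"
    and p: "p < adim G i"
  shows "vec_index (stage_gradient G i Z \<xi> s b) p
      + vec_index (stage_gradient G i Z \<xi> s (reflect_actions (agents G - {i}) m b)) p
    = 2 * vec_index (stage_gradient G i Z \<xi> s m) p"
proof -
  let ?J = "agents G - {i}"
  define y where "y b = Am G *\<^sub>v s + vsum (sdim G) (\<lambda>j. Bm G j *\<^sub>v b j) ?J" for b
  have y: "y b \<in> carrier_vec (sdim G)" for b using A_carrier s by (simp add: y_def)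
  have C: "transpose_mat (Bm G i) * Z \<in> carrier_mat (adim G i) (sdim G)" using B_carrier[OF i] Z by simp
  have "vec_index (Bm G j *\<^sub>v (m j + m j - b j)) q
      = 2 * vec_index (Bm G j *\<^sub>v m j) q - vec_index (Bm G j *\<^sub>v b j) q" if "j \<in> ?J" "q < sdim G" for j q
    using that m[of j] b[of j] B_carrier[of j] by (simp add: mult_B_minus mult_B_plus del: index_mult_mat_vec)
  then have "y (reflect_actions ?J m b) = y m + y m - y b"
    unfolding y_def reflect_actions_def using A_carrier s
    by (intro eq_vecI) (simp_all add: sum_subtractf sum_distrib_left[symmetric] del: index_mult_mat_vec)
  then have "(transpose_mat (Bm G i) * Z) *\<^sub>v y (reflect_actions ?J m b)
      = (transpose_mat (Bm G i) * Z) *\<^sub>v y m + (transpose_mat (Bm G i) * Z) *\<^sub>v y m - (transpose_mat (Bm G i) * Z) *\<^sub>v y b"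
    using C y by (simp add: mult_minus_distrib_mat_vec[OF C] mult_add_distrib_mat_vec[OF C])
  then show ?thesis
    unfolding stage_gradient_def y_def[symmetric] using B_carrier[OF i] p C
    by (simp del: index_mult_mat_vec)
qed

end

text \<open>The mean of each agent depends on the laws of the others, which are unknown at first.
  Averaging the gradient over these laws, whatever they are, already makes all policies Gaussian,
  with means \<open>m\<close>; the averages are then evaluated anew with these Gaussians and become
  gradients at \<open>m\<close>.\<close>

lemma (in lqg_policy) stage_equilibrium:
  assumes ece: "is_ECE G \<pi>" and t: "t \<in> {1..horizon G}" and s: "s \<in> carrier_vec (sdim G)"
    and Z: "\<And>i. i \<in> agents G \<Longrightarrow> pos_semidef (sdim G) (Z i)"
    and \<xi>: "\<And>i. i \<in> agents G \<Longrightarrow> \<xi> i \<in> carrier_vec (sdim G)"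
    and Q: "\<And>i a. i \<in> agents G \<Longrightarrow> a \<in> space (action_space G (agents G)) \<Longrightarrow>
      Qfun G \<pi> i t s a = cost G i s a + quad_value (Z i) (\<xi> i) (\<kappa> i) (next_mean G s a)"
  obtains m where "\<And>i. i \<in> agents G \<Longrightarrow> m i \<in> carrier_vec (adim G i)"
    "\<And>i a. i \<in> agents G \<Longrightarrow> a \<in> carrier_vec (adim G i) \<Longrightarrow>
      \<pi> i t s a = mvn_density (m i) (minv (stage_gain G i (Z i))) a"
    "\<And>i. i \<in> agents G \<Longrightarrow>
      stage_gain G i (Z i) *\<^sub>v m i + stage_gradient G i (Z i) (\<xi> i) s m = 0\<^sub>v (adim G i)"
proof -
  let ?J = "\<lambda>i. agents G - {i}"
  let ?L = "\<lambda>i. action_law G \<pi> t (agents G - {i}) s"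
  let ?M = "\<lambda>i. stage_gain G i (Z i)"
  let ?g = "\<lambda>i. stage_gradient G i (Z i) (\<xi> i) s"
  define v where "v i = Matrix.vec (adim G i) (\<lambda>p. \<integral>b. vec_index (?g i b) p \<partial>?L i)" for i
  define m where "m i = - (minv (?M i) *\<^sub>v v i)" for i
  have inv: "?M i \<in> carrier_mat (adim G i) (adim G i)"
    "minv (?M i) \<in> carrier_mat (adim G i) (adim G i)" "?M i * minv (?M i) = 1\<^sub>m (adim G i)" if "i \<in> agents G" for i
    using stage_gain[OF that Z[OF that]] minv_inverse pos_def_det by blast+
  have v: "v i \<in> carrier_vec (adim G i)" for i by (simp add: v_def)
  have m: "m i \<in> carrier_vec (adim G i)" if "i \<in> agents G" for i
    using inv(2)[OF that] v by (simp add: m_def)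
  have expand: "Qfun G \<pi> i t s (b(i := a)) = Qfun G \<pi> i t s (b(i := 0\<^sub>v (adim G i)))
      + 1/2 * quad_form (?M i) a + scalar_prod a (?g i b)"
    if i: "i \<in> agents G" and a: "a \<in> carrier_vec (adim G i)" and b: "b \<in> space (?L i)" for i a b
  proof -
    have upd: "b(i := x) \<in> space (action_space G (agents G))" if "x \<in> carrier_vec (adim G i)" for x
      using that b i by (auto simp: PiE_iff extensional_def)
    show ?thesis
      unfolding Q[OF i upd[OF a]] Q[OF i upd[OF zero_carrier_vec]]
      by (rule stage_cost_update[OF i s a Z[OF i] \<xi>[OF i]])
  qed
  have Q_int: "integrable (?L i) (\<lambda>b. Qfun G \<pi> i t s (b(i := a)))"
    if "i \<in> agents G" "a \<in> carrier_vec (adim G i)" for i a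
    using ece t s that unfolding is_ECE_def Q_defined_def by blast
  \<comment> \<open>The difference of two integrable Q functions, at own action \<open>a\<close> and
    at own action zero, isolates the linear term.\<close>
  have lin_int: "integrable (?L i) (\<lambda>b. scalar_prod a (?g i b))"
    if i: "i \<in> agents G" and a: "a \<in> carrier_vec (adim G i)" for i a
  proof -
    interpret prob_space "?L i" by (rule prob_space_action_law[OF _ t s]) auto
    have "integrable (?L i) (\<lambda>b. Qfun G \<pi> i t s (b(i := a)) - Qfun G \<pi> i t s (b(i := 0\<^sub>v (adim G i)))
        - 1/2 * quad_form (?M i) a)"
      by (intro Bochner_Integration.integrable_diff Q_int i a zero_carrier_vec integrable_const)
    also have "?this \<longleftrightarrow> ?thesis"
    proof (rule Bochner_Integration.integrable_cong[OF refl])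
      fix b assume "b \<in> space (?L i)"
      from expand[OF i a this]
      show "Qfun G \<pi> i t s (b(i := a)) - Qfun G \<pi> i t s (b(i := 0\<^sub>v (adim G i))) - 1/2 * quad_form (?M i) a
          = scalar_prod a (?g i b)" by simp
    qed
    finally show ?thesis .
  qed
  \<comment> \<open>Unit vectors as own actions pick out the coordinates of the gradient.\<close>
  have g_int: "integrable (?L i) (\<lambda>b. vec_index (?g i b) p)" if i: "i \<in> agents G" and p: "p < adim G i" for i p
    using lin_int[OF i unit_vec_carrier[of "adim G i" p]]
      scalar_prod_left_unit[OF stage_gradient_carrier[OF i] p] by simp
  have lin: "(\<integral>b. scalar_prod a (?g i b) \<partial>?L i) = scalar_prod a (v i)"
    if i: "i \<in> agents G" and a: "a \<in> carrier_vec (adim G i)" for i a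
  proof -
    have dim: "dim_vec (?g i b) = adim G i" for b
      using stage_gradient_carrier[OF i] by (rule carrier_vecD)
    have "(\<integral>b. scalar_prod a (?g i b) \<partial>?L i)
        = (\<Sum>p\<in>{0..<adim G i}. vec_index a p * (\<integral>b. vec_index (?g i b) p \<partial>?L i))"
      using g_int[OF i] by (simp add: scalar_prod_def dim)
    then show ?thesis by (simp add: scalar_prod_def v_def)
  qed
  have Qbar: "Qbar G \<pi> i t s a = (\<integral>b. Qfun G \<pi> i t s (b(i := 0\<^sub>v (adim G i))) \<partial>?L i)
      + 1/2 * quad_form (?M i) a + scalar_prod a (v i)"
    if i: "i \<in> agents G" and a: "a \<in> carrier_vec (adim G i)" for i a
  proof -
    interpret prob_space "?L i" by (rule prob_space_action_law[OF _ t s]) auto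
    have "Qbar G \<pi> i t s a = (\<integral>b. Qfun G \<pi> i t s (b(i := 0\<^sub>v (adim G i)))
        + 1/2 * quad_form (?M i) a + scalar_prod a (?g i b) \<partial>?L i)"
      unfolding Qbar_def by (rule Bochner_Integration.integral_cong[OF refl]) (rule expand[OF i a])
    also have "\<dots> = (\<integral>b. Qfun G \<pi> i t s (b(i := 0\<^sub>v (adim G i))) \<partial>?L i)
        + 1/2 * quad_form (?M i) a + (\<integral>b. scalar_prod a (?g i b) \<partial>?L i)"
      using Q_int[OF i zero_carrier_vec] lin_int[OF i a] prob_space by simp
    finally show ?thesis by (simp only: lin[OF i a])
  qed
  have gauss: "\<pi> i t s a = mvn_density (m i) (minv (?M i)) a"
    if i: "i \<in> agents G" and a: "a \<in> carrier_vec (adim G i)" for i a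
  proof -
    have "\<pi> i t s a = exp (- Qbar G \<pi> i t s a) / (\<integral>a'. exp (- Qbar G \<pi> i t s a') \<partial>lborel_vec (adim G i))"
      using ece t s that unfolding is_ECE_def by blast
    also have "\<dots> = mvn_density (m i) (minv (?M i)) a"
      unfolding m_def
      by (rule softmax_quadratic_eq_mvn_density[OF stage_gain(3)[OF i Z[OF i]] v Qbar[OF i] a])
    finally show ?thesis .
  qed
  \<comment> \<open>Now that \<open>gauss\<close> holds for all agents, the reflection lemma applies
    to the others, with zero remainder.\<close>
  have v_eq: "v i = ?g i m" if i: "i \<in> agents G" for i
  proof (rule eq_vecI)
    have dim: "dim_vec (?g i m) = adim G i"
      using stage_gradient_carrier[OF i] by (rule carrier_vecD)
    then show "dim_vec (v i) = dim_vec (?g i m)" by (simp add: v_def)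
    fix p assume "p < dim_vec (?g i m)"
    then have p: "p < adim G i" using dim by simp
    have "(\<integral>b. vec_index (?g i b) p \<partial>?L i) = vec_index (?g i m) p + (\<integral>b. 0 \<partial>centred_action_law G (\<lambda>j. ?M j) (?J i))"
    proof (rule integral_action_law_reflect[OF _ t s _ _ gauss g_int[OF i p]])
      fix b assume "b \<in> space (action_space G (?J i))"
      then have b: "b j \<in> carrier_vec (adim G j)" if "j \<in> ?J i" for j using that by auto
      show "vec_index (?g i b) p + vec_index (?g i (reflect_actions (?J i) m b)) p = 2 * (vec_index (?g i m) p + 0)"
        using stage_gradient_reflect[where b = b and m = m, OF i s _ _ b p] Z[OF i] m by (simp add: pos_semidef_def)
    qed (use m stage_gain(3) Z in auto)
    then show "vec_index (v i) p = vec_index (?g i m) p" using p by (simp add: v_def)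
  qed
  have foc: "?M i *\<^sub>v m i + ?g i m = 0\<^sub>v (adim G i)" if i: "i \<in> agents G" for i
  proof -
    have "?M i *\<^sub>v (minv (?M i) *\<^sub>v v i) = v i"
      using assoc_mult_mat_vec[OF inv(1,2)[OF i] v] inv(3)[OF i] v by simp
    then have "?M i *\<^sub>v m i = - v i"
      using inv[OF i] v unfolding m_def by (subst mult_mat_vec_uminus[of _ "adim G i" "adim G i"]) auto
    then show ?thesis using v by (simp add: v_eq[OF i, symmetric])
  qed
  show ?thesis using that[OF m gauss foc] by blast
qed


section \<open>The backward recursion\<close>

lemma mat_eqI_mult_unit:
  fixes A B :: rmat
  assumes "A \<in> carrier_mat n d" "B \<in> carrier_mat n d"
    and eq: "\<And>k. k < d \<Longrightarrow> A *\<^sub>v unit_vec d k = B *\<^sub>v unit_vec d k"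
  shows "A = B"
proof (rule eq_matI)
  fix p k assume "p < dim_row B" "k < dim_col B"
  then have k: "k < d" and "vec_index (A *\<^sub>v unit_vec d k) p = A $$ (p, k)" "vec_index (B *\<^sub>v unit_vec d k) p = B $$ (p, k)"
    using assms(1,2) by auto
  then show "A $$ (p, k) = B $$ (p, k)" by (simp only: eq[OF k])
qed (use assms in auto)

lemma mult_mat_vec_zero: "M \<in> carrier_mat n d \<Longrightarrow> M *\<^sub>v 0\<^sub>v d = (0\<^sub>v n :: rvec)"
  by (auto simp: vec_eq_iff)

lemma scalar_prod_vsum:
  assumes "\<And>j. j \<in> J \<Longrightarrow> f j \<in> carrier_vec d"
  shows "scalar_prod v (vsum d f J) = (\<Sum>j\<in>J. scalar_prod v (f j))"
proof -
  have "scalar_prod v (vsum d f J) = (\<Sum>p\<in>{0..<d}. \<Sum>j\<in>J. vec_index v p * vec_index (f j) p)"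
    by (simp add: scalar_prod_def sum_distrib_left)
  also have "\<dots> = (\<Sum>j\<in>J. \<Sum>p\<in>{0..<d}. vec_index v p * vec_index (f j) p)"
    by (rule sum.swap)
  also have "\<dots> = (\<Sum>j\<in>J. scalar_prod v (f j))"
    using assms by (intro sum.cong[OF refl]) (simp add: scalar_prod_def carrier_vecD[OF assms])
  finally show ?thesis .
qed

lemma msum_carrier [simp]: "msum d e f J \<in> carrier_mat d e"
  by (simp add: msum_def)

lemma msum_mult_vec:
  assumes f: "\<And>j. j \<in> J \<Longrightarrow> f j \<in> carrier_mat d e" and v: "v \<in> carrier_vec e"
  shows "msum d e f J *\<^sub>v v = vsum d (\<lambda>j. f j *\<^sub>v v) J"
proof (rule eq_vecI)
  fix p assume "p < dim_vec (vsum d (\<lambda>j. f j *\<^sub>v v) J)"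
  then have p: "p < d" by simp
  have "vec_index (msum d e f J *\<^sub>v v) p = (\<Sum>k\<in>{0..<e}. \<Sum>j\<in>J. f j $$ (p, k) * vec_index v k)"
    using p v by (simp add: msum_def scalar_prod_def sum_distrib_right)
  also have "\<dots> = (\<Sum>j\<in>J. \<Sum>k\<in>{0..<e}. f j $$ (p, k) * vec_index v k)"
    by (rule sum.swap)
  also have "\<dots> = (\<Sum>j\<in>J. vec_index (f j *\<^sub>v v) p)"
  proof (rule sum.cong[OF refl])
    fix j assume "j \<in> J"
    then show "(\<Sum>k\<in>{0..<e}. f j $$ (p, k) * vec_index v k) = vec_index (f j *\<^sub>v v) p"
      using f[of j] v p by (simp add: scalar_prod_def)
  qed
  finally show "vec_index (msum d e f J *\<^sub>v v) p = vec_index (vsum d (\<lambda>j. f j *\<^sub>v v) J) p"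
    using p by simp
qed (simp add: msum_def)

lemma quad_form_msum:
  assumes f: "\<And>j. j \<in> J \<Longrightarrow> f j \<in> carrier_mat d d" and v: "v \<in> carrier_vec d"
  shows "quad_form (msum d d f J) v = (\<Sum>j\<in>J. quad_form (f j) v)"
proof -
  have "msum d d f J *\<^sub>v v = vsum d (\<lambda>j. f j *\<^sub>v v) J" using f v by (rule msum_mult_vec)
  moreover have "scalar_prod v (vsum d (\<lambda>j. f j *\<^sub>v v) J) = (\<Sum>j\<in>J. scalar_prod v (f j *\<^sub>v v))"
    by (rule scalar_prod_vsum) (rule mult_mat_vec_carrier[OF f v])
  ultimately show ?thesis by (simp add: quad_form_def)
qed

lemma pos_semidef_msum:
  assumes f: "\<And>j. j \<in> J \<Longrightarrow> pos_semidef d (f j)"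
  shows "pos_semidef d (msum d d f J)"
proof -
  have c: "f j \<in> carrier_mat d d" "transpose_mat (f j) = f j" if "j \<in> J" for j
    using f[OF that] by (auto simp: pos_semidef_def)
  have "f j $$ (q, p) = f j $$ (p, q)" if "j \<in> J" "p < d" "q < d" for j p q
    using arg_cong[OF c(2)[OF that(1)], of "\<lambda>A. A $$ (p, q)"] c(1)[OF that(1)] that by simp
  then have "transpose_mat (msum d d f J) = msum d d f J"
    by (intro eq_matI) (auto simp: msum_def intro!: sum.cong)
  moreover have "0 \<le> quad_form (msum d d f J) v" if "v \<in> carrier_vec d" for v
    using f that by (subst quad_form_msum[OF c(1)]) (auto simp: pos_semidef_def intro!: sum_nonneg)
  ultimately show ?thesis by (simp add: pos_semidef_def)
qed

text \<open>Primitive recursion on the distance \<open>T - t\<close> to the horizon; the step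
  depends on the time, which is recovered as \<open>T - Suc d\<close>.\<close>

lemma backward_recursion: "\<exists>f. f T = c \<and> (\<forall>t<T. f t = h t (f (Suc t)))"
proof -
  define f where "f t = rec_nat c (\<lambda>d. h (T - Suc d)) (T - t)" for t
  have "f t = h t (f (Suc t))" if "t < T" for t
  proof -
    have "T - t = Suc (T - Suc t)" "T - Suc (T - Suc t) = t" using that by auto
    then show ?thesis by (simp add: f_def)
  qed
  moreover have "f T = c" by (simp add: f_def)
  ultimately show ?thesis by blast
qed

text \<open>The coefficient operator shared by the linear systems for \<open>P\<close> and for \<open>\<alpha>\<close>.\<close>

definition stage_system :: "lqg_game \<Rightarrow> nat \<Rightarrow> rmat \<Rightarrow> joint_action \<Rightarrow> rvec" where
  "stage_system G i Z x = stage_gain G i Z *\<^sub>v x i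
     + (transpose_mat (Bm G i) * Z) *\<^sub>v vsum (sdim G) (\<lambda>j. Bm G j *\<^sub>v x j) (agents G - {i})"

section \<open>The linear system for the means and the closed loop\<close>

context lqg
begin

lemma BZ_carrier:
  "i \<in> agents G \<Longrightarrow> Z \<in> carrier_mat (sdim G) (sdim G) \<Longrightarrow>
    transpose_mat (Bm G i) * Z \<in> carrier_mat (adim G i) (sdim G)"
  using B_carrier[of i] by auto

lemma stage_system_carrier [simp]:
  "i \<in> agents G \<Longrightarrow> stage_system G i Z x \<in> carrier_vec (adim G i)"
  using B_carrier[of i] by (intro carrier_vecI) (simp add: stage_system_def)

lemma stage_system_plus:
  assumes i: "i \<in> agents G" and Z: "pos_semidef (sdim G) Z"
    and x: "\<And>j. j \<in> agents G \<Longrightarrow> x j \<in> carrier_vec (adim G j)"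
    and y: "\<And>j. j \<in> agents G \<Longrightarrow> y j \<in> carrier_vec (adim G j)"
  shows "stage_system G i Z (\<lambda>j. x j + y j) = stage_system G i Z x + stage_system G i Z y"
proof -
  let ?V = "\<lambda>x. vsum (sdim G) (\<lambda>j. Bm G j *\<^sub>v x j) (agents G - {i})"
  have C: "transpose_mat (Bm G i) * Z \<in> carrier_mat (adim G i) (sdim G)"
    using Z by (intro BZ_carrier i) (simp add: pos_semidef_def)
  have "vec_index (Bm G j *\<^sub>v (x j + y j)) p = vec_index (Bm G j *\<^sub>v x j) p + vec_index (Bm G j *\<^sub>v y j) p"
    if "j \<in> agents G" "p < sdim G" for j p
    using that x[of j] y[of j] B_carrier[of j] by (simp add: mult_B_plus del: index_mult_mat_vec)
  then have "?V (\<lambda>j. x j + y j) = ?V x + ?V y"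
    by (intro eq_vecI) (simp_all add: sum.distrib del: index_mult_mat_vec)
  then have "(transpose_mat (Bm G i) * Z) *\<^sub>v ?V (\<lambda>j. x j + y j)
      = (transpose_mat (Bm G i) * Z) *\<^sub>v ?V x + (transpose_mat (Bm G i) * Z) *\<^sub>v ?V y"
    by (simp add: mult_add_distrib_mat_vec[OF C])
  moreover have "stage_gain G i Z *\<^sub>v (x i + y i) = stage_gain G i Z *\<^sub>v x i + stage_gain G i Z *\<^sub>v y i"
    by (rule mult_add_distrib_mat_vec[OF stage_gain(1)[OF i Z] x[OF i] y[OF i]])
  ultimately show ?thesis
    unfolding stage_system_def using B_carrier[OF i] stage_gain(1)[OF i Z]
    by (intro eq_vecI) (simp_all del: index_mult_mat_vec)
qed

text \<open>Follows from additivity, applied to \<open>x j + - x j\<close>, and the value at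
  zero.\<close>

lemma stage_system_uminus:
  assumes i: "i \<in> agents G" and Z: "pos_semidef (sdim G) Z"
    and x: "\<And>j. j \<in> agents G \<Longrightarrow> x j \<in> carrier_vec (adim G j)"
  shows "stage_system G i Z (\<lambda>j. - x j) = - stage_system G i Z x"
proof -
  have Zc: "Z \<in> carrier_mat (sdim G) (sdim G)" using Z by (simp add: pos_semidef_def)
  have x': "- x j \<in> carrier_vec (adim G j)" if "j \<in> agents G" for j using x[OF that] by simp
  have 0: "stage_system G i Z (\<lambda>j. 0\<^sub>v (adim G j)) = 0\<^sub>v (adim G i)"
  proof -
    have "vsum (sdim G) (\<lambda>j. Bm G j *\<^sub>v 0\<^sub>v (adim G j)) (agents G - {i}) = 0\<^sub>v (sdim G)"
      using mult_mat_vec_zero[OF B_carrier] by (intro eq_vecI) (simp_all del: index_mult_mat_vec)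
    then show ?thesis
      unfolding stage_system_def by (simp add: mult_mat_vec_zero[OF stage_gain(1)[OF i Z]] mult_mat_vec_zero[OF BZ_carrier[OF i Zc]])
  qed
  have "stage_system G i Z (\<lambda>j. x j + - x j) = stage_system G i Z (\<lambda>j. 0\<^sub>v (adim G j))"
  proof -
    have e: "x j + - x j = 0\<^sub>v (adim G j)" if "j \<in> agents G" for j using x[OF that] by simp
    have "vsum (sdim G) (\<lambda>j. Bm G j *\<^sub>v (x j + - x j)) (agents G - {i})
        = vsum (sdim G) (\<lambda>j. Bm G j *\<^sub>v 0\<^sub>v (adim G j)) (agents G - {i})"
      by (rule vsum_cong) (simp add: e)
    then show ?thesis unfolding stage_system_def e[OF i] by (simp only:)
  qed
  then have "stage_system G i Z x + stage_system G i Z (\<lambda>j. - x j) = 0\<^sub>v (adim G i)"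
    using stage_system_plus[OF i Z x x'] 0 by simp
  from this[unfolded vec_eq_iff] show ?thesis
    using stage_system_carrier[OF i, THEN carrier_vecD]
    by (intro eq_vecI) (simp_all add: add_eq_0_iff)
qed

text \<open>The first order condition with the unknown means collected on the left. The operator
  there is the one that acts on the columns of \<open>P\<close> and on \<open>\<alpha>\<close>,
  which makes the means comparable with them.\<close>

lemma stage_gain_gradient:
  assumes i: "i \<in> agents G" and Z: "pos_semidef (sdim G) Z" and s: "s \<in> carrier_vec (sdim G)"
    and foc: "stage_gain G i Z *\<^sub>v m i + stage_gradient G i Z \<xi> s m = 0\<^sub>v (adim G i)"
  shows "stage_system G i Z m
    = - ((transpose_mat (Bm G i) * Z * Am G) *\<^sub>v s) - transpose_mat (Bm G i) *\<^sub>v \<xi>"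
proof -
  have C: "transpose_mat (Bm G i) * Z \<in> carrier_mat (adim G i) (sdim G)"
    using Z by (intro BZ_carrier i) (simp add: pos_semidef_def)
  have As: "Am G *\<^sub>v s \<in> carrier_vec (sdim G)" using A_carrier s by simp
  have CA: "(transpose_mat (Bm G i) * Z * Am G) *\<^sub>v s = (transpose_mat (Bm G i) * Z) *\<^sub>v (Am G *\<^sub>v s)"
    by (rule assoc_mult_mat_vec[OF C A_carrier s])
  have eq: "g + u = - a - x"
    if "g + ((a + u) + x) = 0\<^sub>v d" "g \<in> carrier_vec d" "a \<in> carrier_vec d" "u \<in> carrier_vec d" "x \<in> carrier_vec d"
    for g a u x :: rvec and d
  proof (rule eq_vecI)
    fix p assume "p < dim_vec (- a - x)"
    then have p: "p < d" using that by simp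
    have "vec_index (g + ((a + u) + x)) p = 0" unfolding that(1) using p by simp
    moreover have "vec_index (g + ((a + u) + x)) p = vec_index g p + ((vec_index a p + vec_index u p) + vec_index x p)"
      using p that(2-) by simp
    ultimately show "vec_index (g + u) p = vec_index (- a - x) p"
      using p that(2-) by simp
  qed (use that in auto)
  show ?thesis
    unfolding stage_system_def CA
  proof (rule eq[OF foc[unfolded stage_gradient_def mult_add_distrib_mat_vec[OF C As vsum_carrier]]])
    show "stage_gain G i Z *\<^sub>v m i \<in> carrier_vec (adim G i)"
      using stage_gain(1)[OF i Z] by (intro carrier_vecI) simp
    show "transpose_mat (Bm G i) *\<^sub>v \<xi> \<in> carrier_vec (adim G i)"
      using B_carrier[OF i] by (intro carrier_vecI) simp
  qed (use C As in auto)
qed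

text \<open>Closed loop dynamics under the means: the source of \<open>Fm\<close> and
  \<open>betav\<close>.\<close>

lemma next_mean_affine:
  assumes s: "s \<in> carrier_vec (sdim G)"
    and P: "\<And>j. j \<in> agents G \<Longrightarrow> P j t \<in> carrier_mat (adim G j) (sdim G)"
    and \<alpha>: "\<And>j. j \<in> agents G \<Longrightarrow> \<alpha> j t \<in> carrier_vec (adim G j)"
  shows "next_mean G s (\<lambda>j. - (P j t *\<^sub>v s) - \<alpha> j t) = Fm G P t *\<^sub>v s + betav G \<alpha> t"
proof -
  have BP: "Bm G j * P j t \<in> carrier_mat (sdim G) (sdim G)"
    "(Bm G j * P j t) *\<^sub>v s = Bm G j *\<^sub>v (P j t *\<^sub>v s)" if "j \<in> agents G" for j
    using B_carrier[OF that] P[OF that] s by auto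
  have "msum (sdim G) (sdim G) (\<lambda>j. Bm G j * P j t) (agents G) *\<^sub>v s
      = vsum (sdim G) (\<lambda>j. Bm G j *\<^sub>v (P j t *\<^sub>v s)) (agents G)"
    using BP s by (subst msum_mult_vec) (auto intro!: vsum_cong)
  then have F: "Fm G P t *\<^sub>v s = Am G *\<^sub>v s - vsum (sdim G) (\<lambda>j. Bm G j *\<^sub>v (P j t *\<^sub>v s)) (agents G)"
    by (simp only: Fm_def minus_mult_distrib_mat_vec[OF A_carrier msum_carrier s])
  have "vec_index (Bm G j *\<^sub>v (- (P j t *\<^sub>v s) - \<alpha> j t)) p
      = - vec_index (Bm G j *\<^sub>v (P j t *\<^sub>v s)) p - vec_index (Bm G j *\<^sub>v \<alpha> j t) p"
    if j: "j \<in> agents G" and p: "p < sdim G" for j p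
  proof -
    have Ps: "P j t *\<^sub>v s \<in> carrier_vec (adim G j)" using P[OF j] s by simp
    have "Bm G j *\<^sub>v (- (P j t *\<^sub>v s) - \<alpha> j t) = - (Bm G j *\<^sub>v (P j t *\<^sub>v s)) - Bm G j *\<^sub>v \<alpha> j t"
      using Ps \<alpha>[OF j] j mult_mat_vec_uminus[OF B_carrier[OF j] Ps] by (simp add: mult_B_minus)
    then show ?thesis using p B_carrier[OF j] by (simp del: index_mult_mat_vec)
  qed
  then show ?thesis
    unfolding next_mean_def F betav_def using A_carrier
    by (intro eq_vecI) (simp_all add: sum_subtractf sum_negf del: index_mult_mat_vec)
qed

lemma Fm_carrier: "Fm G P t \<in> carrier_mat (sdim G) (sdim G)"
  unfolding Fm_def by (rule minus_carrier_mat[OF msum_carrier])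

lemma betav_carrier: "betav G \<alpha> t \<in> carrier_vec (sdim G)"
  by (simp add: betav_def)

text \<open>Congruences and sums preserve semidefiniteness, and the last term is semidefinite by
  validity of the game.\<close>

lemma pos_semidef_Z_step:
  assumes i: "i \<in> agents G" and Z: "pos_semidef (sdim G) Z"
    and P: "\<And>j. j \<in> agents G \<Longrightarrow> P j t \<in> carrier_mat (adim G j) (sdim G)"
  shows "pos_semidef (sdim G) (transpose_mat (Fm G P t) * Z * Fm G P t
       + msum (sdim G) (sdim G) (\<lambda>j. transpose_mat (P j t) * Rm G i j * P j t) (agents G) + Qm G i)"
  using valid i
  by (intro pos_semidef_add pos_semidef_msum pos_semidef_congruence[OF Z Fm_carrier]
      pos_semidef_congruence[OF R_pos_semidef[OF i] P]) (auto simp: valid_game_def)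

text \<open>Origin of the recursions for \<open>Z\<close> and \<open>\<xi>\<close>. Besides the
  propagated \<open>\<xi>\<close>, the linear coefficient collects the cross terms of the
  continuation and of the control costs, whose factor 2 cancels the 1/2, and the linear state cost,
  which keeps its 1/2.\<close>

lemma stage_value_affine:
  fixes P :: "nat \<Rightarrow> nat \<Rightarrow> rmat" and \<alpha> :: "nat \<Rightarrow> nat \<Rightarrow> rvec"
  assumes i: "i \<in> agents G" and s: "s \<in> carrier_vec (sdim G)"
    and P: "\<And>j. j \<in> agents G \<Longrightarrow> P j t \<in> carrier_mat (adim G j) (sdim G)"
    and \<alpha>: "\<And>j. j \<in> agents G \<Longrightarrow> \<alpha> j t \<in> carrier_vec (adim G j)"
    and Z: "pos_semidef (sdim G) Z" and \<xi>: "\<xi> \<in> carrier_vec (sdim G)"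
  defines "m \<equiv> \<lambda>j. - (P j t *\<^sub>v s) - \<alpha> j t"
  shows "cost G i s m + quad_value Z \<xi> \<kappa> (next_mean G s m)
    = quad_value
        (transpose_mat (Fm G P t) * Z * Fm G P t
          + msum (sdim G) (sdim G) (\<lambda>j. transpose_mat (P j t) * Rm G i j * P j t) (agents G) + Qm G i)
        (transpose_mat (Fm G P t) *\<^sub>v (\<xi> + Z *\<^sub>v betav G \<alpha> t)
          + vsum (sdim G) (\<lambda>j. (transpose_mat (P j t) * Rm G i j) *\<^sub>v \<alpha> j t) (agents G) + (1/2) \<cdot>\<^sub>v lv G i)
        (1/2 * (\<Sum>j\<in>agents G. quad_form (Rm G i j) (\<alpha> j t)) + quad_value Z \<xi> \<kappa> (betav G \<alpha> t)) s"
proof -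
  let ?n = "sdim G"
  let ?F = "Fm G P t" and ?\<beta> = "betav G \<alpha> t"
  note F = Fm_carrier[of P t] and \<beta> = betav_carrier[of \<alpha> t]
  have Zc: "Z \<in> carrier_mat ?n ?n" "transpose_mat Z = Z" using Z by (auto simp: pos_semidef_def)
  have Fs: "?F *\<^sub>v s \<in> carrier_vec ?n" using F s by simp
  let ?R = "\<lambda>j. transpose_mat (P j t) * Rm G i j * P j t"
  let ?r = "\<lambda>j. (transpose_mat (P j t) * Rm G i j) *\<^sub>v \<alpha> j t"
  have Rc: "?R j \<in> carrier_mat ?n ?n" "?r j \<in> carrier_vec ?n" if "j \<in> agents G" for j
    using P[OF that] R_symmetric[OF i that] by (auto intro!: carrier_vecI)
  have R_term: "quad_form (Rm G i j) (m j) = quad_form (?R j) s + 2 * scalar_prod s (?r j) + quad_form (Rm G i j) (\<alpha> j t)"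
    if j: "j \<in> agents G" for j
  proof -
    note Rj = R_symmetric[OF i j]
    have Ps: "P j t *\<^sub>v s \<in> carrier_vec (adim G j)" using P[OF j] s by simp
    have RPs: "Rm G i j *\<^sub>v (P j t *\<^sub>v s) \<in> carrier_vec (adim G j)"
      by (rule mult_mat_vec_carrier[OF conjunct1[OF Rj] Ps])
    \<comment> \<open>The sign disappears because the quadratic form is even.\<close>
    have "m j = - (P j t *\<^sub>v s + \<alpha> j t)" using P[OF j] \<alpha>[OF j] by (auto simp: m_def vec_eq_iff)
    then have "quad_form (Rm G i j) (m j) = quad_form (Rm G i j) (P j t *\<^sub>v s + \<alpha> j t)"
      using Rj Ps \<alpha>[OF j] by (simp add: quad_form_uminus[of _ "adim G j"])
    also have "\<dots> = quad_form (Rm G i j) (P j t *\<^sub>v s) + 2 * scalar_prod (P j t *\<^sub>v s) (Rm G i j *\<^sub>v \<alpha> j t) + quad_form (Rm G i j) (\<alpha> j t)"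
      using quad_form_add[of _ "adim G j", OF _ _ Ps \<alpha>[OF j]] scalar_prod_symmetric_mat[of _ "adim G j", OF _ _ Ps \<alpha>[OF j]] Rj
      by simp
    also have "quad_form (Rm G i j) (P j t *\<^sub>v s) = quad_form (?R j) s"
      using quad_form_congruence[OF _ P[OF j] s] Rj by simp
    also have "scalar_prod (P j t *\<^sub>v s) (Rm G i j *\<^sub>v \<alpha> j t) = scalar_prod s (?r j)"
    proof -
      have "?r j = transpose_mat (P j t) *\<^sub>v (Rm G i j *\<^sub>v \<alpha> j t)"
        using P[OF j] Rj \<alpha>[OF j] by (intro assoc_mult_mat_vec[of _ ?n "adim G j"]) auto
      then show ?thesis
        using scalar_prod_mult_mat_vec[of "transpose_mat (P j t)" ?n "adim G j" s "Rm G i j *\<^sub>v \<alpha> j t"] P[OF j] s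
          mult_mat_vec_carrier[OF conjunct1[OF Rj] \<alpha>[OF j]]
        by simp
    qed
    finally show ?thesis .
  qed
  have cost: "cost G i s m = 1/2 * quad_form (Qm G i) s + 1/2 * scalar_prod s (lv G i)
      + 1/2 * quad_form (msum ?n ?n ?R (agents G)) s + scalar_prod s (vsum ?n ?r (agents G))
      + 1/2 * (\<Sum>j\<in>agents G. quad_form (Rm G i j) (\<alpha> j t))"
    using R_term Rc s l_carrier[OF i]
    by (simp add: cost_def sum.distrib sum_distrib_left[symmetric] quad_form_msum[OF Rc(1) s] scalar_prod_vsum
        comm_scalar_prod[of "lv G i" ?n s] field_simps)
  have nm: "next_mean G s m = ?F *\<^sub>v s + ?\<beta>"
    unfolding m_def using s P \<alpha> by (rule next_mean_affine)
  \<comment> \<open>Expanded about \<open>betav\<close>, with the part depending on \<open>s\<close>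
    as increment, so that the degrees in \<open>s\<close> separate.\<close>
  have "quad_value Z \<xi> \<kappa> (next_mean G s m) = quad_value Z \<xi> \<kappa> (?\<beta> + ?F *\<^sub>v s)"
    using nm comm_add_vec[OF \<beta> Fs] by simp
  also have "\<dots> = quad_value Z \<xi> \<kappa> ?\<beta> + 1/2 * quad_form (transpose_mat ?F * Z * ?F) s
      + scalar_prod (?F *\<^sub>v s) (\<xi> + Z *\<^sub>v ?\<beta>)"
    using Zc \<beta> \<xi> Fs
    by (simp only: quad_value_add[OF Zc \<xi> \<beta> Fs] quad_form_congruence[OF Zc(1) F s])
       (simp add: scalar_prod_add_distrib[of _ ?n])
  also have "scalar_prod (?F *\<^sub>v s) (\<xi> + Z *\<^sub>v ?\<beta>) = scalar_prod s (transpose_mat ?F *\<^sub>v (\<xi> + Z *\<^sub>v ?\<beta>))"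
    using scalar_prod_mult_mat_vec[of "transpose_mat ?F" ?n ?n s "\<xi> + Z *\<^sub>v ?\<beta>"] F s Zc \<xi> \<beta> by simp
  finally have val: "quad_value Z \<xi> \<kappa> (next_mean G s m) = quad_value Z \<xi> \<kappa> ?\<beta>
      + 1/2 * quad_form (transpose_mat ?F * Z * ?F) s + scalar_prod s (transpose_mat ?F *\<^sub>v (\<xi> + Z *\<^sub>v ?\<beta>))" .
  define x where "x = transpose_mat ?F *\<^sub>v (\<xi> + Z *\<^sub>v ?\<beta>)"
  have x: "x \<in> carrier_vec ?n" using F Zc \<xi> \<beta> by (simp add: x_def)
  have FZF: "transpose_mat ?F * Z * ?F \<in> carrier_mat ?n ?n" using F Zc by simp
  have lin: "scalar_prod (x + vsum ?n ?r (agents G) + (1/2) \<cdot>\<^sub>v lv G i) s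
      = scalar_prod s x + scalar_prod s (vsum ?n ?r (agents G)) + 1/2 * scalar_prod s (lv G i)"
    using x s l_carrier[OF i] by (subst comm_scalar_prod[of _ ?n])
      (simp_all add: scalar_prod_add_distrib[of _ ?n])
  have quad: "quad_form (transpose_mat ?F * Z * ?F + msum ?n ?n ?R (agents G) + Qm G i) s
      = quad_form (transpose_mat ?F * Z * ?F) s + quad_form (msum ?n ?n ?R (agents G)) s + quad_form (Qm G i) s"
    using FZF Q_symmetric[OF i] s by (simp add: quad_form_add_mat[of _ ?n] del: assoc_mult_mat)
  show ?thesis
    unfolding quad_value_def[of "_ + _"] x_def[symmetric] lin quad cost val[folded x_def] by simp
qed

end


text \<open>Links the matrix equation for \<open>P\<close> with the vector system; unit vectors give
  it for the columns, a state gives it for the linear part of the means.\<close>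

lemma (in lqg) stage_system_mat:
  assumes i: "i \<in> agents G" and Z: "pos_semidef (sdim G) Z" and v: "v \<in> carrier_vec (sdim G)"
    and P: "\<And>j. j \<in> agents G \<Longrightarrow> P j \<in> carrier_mat (adim G j) (sdim G)"
  shows "(stage_gain G i Z * P i + transpose_mat (Bm G i) * Z
      * msum (sdim G) (sdim G) (\<lambda>j. Bm G j * P j) (agents G - {i})) *\<^sub>v v
    = stage_system G i Z (\<lambda>j. P j *\<^sub>v v)"
proof -
  have Zc: "Z \<in> carrier_mat (sdim G) (sdim G)" using Z by (simp add: pos_semidef_def)
  note C = BZ_carrier[OF i Zc] and M = stage_gain(1)[OF i Z]
  have BP: "Bm G j * P j \<in> carrier_mat (sdim G) (sdim G)" "(Bm G j * P j) *\<^sub>v v = Bm G j *\<^sub>v (P j *\<^sub>v v)"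
    if "j \<in> agents G" for j
    using mult_carrier_mat[OF B_carrier[OF that] P[OF that]] assoc_mult_mat_vec[OF B_carrier[OF that] P[OF that] v]
    by auto
  have "msum (sdim G) (sdim G) (\<lambda>j. Bm G j * P j) (agents G - {i}) *\<^sub>v v
      = vsum (sdim G) (\<lambda>j. (Bm G j * P j) *\<^sub>v v) (agents G - {i})"
    by (rule msum_mult_vec) (use BP v in auto)
  also have "\<dots> = vsum (sdim G) (\<lambda>j. Bm G j *\<^sub>v (P j *\<^sub>v v)) (agents G - {i})"
    by (rule vsum_cong) (simp add: BP)
  finally show ?thesis
    unfolding stage_system_def
    by (simp only: add_mult_distrib_mat_vec[OF mult_carrier_mat[OF M P[OF i]] mult_carrier_mat[OF C msum_carrier] v]
        assoc_mult_mat_vec[OF M P[OF i] v] assoc_mult_mat_vec[OF C msum_carrier v])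
qed

text \<open>Uniqueness forces the means to be affine in the state: \<open>\<mu> s + P s + \<alpha>\<close> solves the homogeneous
  system.\<close>

lemma (in lqg) means_affine:
  fixes \<mu> :: "rvec \<Rightarrow> joint_action" and Z :: "nat \<Rightarrow> rmat" and \<xi> :: "nat \<Rightarrow> rvec"
    and P :: "nat \<Rightarrow> rmat" and \<alpha> :: "nat \<Rightarrow> rvec"
  assumes Z: "\<And>i. i \<in> agents G \<Longrightarrow> pos_semidef (sdim G) (Z i)"
    and \<mu>: "\<And>s i. s \<in> carrier_vec (sdim G) \<Longrightarrow> i \<in> agents G \<Longrightarrow> \<mu> s i \<in> carrier_vec (adim G i)"
    and sys: "\<And>s i. s \<in> carrier_vec (sdim G) \<Longrightarrow> i \<in> agents G \<Longrightarrow> stage_system G i (Z i) (\<mu> s)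
      = - ((transpose_mat (Bm G i) * Z i * Am G) *\<^sub>v s) - transpose_mat (Bm G i) *\<^sub>v \<xi> i"
    and unique: "\<And>x i. (\<And>i. i \<in> agents G \<Longrightarrow> x i \<in> carrier_vec (adim G i)) \<Longrightarrow>
      (\<And>i. i \<in> agents G \<Longrightarrow> stage_system G i (Z i) x = 0\<^sub>v (adim G i)) \<Longrightarrow> i \<in> agents G \<Longrightarrow> x i = 0\<^sub>v (adim G i)"
    and P: "\<And>i. i \<in> agents G \<Longrightarrow> P i = Matrix.mat (adim G i) (sdim G)
      (\<lambda>(p, k). vec_index (\<mu> (0\<^sub>v (sdim G)) i) p - vec_index (\<mu> (unit_vec (sdim G) k) i) p)"
    and \<alpha>: "\<And>i. i \<in> agents G \<Longrightarrow> \<alpha> i = - \<mu> (0\<^sub>v (sdim G)) i"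
    and i: "i \<in> agents G"
  shows "stage_gain G i (Z i) * P i + transpose_mat (Bm G i) * Z i
      * msum (sdim G) (sdim G) (\<lambda>j. Bm G j * P j) (agents G - {i}) = transpose_mat (Bm G i) * Z i * Am G"
    and "stage_system G i (Z i) \<alpha> = transpose_mat (Bm G i) *\<^sub>v \<xi> i"
    and "s \<in> carrier_vec (sdim G) \<Longrightarrow> \<mu> s i = - (P i *\<^sub>v s) - \<alpha> i"
proof -
  let ?n = "sdim G"
  let ?CA = "\<lambda>i. transpose_mat (Bm G i) * Z i * Am G" and ?b = "\<lambda>i. transpose_mat (Bm G i) *\<^sub>v \<xi> i"
  have Zc: "Z i \<in> carrier_mat ?n ?n" if "i \<in> agents G" for i using Z[OF that] by (simp add: pos_semidef_def)
  have CA: "?CA i \<in> carrier_mat (adim G i) ?n" if "i \<in> agents G" for i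
    by (rule mult_carrier_mat[OF BZ_carrier[OF that Zc[OF that]] A_carrier])
  have b: "?b i \<in> carrier_vec (adim G i)" if "i \<in> agents G" for i
    using B_carrier[OF that] by (intro carrier_vecI) simp
  have Pc: "P i \<in> carrier_mat (adim G i) ?n" if "i \<in> agents G" for i by (simp add: P[OF that])
  have \<alpha>c: "\<alpha> i \<in> carrier_vec (adim G i)" if "i \<in> agents G" for i
    using \<mu>[OF zero_carrier_vec that] by (simp add: \<alpha>[OF that])
  have cong: "stage_system G i (Z i) x = stage_system G i (Z i) y"
    if "\<And>j. j \<in> agents G \<Longrightarrow> x j = y j" "i \<in> agents G" for x y i
  proof -
    have "vsum ?n (\<lambda>j. Bm G j *\<^sub>v x j) (agents G - {i}) = vsum ?n (\<lambda>j. Bm G j *\<^sub>v y j) (agents G - {i})"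
      using that(1) by (intro vsum_cong) simp
    then show ?thesis using that by (simp add: stage_system_def)
  qed
  \<comment> \<open>At the zero state the term with \<open>Am G\<close> vanishes from the right-hand
    side, so \<open>\<alpha>\<close>, the negated mean there, solves its own system.\<close>
  have \<alpha>_sys: "stage_system G i (Z i) \<alpha> = ?b i" if i: "i \<in> agents G" for i
  proof -
    have "stage_system G i (Z i) \<alpha> = stage_system G i (Z i) (\<lambda>j. - \<mu> (0\<^sub>v ?n) j)"
      using \<alpha> i by (rule cong)
    also have "\<dots> = - stage_system G i (Z i) (\<mu> (0\<^sub>v ?n))"
      by (rule stage_system_uminus[OF i Z[OF i] \<mu>[OF zero_carrier_vec]])
    also have "\<dots> = - (- (?CA i *\<^sub>v 0\<^sub>v ?n) - ?b i)"
      by (simp only: sys[OF zero_carrier_vec i])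
    also have "\<dots> = ?b i"
      using b[OF i] unfolding mult_mat_vec_zero[OF CA[OF i]] by (intro eq_vecI) auto
    finally show ?thesis .
  qed
  show "stage_system G i (Z i) \<alpha> = ?b i" by (rule \<alpha>_sys[OF i])
  have P_sys: "stage_gain G i (Z i) * P i + transpose_mat (Bm G i) * Z i
      * msum ?n ?n (\<lambda>j. Bm G j * P j) (agents G - {i}) = ?CA i" (is "?L i = _") if i: "i \<in> agents G" for i
  proof -
    have Lc: "?L i \<in> carrier_mat (adim G i) ?n"
      by (rule add_carrier_mat[OF mult_carrier_mat[OF BZ_carrier[OF i Zc[OF i]] msum_carrier]])
    show ?thesis
    proof (rule mat_eqI_mult_unit[OF Lc CA[OF i]])
      fix k assume k: "k < ?n"
      let ?e = "unit_vec ?n k"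
      have e: "?e \<in> carrier_vec ?n" by simp
      \<comment> \<open>Column \<open>k\<close> is the decrease of the mean from the zero state to
        the unit vector; the sign fits the convention that means are
        \<open>- (P i *\<^sub>v s) - \<alpha> i\<close>.\<close>
      have "P j *\<^sub>v ?e = \<mu> (0\<^sub>v ?n) j + - \<mu> ?e j" if j: "j \<in> agents G" for j
        using \<mu>[OF zero_carrier_vec j] \<mu>[OF e j] k by (intro eq_vecI) (auto simp: P[OF j])
      then have "stage_system G i (Z i) (\<lambda>j. P j *\<^sub>v ?e) = stage_system G i (Z i) (\<lambda>j. \<mu> (0\<^sub>v ?n) j + - \<mu> ?e j)"
        using i by (rule cong)
      also have "\<dots> = stage_system G i (Z i) (\<mu> (0\<^sub>v ?n)) + - stage_system G i (Z i) (\<mu> ?e)"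
        using \<mu>[OF e] by (subst stage_system_plus[OF i Z[OF i] \<mu>[OF zero_carrier_vec]])
          (simp_all add: stage_system_uminus[OF i Z[OF i] \<mu>[OF e]])
      also have "\<dots> = (- (?CA i *\<^sub>v 0\<^sub>v ?n) - ?b i) + - (- (?CA i *\<^sub>v ?e) - ?b i)"
        by (simp only: sys[OF zero_carrier_vec i] sys[OF e i])
      also have "\<dots> = ?CA i *\<^sub>v ?e"
        using b[OF i] mult_mat_vec_carrier[OF CA[OF i] e] unfolding mult_mat_vec_zero[OF CA[OF i]]
        by (intro eq_vecI) (auto simp del: index_mult_mat_vec)
      finally show "?L i *\<^sub>v ?e = ?CA i *\<^sub>v ?e"
        by (simp only: stage_system_mat[OF i Z[OF i] e Pc])
    qed
  qed
  show "?L i = ?CA i" by (rule P_sys[OF i])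
  show "\<mu> s i = - (P i *\<^sub>v s) - \<alpha> i" if s: "s \<in> carrier_vec ?n"
  proof -
    \<comment> \<open>Deviation of the mean from its affine candidate; the inhomogeneous terms of
      the two systems cancel.\<close>
    define x where "x j = \<mu> s j + (P j *\<^sub>v s + \<alpha> j)" for j
    have Ps: "P j *\<^sub>v s \<in> carrier_vec (adim G j)" if "j \<in> agents G" for j
      by (rule mult_mat_vec_carrier[OF Pc[OF that] s])
    have P\<alpha>: "P j *\<^sub>v s + \<alpha> j \<in> carrier_vec (adim G j)" if "j \<in> agents G" for j
      by (rule add_carrier_vec[OF Ps[OF that] \<alpha>c[OF that]])
    have cancel: "(- u - w) + (u + w) = 0\<^sub>v d" if "u \<in> carrier_vec d" "w \<in> carrier_vec d" for u w :: rvec and d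
      using that by (intro eq_vecI) auto
    have "x i = 0\<^sub>v (adim G i)"
    proof (rule unique[OF _ _ i])
      show "x j \<in> carrier_vec (adim G j)" if "j \<in> agents G" for j
        using \<mu>[OF s that] P\<alpha>[OF that] by (simp add: x_def)
      show "stage_system G j (Z j) x = 0\<^sub>v (adim G j)" if j: "j \<in> agents G" for j
      proof -
        have "stage_system G j (Z j) x = stage_system G j (Z j) (\<mu> s)
            + (stage_system G j (Z j) (\<lambda>j. P j *\<^sub>v s) + stage_system G j (Z j) \<alpha>)"
          unfolding x_def
          by (subst stage_system_plus[OF j Z[OF j] \<mu>[OF s] P\<alpha>], assumption+)
             (simp only: stage_system_plus[OF j Z[OF j] Ps \<alpha>c])
        also have "\<dots> = (- (?CA j *\<^sub>v s) - ?b j) + (?CA j *\<^sub>v s + ?b j)"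
          by (simp only: sys[OF s j] \<alpha>_sys[OF j] stage_system_mat[OF j Z[OF j] s Pc, symmetric] P_sys[OF j])
        also have "\<dots> = 0\<^sub>v (adim G j)"
          by (rule cancel[OF mult_mat_vec_carrier[OF CA[OF j] s] b[OF j]])
        finally show ?thesis .
      qed
    qed
    then have "\<mu> s i + (P i *\<^sub>v s + \<alpha> i) = 0\<^sub>v (adim G i)" by (simp only: x_def)
    moreover have "u = - w - z"
      if 0: "u + (w + z) = 0\<^sub>v d" and c: "u \<in> carrier_vec d" "w \<in> carrier_vec d" "z \<in> carrier_vec d"
      for u w z :: rvec and d
    proof (rule eq_vecI)
      fix p assume "p < dim_vec (- w - z)"
      then have p: "p < d" using c by simp
      have "vec_index (u + (w + z)) p = 0" unfolding 0 using p by simp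
      then show "vec_index u p = vec_index (- w - z) p" using p c by simp
    qed (use c in auto)
    ultimately show ?thesis using \<mu>[OF s i] Ps[OF i] \<alpha>c[OF i] by blast
  qed
qed


section \<open>Equilibria of the game\<close>

lemma (in lqg_policy) equilibrium_recursion:
  assumes us: "uniquely_solvable G" and ece: "is_ECE G \<pi>"
  shows "\<exists>P \<alpha> Z \<xi>. solves_from G 1 P \<alpha> Z \<xi> \<and>
    (\<forall>i\<in>agents G. \<forall>t\<in>{1..<horizon G}.
       pos_def (adim G i) (gain G Z i t) \<and>
       (\<forall>s\<in>carrier_vec (sdim G). \<forall>a\<in>carrier_vec (adim G i).
          \<pi> i t s a = mvn_density (- (P i t *\<^sub>v s) - \<alpha> i t) (minv (gain G Z i t)) a))"
proof -
  let ?n = "sdim G" and ?T = "horizon G"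
  let ?C = "carrier_vec (sdim G) :: rvec set"
  text \<open>A Gaussian density determines its mean as its mode. This allows \<open>P\<close> and \<open>\<alpha>\<close> to be defined from
    \<open>\<pi>\<close> at all times at once, before the recursion for \<open>Z\<close> and \<open>\<xi>\<close>.\<close>
  define is_mode where "is_mode i t s m \<longleftrightarrow> m \<in> carrier_vec (adim G i) \<and>
    (\<forall>x\<in>carrier_vec (adim G i). x \<noteq> m \<longrightarrow> \<pi> i t s x < \<pi> i t s m)" for i t s m
  define \<mu> where "\<mu> i t s = (SOME m. is_mode i t s m)" for i t s
  have mode: "\<mu> i t s = m" if "is_mode i t s m" for i t s m
  proof -
    have "is_mode i t s (\<mu> i t s)" unfolding \<mu>_def by (rule someI[of "is_mode i t s", OF that])
    then show ?thesis using that unfolding is_mode_def by (metis less_asym)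
  qed
  define P where "P i t = Matrix.mat (adim G i) ?n
    (\<lambda>(p, k). vec_index (\<mu> i t (0\<^sub>v ?n)) p - vec_index (\<mu> i t (unit_vec ?n k)) p)" for i t
  define \<alpha> where "\<alpha> i t = Matrix.vec (adim G i) (\<lambda>p. - vec_index (\<mu> i t (0\<^sub>v ?n)) p)" for i t
  have Pc: "P i t \<in> carrier_mat (adim G i) ?n" for i t by (simp add: P_def)
  have \<alpha>c: "\<alpha> i t \<in> carrier_vec (adim G i)" for i t by (simp add: \<alpha>_def)

  \<comment> \<open>With \<open>P\<close> and \<open>\<alpha>\<close> fixed, the recursions for
    \<open>Z\<close> and then \<open>\<xi>\<close> are explicit; the equations still to be proved
    are \<open>P_eq\<close> and \<open>alpha_eq\<close>.\<close>
  have "\<forall>i. \<exists>Z. Z ?T = Qm G i \<and> (\<forall>t<?T. Z t = transpose_mat (Fm G P t) * Z (Suc t) * Fm G P t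
      + msum ?n ?n (\<lambda>j. transpose_mat (P j t) * Rm G i j * P j t) (agents G) + Qm G i)"
    by (intro allI backward_recursion)
  from choice[OF this] obtain Z where Z: "\<And>i. Z i ?T = Qm G i"
    "\<And>i t. t < ?T \<Longrightarrow> Z i t = transpose_mat (Fm G P t) * Z i (Suc t) * Fm G P t
      + msum ?n ?n (\<lambda>j. transpose_mat (P j t) * Rm G i j * P j t) (agents G) + Qm G i"
    by blast
  have "\<forall>i. \<exists>\<xi>. \<xi> ?T = (1/2) \<cdot>\<^sub>v lv G i \<and> (\<forall>t<?T. \<xi> t =
      transpose_mat (Fm G P t) *\<^sub>v (\<xi> (Suc t) + Z i (Suc t) *\<^sub>v betav G \<alpha> t)
      + vsum ?n (\<lambda>j. (transpose_mat (P j t) * Rm G i j) *\<^sub>v \<alpha> j t) (agents G) + (1/2) \<cdot>\<^sub>v lv G i)"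
    by (intro allI backward_recursion)
  from choice[OF this] obtain \<xi> where \<xi>: "\<And>i. \<xi> i ?T = (1/2) \<cdot>\<^sub>v lv G i"
    "\<And>i t. t < ?T \<Longrightarrow> \<xi> i t =
      transpose_mat (Fm G P t) *\<^sub>v (\<xi> i (Suc t) + Z i (Suc t) *\<^sub>v betav G \<alpha> t)
      + vsum ?n (\<lambda>j. (transpose_mat (P j t) * Rm G i j) *\<^sub>v \<alpha> j t) (agents G) + (1/2) \<cdot>\<^sub>v lv G i"
    by blast

  text \<open>\<open>Zn\<close>, \<open>\<xi>n\<close>, \<open>\<kappa>n\<close> describe the cost from the next stage on, which vanishes after the last stage.\<close>
  define Zn where "Zn i t = (if t = ?T then 0\<^sub>m ?n ?n else Z i (Suc t))" for i t
  define \<xi>n where "\<xi>n i t = (if t = ?T then 0\<^sub>v ?n else \<xi> i (Suc t))" for i t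
  define \<gamma> where "\<gamma> i t = (\<integral>w. 1/2 * quad_form (Z i t) w \<partial>noise_law ?n)" for i t
  define \<nu> where "\<nu> i t = (\<integral>e. stage_noise_cost G i (Zn i t) e
    \<partial>centred_action_law G (\<lambda>j. stage_gain G j (Zn j t)) (agents G))" for i t
  \<comment> \<open>Constant terms: the last coefficient of \<open>quad_value\<close> in
    \<open>stage_value_affine\<close>, plus the cost \<open>\<nu>\<close> of the randomness of the
    actions. The noise of the dynamics enters as \<open>\<gamma>\<close> of the next stage.\<close>
  have "\<forall>i. \<exists>\<kappa>. \<kappa> ?T = \<nu> i ?T \<and> (\<forall>t<?T. \<kappa> t =
      1/2 * (\<Sum>j\<in>agents G. quad_form (Rm G i j) (\<alpha> j t))
      + quad_value (Z i (Suc t)) (\<xi> i (Suc t)) (\<kappa> (Suc t) + \<gamma> i (Suc t)) (betav G \<alpha> t) + \<nu> i t)"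
    by (intro allI backward_recursion)
  from choice[OF this] obtain \<kappa> where \<kappa>: "\<And>i. \<kappa> i ?T = \<nu> i ?T"
    "\<And>i t. t < ?T \<Longrightarrow> \<kappa> i t = 1/2 * (\<Sum>j\<in>agents G. quad_form (Rm G i j) (\<alpha> j t))
      + quad_value (Z i (Suc t)) (\<xi> i (Suc t)) (\<kappa> i (Suc t) + \<gamma> i (Suc t)) (betav G \<alpha> t) + \<nu> i t"
    by blast
  define \<kappa>n where "\<kappa>n i t = (if t = ?T then 0 else \<kappa> i (Suc t) + \<gamma> i (Suc t))" for i t
  define V where "V i t = quad_value (Z i t) (\<xi> i t) (\<kappa> i t)" for i t

  have Z_psd: "pos_semidef ?n (Z i t)" if i: "i \<in> agents G" and "t \<le> ?T" for i t
    using that(2)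
  proof (induction t rule: inc_induct)
    case base
    show ?case using valid i by (simp add: Z(1) valid_game_def)
  next
    case (step t)
    show ?case unfolding Z(2)[OF step.hyps(2)] by (rule pos_semidef_Z_step[OF i step.IH Pc])
  qed
  have Zc: "Z i t \<in> carrier_mat ?n ?n" "transpose_mat (Z i t) = Z i t" if "i \<in> agents G" "t \<le> ?T" for i t
    using Z_psd[OF that] by (auto simp: pos_semidef_def)
  have \<xi>c: "\<xi> i t \<in> carrier_vec ?n" if i: "i \<in> agents G" and t: "t \<le> ?T" for i t
  proof (cases "t = ?T")
    case False
    then have tT: "t < ?T" using t by simp
    have "transpose_mat (Fm G P t) *\<^sub>v y \<in> carrier_vec ?n" for y
      using Fm_carrier[of P t] by (intro carrier_vecI) simp
    then show ?thesis
      unfolding \<xi>(2)[OF tT] using l_carrier[OF i] by (intro add_carrier_vec) auto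
  qed (use \<xi>(1) l_carrier[OF i] in simp)
  have zero_mult: "0\<^sub>m d ?n *\<^sub>v v = (0\<^sub>v d :: rvec)" if "v \<in> carrier_vec ?n" for v d
    using that by (auto simp: vec_eq_iff)
  have psd0: "pos_semidef ?n (0\<^sub>m ?n ?n)"
    by (simp add: pos_semidef_def quad_form_def zero_mult)
  have Zn_psd: "pos_semidef ?n (Zn i t)" if "i \<in> agents G" "t \<le> ?T" for i t
    using Z_psd[OF that(1), of "Suc t"] that(2) psd0 by (simp add: Zn_def)
  have Znc: "Zn i t \<in> carrier_mat ?n ?n" "transpose_mat (Zn i t) = Zn i t" if "i \<in> agents G" "t \<le> ?T" for i t
    using Zn_psd[OF that] by (auto simp: pos_semidef_def)
  have \<xi>nc: "\<xi>n i t \<in> carrier_vec ?n" if "i \<in> agents G" "t \<le> ?T" for i t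
    using \<xi>c[OF that(1), of "Suc t"] that(2) by (simp add: \<xi>n_def)
  \<comment> \<open>Zero coefficients absorb the case distinction at the horizon, beyond which
    \<open>V\<close> has no meaning.\<close>
  have H: "(if k = ?T then 0 else V i (Suc k) y + \<gamma> i (Suc k)) = quad_value (Zn i k) (\<xi>n i k) (\<kappa>n i k) y"
    if "y \<in> ?C" for i k and y :: rvec
    using that by (simp add: V_def Zn_def \<xi>n_def \<kappa>n_def quad_value_def quad_form_def zero_mult)

  \<comment> \<open>The integrability premise is that of \<open>V_stage\<close> in
    \<open>integral_cost_to_go\<close>.\<close>
  define stage_value where "stage_value t \<longleftrightarrow> (\<forall>i\<in>agents G. \<forall>s\<in>?C.
      integrable (action_law G \<pi> t (agents G) s)
        (\<lambda>a. cost G i s a + quad_value (Zn i t) (\<xi>n i t) (\<kappa>n i t) (next_mean G s a)) \<longrightarrow>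
      (\<integral>a. cost G i s a + quad_value (Zn i t) (\<xi>n i t) (\<kappa>n i t) (next_mean G s a)
        \<partial>action_law G \<pi> t (agents G) s) = V i t s)" for t
  define coefficients where "coefficients t \<longleftrightarrow> (\<forall>i\<in>agents G. P_eq G P Z i t \<and> alpha_eq G \<alpha> Z \<xi> i t \<and>
      (\<forall>s\<in>?C. \<forall>a\<in>carrier_vec (adim G i).
        \<pi> i t s a = mvn_density (- (P i t *\<^sub>v s) - \<alpha> i t) (minv (gain G Z i t)) a))" for t
  have solves: "solves_from G t P \<alpha> Z \<xi>" if "\<And>k. t \<le> k \<Longrightarrow> k < ?T \<Longrightarrow> coefficients k" for t
    using that Z \<xi> Pc \<alpha>c unfolding solves_from_def coefficients_def Z_rec_def xi_rec_def by auto

  \<comment> \<open>Strong induction on the distance to the horizon: the Q functions use the values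
    of all later stages, and unique solvability at \<open>t\<close> presupposes a solution from
    \<open>Suc t\<close> on.\<close>
  have stage: "stage_value t \<and> (t < ?T \<longrightarrow> coefficients t)" if "1 \<le> t" "t \<le> ?T" for t
    using that
  proof (induction "?T - t" arbitrary: t rule: less_induct)
    case less
    have t: "t \<in> {1..?T}" using less.prems by simp
    have later: "stage_value k" "k < ?T \<Longrightarrow> coefficients k" if "k \<in> {t<..?T}" for k
      using less.hyps[of k] that less.prems by auto
    have Q: "Qfun G \<pi> i t s a = cost G i s a + quad_value (Zn i t) (\<xi>n i t) (\<kappa>n i t) (next_mean G s a)"
      if i: "i \<in> agents G" and s: "s \<in> ?C" and a: "a \<in> space (action_space G (agents G))" for i s a
    proof -
      have int: "integrable (trajectory_law G \<pi> t s a (?T - t)) (cost_to_go G i t)"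
        using ece i t s a unfolding is_ECE_def Q_defined_def by blast
      have "(\<integral>\<omega>. cost_to_go G i t \<omega> \<partial>trajectory_law G \<pi> t s a (?T - t))
          = (if t = ?T then 0 else V i (Suc t) (next_mean G s a) + \<gamma> i (Suc t))"
      proof (rule integral_cost_to_go[OF i _ _ _ less.prems(2) s a int])
        fix k assume k: "k \<in> {t<..?T}"
        then have kT: "k \<le> ?T" by simp
        show "V i k \<in> borel_measurable (lborel_vec ?n)"
          unfolding V_def using borel_measurable_quad_value[OF Zc(1)[OF i kT] \<xi>c[OF i kT], of "\<lambda>x. x" "lborel_vec ?n"]
          by simp
        fix s' assume s': "s' \<in> ?C"
        show "(\<integral>a. cost G i s' a + (if k = ?T then 0 else V i (Suc k) (next_mean G s' a) + \<gamma> i (Suc k))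
            \<partial>action_law G \<pi> k (agents G) s') = V i k s'"
          if "integrable (action_law G \<pi> k (agents G) s')
            (\<lambda>a. cost G i s' a + (if k = ?T then 0 else V i (Suc k) (next_mean G s' a) + \<gamma> i (Suc k)))"
          using later(1)[OF k] that i s' unfolding stage_value_def H[OF next_mean_carrier[OF s']] by blast
        fix a'
        assume "integrable (next_state_law G s' a') (V i k)"
        then show "(\<integral>y. V i k y \<partial>next_state_law G s' a') = V i k (next_mean G s' a') + \<gamma> i k"
          unfolding V_def \<gamma>_def by (rule integral_next_state_quad_value[OF Zc[OF i kT] \<xi>c[OF i kT] s'])
      qed
      then show ?thesis unfolding Qfun_def H[OF next_mean_carrier[OF s]] by simp
    qed
    let ?M = "\<lambda>i. stage_gain G i (Zn i t)"
    have "\<exists>m. \<forall>i\<in>agents G. m i \<in> carrier_vec (adim G i) \<and>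
        (\<forall>a\<in>carrier_vec (adim G i). \<pi> i t s a = mvn_density (m i) (minv (?M i)) a) \<and>
        ?M i *\<^sub>v m i + stage_gradient G i (Zn i t) (\<xi>n i t) s m = 0\<^sub>v (adim G i)" if s: "s \<in> ?C" for s
    proof (rule stage_equilibrium[where Z = "\<lambda>i. Zn i t" and \<xi> = "\<lambda>i. \<xi>n i t" and \<kappa> = "\<lambda>i. \<kappa>n i t",
          OF ece t s Zn_psd[OF _ less.prems(2)] \<xi>nc[OF _ less.prems(2)] Q[OF _ s]])
      fix m
      assume "\<And>i. i \<in> agents G \<Longrightarrow> m i \<in> carrier_vec (adim G i)"
        "\<And>i a. i \<in> agents G \<Longrightarrow> a \<in> carrier_vec (adim G i) \<Longrightarrow> \<pi> i t s a = mvn_density (m i) (minv (?M i)) a"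
        "\<And>i. i \<in> agents G \<Longrightarrow> ?M i *\<^sub>v m i + stage_gradient G i (Zn i t) (\<xi>n i t) s m = 0\<^sub>v (adim G i)"
      then show ?thesis by (intro exI[of _ m]) simp
    qed
    then have "\<forall>s\<in>?C. \<exists>m. \<forall>i\<in>agents G. m i \<in> carrier_vec (adim G i) \<and>
        (\<forall>a\<in>carrier_vec (adim G i). \<pi> i t s a = mvn_density (m i) (minv (?M i)) a) \<and>
        ?M i *\<^sub>v m i + stage_gradient G i (Zn i t) (\<xi>n i t) s m = 0\<^sub>v (adim G i)" by blast
    from bchoice[OF this]
    obtain m where m: "\<And>s i. s \<in> ?C \<Longrightarrow> i \<in> agents G \<Longrightarrow> m s i \<in> carrier_vec (adim G i)"
      and gauss: "\<And>s i a. s \<in> ?C \<Longrightarrow> i \<in> agents G \<Longrightarrow> a \<in> carrier_vec (adim G i) \<Longrightarrow>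
        \<pi> i t s a = mvn_density (m s i) (minv (?M i)) a"
      and foc: "\<And>s i. s \<in> ?C \<Longrightarrow> i \<in> agents G \<Longrightarrow>
        ?M i *\<^sub>v m s i + stage_gradient G i (Zn i t) (\<xi>n i t) s (m s) = 0\<^sub>v (adim G i)"
      by auto
    have M: "pos_def (adim G i) (?M i)" if "i \<in> agents G" for i
      by (rule stage_gain(3)[OF that Zn_psd[OF that less.prems(2)]])
    \<comment> \<open>The modes chosen at the outset are the equilibrium means, which ties
      \<open>P\<close> and \<open>\<alpha>\<close> to the stage at hand.\<close>
    have \<mu>m: "\<mu> i t s = m s i" if s: "s \<in> ?C" and i: "i \<in> agents G" for s i
      using m[OF s i] mvn_density_less_mode[OF M[OF i] m[OF s i]] gauss[OF s i]
      by (intro mode) (simp add: is_mode_def)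
    have value_eq: "(\<integral>a. cost G i s a + quad_value (Zn i t) (\<xi>n i t) (\<kappa>n i t) (next_mean G s a)
        \<partial>action_law G \<pi> t (agents G) s)
      = cost G i s (m s) + quad_value (Zn i t) (\<xi>n i t) (\<kappa>n i t) (next_mean G s (m s)) + \<nu> i t"
      if i: "i \<in> agents G" and s: "s \<in> ?C" and int: "integrable (action_law G \<pi> t (agents G) s)
        (\<lambda>a. cost G i s a + quad_value (Zn i t) (\<xi>n i t) (\<kappa>n i t) (next_mean G s a))" for i s
      unfolding \<nu>_def
      by (rule integral_stage_cost[OF i t s M m[OF s] gauss[OF s] Znc[OF i less.prems(2)] \<xi>nc[OF i less.prems(2)] int])
    show ?case
    proof (cases "t = ?T")
      case True
      \<comment> \<open>Without continuation cost the gradient vanishes, and positive definiteness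
        of the gain forces the means to be zero.\<close>
      have m_zero: "m s i = 0\<^sub>v (adim G i)" if s: "s \<in> ?C" and i: "i \<in> agents G" for s i
      proof (rule ccontr)
        assume "m s i \<noteq> 0\<^sub>v (adim G i)"
        then have "0 < quad_form (?M i) (m s i)" using M[OF i] m[OF s i] by (simp add: pos_def_def)
        moreover have "stage_gradient G i (Zn i t) (\<xi>n i t) s (m s) = 0\<^sub>v (adim G i)"
        proof -
          have B: "transpose_mat (Bm G i) \<in> carrier_mat (adim G i) ?n" using B_carrier[OF i] by simp
          have "Am G *\<^sub>v s + vsum ?n (\<lambda>j. Bm G j *\<^sub>v m s j) (agents G - {i}) \<in> carrier_vec ?n"
            by (rule add_carrier_vec[OF mult_mat_vec_carrier[OF A_carrier s] vsum_carrier])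
          then show ?thesis
            using True by (simp add: stage_gradient_def Zn_def \<xi>n_def right_mult_zero_mat[OF B] mult_mat_vec_zero[OF B] zero_mult)
        qed
        then have "?M i *\<^sub>v m s i = 0\<^sub>v (adim G i)"
          using foc[OF s i] M[OF i] m[OF s i] by (auto simp: pos_def_def)
        then have "quad_form (?M i) (m s i) = 0" using m[OF s i] by (simp add: quad_form_def)
        ultimately show False by simp
      qed
      \<comment> \<open>Only the state cost remains, which matches the terminal values
        \<open>Qm G i\<close> and \<open>(1/2) \<cdot>\<^sub>v lv G i\<close>.\<close>
      have "cost G i s (m s) = V i t s - \<nu> i t" if i: "i \<in> agents G" and s: "s \<in> ?C" for i s
      proof -
        have "quad_form (Rm G i j) (m s j) = 0" if j: "j \<in> agents G" for j
          using m_zero[OF s j] R_symmetric[OF i j]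
          by (auto simp: quad_form_def intro!: scalar_prod_left_zero mult_mat_vec_carrier)
        then show ?thesis
          using l_carrier[OF i] s by (simp add: cost_def V_def True Z(1) \<xi>(1) \<kappa>(1) quad_value_def)
      qed
      moreover have "quad_value (Zn i t) (\<xi>n i t) (\<kappa>n i t) (next_mean G s (m s)) = 0" if "s \<in> ?C" for i s
        unfolding H[OF next_mean_carrier[OF that], symmetric] using True by simp
      ultimately show ?thesis
        unfolding stage_value_def using value_eq True by simp
    next
      case False
      then have tT: "t < ?T" using less.prems by simp
      have n: "Zn i t = Z i (Suc t)" "\<xi>n i t = \<xi> i (Suc t)" "\<kappa>n i t = \<kappa> i (Suc t) + \<gamma> i (Suc t)" for i
        using False by (auto simp: Zn_def \<xi>n_def \<kappa>n_def)
      have gain_eq: "gain G Z i t = ?M i" for i by (simp add: gain_def stage_gain_def n)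
      \<comment> \<open>\<open>uniquely_solvable\<close> speaks of solutions from
        \<open>Suc t\<close> on; the induction hypothesis provides one.\<close>
      have unique: "x i = 0\<^sub>v (adim G i)"
        if "\<And>i. i \<in> agents G \<Longrightarrow> x i \<in> carrier_vec (adim G i)"
          "\<And>i. i \<in> agents G \<Longrightarrow> stage_system G i (Zn i t) x = 0\<^sub>v (adim G i)" "i \<in> agents G" for x i
      proof -
        have "solves_from G (Suc t) P \<alpha> Z \<xi>" using later(2) by (intro solves) auto
        then show ?thesis
          using us[unfolded uniquely_solvable_def, rule_format, of t P \<alpha> Z \<xi> x i] tT t that
          by (simp add: stage_system_def gain_eq n)
      qed
      have sys: "stage_system G i (Zn i t) (m s)
          = - ((transpose_mat (Bm G i) * Zn i t * Am G) *\<^sub>v s) - transpose_mat (Bm G i) *\<^sub>v \<xi>n i t"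
        if "s \<in> ?C" "i \<in> agents G" for s i
        by (rule stage_gain_gradient[OF that(2) Zn_psd[OF that(2) less.prems(2)] that(1) foc[OF that]])
      have P_eq_m: "P i t = Matrix.mat (adim G i) ?n (\<lambda>(p, k). vec_index (m (0\<^sub>v ?n) i) p - vec_index (m (unit_vec ?n k) i) p)"
        and \<alpha>_eq_m: "\<alpha> i t = - m (0\<^sub>v ?n) i" if i: "i \<in> agents G" for i
        using m[OF zero_carrier_vec i] by (auto simp: P_def \<alpha>_def \<mu>m[OF _ i] vec_eq_iff)
      have P_sys: "?M i * P i t + transpose_mat (Bm G i) * Zn i t
            * msum ?n ?n (\<lambda>j. Bm G j * P j t) (agents G - {i}) = transpose_mat (Bm G i) * Zn i t * Am G"
        and \<alpha>_sys: "stage_system G i (Zn i t) (\<lambda>j. \<alpha> j t) = transpose_mat (Bm G i) *\<^sub>v \<xi>n i t"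
        if i: "i \<in> agents G" for i
        by (rule means_affine(1,2)[where Z = "\<lambda>i. Zn i t" and \<mu> = m and \<xi> = "\<lambda>i. \<xi>n i t" and P = "\<lambda>i. P i t" and \<alpha> = "\<lambda>i. \<alpha> i t"]; fact Zn_psd[OF _ less.prems(2)] m sys unique P_eq_m \<alpha>_eq_m i)+
      have m_affine: "m s i = - (P i t *\<^sub>v s) - \<alpha> i t" if i: "i \<in> agents G" and s: "s \<in> ?C" for i s
        by (rule means_affine(3)[where Z = "\<lambda>i. Zn i t" and \<mu> = m and \<xi> = "\<lambda>i. \<xi>n i t" and P = "\<lambda>i. P i t" and \<alpha> = "\<lambda>i. \<alpha> i t"]; fact Zn_psd[OF _ less.prems(2)] m sys unique P_eq_m \<alpha>_eq_m i s)
      have coeff: "coefficients t"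
        unfolding coefficients_def
      proof (intro ballI conjI)
        fix i assume i: "i \<in> agents G"
        show "P_eq G P Z i t"
          using P_sys[OF i] by (simp add: P_eq_def gain_eq n)
        show "alpha_eq G \<alpha> Z \<xi> i t"
          using \<alpha>_sys[OF i] by (simp add: alpha_eq_def stage_system_def gain_eq n)
        fix s a :: rvec assume "s \<in> ?C" "a \<in> carrier_vec (adim G i)"
        then show "\<pi> i t s a = mvn_density (- (P i t *\<^sub>v s) - \<alpha> i t) (minv (gain G Z i t)) a"
          using m_affine[OF i] gauss[OF _ i] by (simp add: gain_eq)
      qed
      have "V i t s = cost G i s (m s) + quad_value (Zn i t) (\<xi>n i t) (\<kappa>n i t) (next_mean G s (m s)) + \<nu> i t"
        if i: "i \<in> agents G" and s: "s \<in> ?C" for i s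
      proof -
        let ?m = "\<lambda>j. - (P j t *\<^sub>v s) - \<alpha> j t"
        \<comment> \<open>The two joint actions are known to agree only on the agents, hence the
          congruence rules.\<close>
        have "cost G i s (m s) = cost G i s ?m" "next_mean G s (m s) = next_mean G s ?m"
          using m_affine[OF _ s] by (auto intro!: cost_cong next_mean_cong)
        moreover have "cost G i s ?m + quad_value (Zn i t) (\<xi>n i t) (\<kappa>n i t) (next_mean G s ?m) + \<nu> i t = V i t s"
        proof -
          have "cost G i s ?m + quad_value (Zn i t) (\<xi>n i t) (\<kappa>n i t) (next_mean G s ?m)
            = quad_value (Z i t) (\<xi> i t) (1/2 * (\<Sum>j\<in>agents G. quad_form (Rm G i j) (\<alpha> j t))
                + quad_value (Zn i t) (\<xi>n i t) (\<kappa>n i t) (betav G \<alpha> t)) s"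
            unfolding Z(2)[OF tT] \<xi>(2)[OF tT] n(1,2)[symmetric]
            by (rule stage_value_affine[OF i s Pc \<alpha>c Zn_psd[OF i less.prems(2)] \<xi>nc[OF i less.prems(2)]])
          then show ?thesis by (simp add: V_def \<kappa>(2)[OF tT] n quad_value_def)
        qed
        ultimately show ?thesis by simp
      qed
      then have "stage_value t"
        unfolding stage_value_def using value_eq by simp
      then show ?thesis using coeff by simp
    qed
  qed
  have "solves_from G 1 P \<alpha> Z \<xi>"
    using stage by (intro solves) auto
  moreover have "pos_def (adim G i) (gain G Z i t)" if "i \<in> agents G" "t \<in> {1..<?T}" for i t
    using stage_gain(3)[OF that(1) Z_psd[OF that(1), of "Suc t"]] that(2) by (simp add: gain_def stage_gain_def)
  moreover have "\<pi> i t s a = mvn_density (- (P i t *\<^sub>v s) - \<alpha> i t) (minv (gain G Z i t)) a"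
    if "i \<in> agents G" "t \<in> {1..<?T}" "s \<in> ?C" "a \<in> carrier_vec (adim G i)" for i t s a
    using stage[of t] that unfolding coefficients_def by auto
  ultimately show ?thesis by blast
qed

theorem theorem2:
  fixes G :: lqg_game and \<pi> :: policies
  assumes "valid_game G"
    and "uniquely_solvable G"
    and "is_ECE G \<pi>"
  shows "\<exists>P \<alpha> Z \<xi>. solves_from G 1 P \<alpha> Z \<xi> \<and>
    (\<forall>i\<in>agents G. \<forall>t\<in>{1..<horizon G}.
       pos_def (adim G i) (gain G Z i t) \<and>
       (\<forall>s\<in>carrier_vec (sdim G). \<forall>a\<in>carrier_vec (adim G i).
          \<pi> i t s a = mvn_density (- (P i t *\<^sub>v s) - \<alpha> i t) (minv (gain G Z i t)) a))"
proof -
  interpret lqg_policy G \<pi>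
    using assms by unfold_locales (simp_all add: is_ECE_def)
  show ?thesis using assms(2,3) by (rule equilibrium_recursion)
qed

end
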